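(* (Reynolds transport theorem.) Assume the standing assumptions, let $X$ be the flow map defined in the context, let $A\subset\Omega$ be Borel measurable and let $\{X(s,t,A\setminus \dot N^{s,t}_A)\}_{s,t\in\mathbb R}$ be a regular co-moving volume. Then for every $C^1$ function $g:\mathbb R\times\mathbb R^3\to\mathbb R$ and all $s,t\in\mathbb R$: $$\int_{X(s,t,A\setminus \dot N_A^{s,t})} g(s,x)\,dx=\int_A g(t,x)\,dx+\int_t^s\int_{X(r,t,A\setminus \dot N_A^{r,t})}\Big\{\partial_r g(r,x)+\nabla\cdot\big(g(r,x)v(r,x)\big)\Big\}dx\,dr,$$ $$\int_{X(s,t,\cdot)^{-1}(A)} g(t,x)\,dx=\int_A g(s,x)\,dx+\int_s^t\int_{X(s,r,\cdot)^{-1}(A)}\Big\{\partial_r g(r,x)+\nabla\cdot\big(g(r,x)v(r,x)\big)\Big\}dx\,dr,$$ $$\mathrm{meas}\big(X(s,t,A\setminus \dot N_A^{s,t})\big)=\mathrm{meas}(A)+\int_t^s\int_{X(r,t,A\setminus \dot N_A^{r,t})}\nabla\cdot v(r,x)\,dx\,dr,$$ $$\mathrm{meas}\big(X(s,t,\cdot)^{-1}(A)\big)=\mathrm{meas}(A)+\int_s^t\int_{X(s,r,\cdot)^{-1}(A)}\nabla\cdot v(r,x)\,dx\,dr,$$ where all integrands in $r$ are measurable and integrable.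
   Context: Standing assumptions: $\Omega\subset\mathbb R^3$ is a bounded connected open set with $\mathrm{meas}(\Omega)=\mathrm{meas}(\overline\Omega)$. $v=(v_1,v_2,v_3):\mathbb R\times\Omega\to\mathbb R^3$ is measurable with $v_i\in L^1([T_0,T_1]\times\Omega)$ for all $T_0<T_1$; weak spatial derivatives $\partial_{x_j}v_i\in L^1([T_0,T_1]\times\Omega)$ for all $T_0<T_1$; $v_i(t,\cdot)\in W^{1,1}_0(\Omega)$ for a.e. $t$; and $\int_{T_0}^{T_1}\|\nabla\cdot v(t,\cdot)\|_{L^\infty(\Omega)}dt<\infty$ for all $T_0<T_1$. $v$ is extended by $0$ outside $\mathbb R\times\Omega$. Approximating flows: fix an open ball $K\supset\overline\Omega$ and a sequence $\varepsilon_k\searrow0$ with $\varepsilon_1>0$ small. $v^k$ is the convolution of the zero-extended $v$ with the standard mollifier on $\mathbb R^4=\mathbb R_t\times\mathbb R^3_x$ at scale $\varepsilon_k$; thus $v^k$ is smooth, $\mathrm{supp}\,v^k\subset\mathbb R\times K$. $X^k(s,t,\xi)$ denotes the value at time $s$ of the solution of $x'(s)=v^k(s,x(s))$, $x(t)=\xi$; $X^k(s,t,\cdot)$ is a $C^1$-diffeomorphism of $K$ with inverse $X^k(t,s,\cdot)$. Flow map $X$: for all $s,t$, $X^k(s,t,\cdot)|_\Omega$ converges in $L^2(\Omega)^3$ as $k\to\infty$, and for each $t$ and $T_0<T_1$, $X^k(\cdot,t,\cdot)$ converges in $L^2([T_0,T_1]\times\Omega)^3$; $X:\mathbb R\times\mathbb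 R\times\Omega\to\overline\Omega$ is the limit, taken so that for each $t$, $(s,x)\mapsto X(s,t,x)$ is measurable and $X(s,t,\cdot)$ is the $L^2(\Omega)$-limit for every $s$. Notation: $X(s,t,\cdot)^{-1}(A)=\{x\in\Omega:X(s,t,x)\in A\}$; $E^{s,t}:=\{x\in\Omega: X(t,s,X(s,t,x))\neq x\}$ (a null set). Regular co-moving volume: for a Borel set $A\subset\Omega$ and each $s,t$, let $\dot N^{s,t}_A$ be a null set such that $X(s,t,A\setminus\dot N^{s,t}_A)$ is Lebesgue measurable and $A\setminus \dot N^{s,t}_A$ contains no point of $E^{s,t}$; the family $\{X(s,t,A\setminus\dot N^{s,t}_A)\}_{s,t\in\mathbb R}$ is called a regular co-moving volume. Integrals $\int_t^s$ with $s<t$ are oriented ($\int_t^s=-\int_s^t$). *)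

theory Defs
  imports "HOL-Analysis.Analysis" "HOL-Probability.Essential_Supremum"
begin

fun Ck :: "nat \<Rightarrow> ('a::euclidean_space \<Rightarrow> real) \<Rightarrow> bool" where
  "Ck 0 f = continuous_on UNIV f"
| "Ck (Suc n) f = ((\<forall>x. f differentiable (at x)) \<and>
      (\<forall>b\<in>Basis. Ck n (\<lambda>x. frechet_derivative f (at x) b)))"

definition smooth_fun :: "('a::euclidean_space \<Rightarrow> real) \<Rightarrow> bool" where
  "smooth_fun f \<longleftrightarrow> (\<forall>n. Ck n f)"

definition test_fun :: "('a::euclidean_space \<Rightarrow> real) \<Rightarrow> 'a set \<Rightarrow> bool" where
  "test_fun \<phi> U \<longleftrightarrow> smooth_fun \<phi> \<and> compact (closure {z. \<phi> z \<noteq> 0})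
      \<and> closure {z. \<phi> z \<noteq> 0} \<subseteq> U"

definition dt :: "(real \<times> (real^3) \<Rightarrow> real) \<Rightarrow> real \<times> (real^3) \<Rightarrow> real" where
  "dt g z = frechet_derivative g (at z) (1, 0)"

definition dx :: "3 \<Rightarrow> (real \<times> (real^3) \<Rightarrow> real) \<Rightarrow> real \<times> (real^3) \<Rightarrow> real" where
  "dx j g z = frechet_derivative g (at z) (0, axis j 1)"

definition W011_0 :: "(real^3) set \<Rightarrow> ((real^3) \<Rightarrow> real) \<Rightarrow> (3 \<Rightarrow> (real^3) \<Rightarrow> real) \<Rightarrow> bool" where
  "W011_0 Om u w \<longleftrightarrow> set_integrable lebesgue Om u \<and> (\<forall>j. set_integrable lebesgue Om (w j)) \<and>
     (\<exists>\<phi>. (\<forall>n. test_fun (\<phi> n) Om) \<and>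
        (\<lambda>n. LINT x:Om|lebesgue. \<bar>\<phi> n x - u x\<bar>) \<longlonglongrightarrow> 0 \<and>
        (\<forall>j. (\<lambda>n. LINT x:Om|lebesgue. \<bar>frechet_derivative (\<phi> n) (at x) (axis j 1) - w j x\<bar>) \<longlonglongrightarrow> 0))"

definition eta0 :: "real \<times> (real^3) \<Rightarrow> real" where
  "eta0 z = (if norm z < 1 then exp (1 / ((norm z)\<^sup>2 - 1)) else 0)"

definition eta :: "real \<times> (real^3) \<Rightarrow> real" where
  "eta z = eta0 z / (LINT w|lborel. eta0 w)"

definition mollify :: "real \<Rightarrow> (real \<times> (real^3) \<Rightarrow> real^3) \<Rightarrow> real \<times> (real^3) \<Rightarrow> real^3" where
  "mollify e f z = (LINT w|lebesgue. ((1 / e ^ 4) * eta ((1 / e) *\<^sub>R (z - w))) *\<^sub>R f w)"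

text \<open>Weak divergence from the weak Jacobian (D $ i $ j = d_j v_i).\<close>
definition wdiv :: "(real \<Rightarrow> real^3 \<Rightarrow> real^3^3) \<Rightarrow> real \<Rightarrow> real^3 \<Rightarrow> real" where
  "wdiv Dv t x = (\<Sum>j\<in>UNIV. Dv t x $ j $ j)"

end

theory Submission
  imports Defs "HOL-Real_Asymp.Real_Asymp"
begin

text \<open>
  A Lipschitz observable \<open>\<phi>\<close> carried by the smooth flow \<open>X\<^sup>k\<close> satisfies
  \<open>d/dr \<integral> \<phi>(X\<^sup>k(s,r,x)) g(r,x) dx = \<integral> \<phi>(X\<^sup>k(s,r,x)) (\<partial>\<^sub>r g + div (g v\<^sup>k)) dx\<close>.
  With \<open>g = 1\<close> and \<open>\<phi> \<ge> 0\<close>, Gronwall's inequality bounds the compression of \<open>X\<^sup>k\<close> by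
  \<open>exp \<integral> \<parallel>div v\<parallel>\<^sub>\<infinity>\<close> uniformly in \<open>k\<close>; here \<open>v \<in> W\<^sub>0\<^sup>1\<^sup>,\<^sup>1\<close> is what makes \<open>div v\<^sup>k\<close> the mollification
  of the zero extension of \<open>div v\<close>. The bound survives in the limit, so that \<open>X\<close> pulls null sets
  back to null sets and \<open>X(t,r,X(r,t,x)) = x\<close> almost everywhere. Since \<open>v\<^sup>k\<close> vanishes near each point
  outside the closure of \<open>\<Omega>\<close> for large \<open>k\<close>, the flows \<open>X\<^sup>k\<close> converge on the whole ball \<open>K\<close> to \<open>X\<close> extended by the
  identity, and the transport identity passes to the limit for Lipschitz \<open>\<phi>\<close>, then by a Dynkin
  argument for \<open>\<phi> = 1\<^sub>A\<close>. This is the formula for preimages; the one for images follows because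
  \<open>X(r,t,A - N)\<close> and \<open>X(t,r,\<cdot>)\<^sup>-\<^sup>1(A)\<close> agree up to a null set.
\<close>

subsection \<open>Convolution with a compactly supported kernel\<close>

text \<open>Preimages come first because they are stable under the available convergence: the flows
  converge in L2, hence almost everywhere along subsequences, and such a limit can be inserted into
  an observable, while images under an almost everywhere limit are not controlled. For the same
  reason the terminal time \<open>s\<close> is fixed and one differentiates in the initial time
  \<open>r\<close>, where the flow enters only through \<open>\<phi>(X(s, r, x))\<close>. On the
  right-hand side a bounded factor converging almost everywhere meets densities converging in L1 of
  space-time, so the Lipschitz constants of the fields may depend on \<open>k\<close>. The ball is
  there because the approximating flows may carry points out of \<open>Om\<close>. The hypothesis on
  the measure of the closure enters twice: off a null set a point lies in \<open>Om\<close> or has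
  positive distance from it, and values of \<open>X\<close> on the boundary can be discarded. The
  compression bound makes compositions such as \<open>X(t, r, X(r, t, x))\<close> insensitive to the
  null sets on which an L2 limit is arbitrary.\<close>

lemma uniformly_continuous_on_compact_support:
  fixes f :: "'a::euclidean_space \<Rightarrow> 'b::real_normed_vector"
  assumes cont: "continuous_on UNIV f" and supp: "\<And>z. r \<le> norm z \<Longrightarrow> f z = 0"
  shows "uniformly_continuous_on UNIV f"
proof -
  have uc: "uniformly_continuous_on (cball 0 (r + 1)) f"
    by (rule compact_uniformly_continuous) (auto intro: continuous_on_subset[OF cont])
  show ?thesis
    unfolding uniformly_continuous_on_def
  proof (intro allI impI)
    fix e :: real assume "e > 0"
    then obtain d where d: "d > 0" and D: "\<And>x y. x \<in> cball 0 (r+1) \<Longrightarrow> y \<in> cball 0 (r+1) \<Longrightarrow> dist y x < d \<Longrightarrow> dist (f y) (f x) < e"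
      using uc unfolding uniformly_continuous_on_def by metis
    show "\<exists>d>0. \<forall>x\<in>UNIV. \<forall>x'\<in>UNIV. dist x' x < d \<longrightarrow> dist (f x') (f x) < e"
    \<comment> \<open>Capping the distance at 1 leaves two cases: both points lie in the ball of
      radius \<open>r + 1\<close>, where compactness applies, or both have norm at least
      \<open>r\<close>, where \<open>f\<close> vanishes.\<close>
    proof (intro exI[of _ "min d 1"] conjI ballI impI)
      show "min d 1 > 0" using d by simp
      fix x y :: 'a assume xy: "dist y x < min d 1"
      have n: "\<bar>norm x - norm y\<bar> < 1"
        using xy norm_triangle_ineq3[of x y] by (simp add: dist_norm norm_minus_commute)
      show "dist (f y) (f x) < e"
      proof (cases "norm x \<le> r + 1 \<and> norm y \<le> r + 1")
        case True then show ?thesis using D xy by auto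
      next
        case False
        then have "r \<le> norm x" "r \<le> norm y" using n by auto
        then show ?thesis using supp \<open>e > 0\<close> by simp
      qed
    qed
  qed
qed

lemma bounded_compact_support:
  fixes f :: "'a::euclidean_space \<Rightarrow> 'b::real_normed_vector"
  assumes cont: "continuous_on UNIV f" and supp: "\<And>z. r \<le> norm z \<Longrightarrow> f z = 0"
  obtains B where "B \<ge> 0" "\<And>z. norm (f z) \<le> B"
proof -
  have "compact (f ` cball 0 r)"
    by (intro compact_continuous_image continuous_on_subset[OF cont]) auto
  then obtain B where "\<And>z. z \<in> cball 0 r \<Longrightarrow> norm (f z) \<le> B"
    using compact_imp_bounded bounded_iff by (metis imageI)
  then have "norm (f z) \<le> max B 0" for z
    using supp[of z] by (cases "norm z \<le> r") (auto simp: le_max_iff_disj)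
  then show ?thesis using that[of "max B 0"] by simp
qed

text \<open>Scalar and over \<open>lborel\<close>, unlike \<open>mollify\<close>: Fubini and Borel
  measurability are then at hand, and the vector field is treated component by component.\<close>

definition conv :: "('a::euclidean_space \<Rightarrow> real) \<Rightarrow> ('a \<Rightarrow> real) \<Rightarrow> 'a \<Rightarrow> real" where
  "conv \<kappa> F z = (LINT w|lborel. \<kappa> (z - w) * F w)"

lemma integrable_bounded_mult_right:
  fixes f g :: "'a \<Rightarrow> real"
  assumes "integrable M f" "g \<in> borel_measurable M" "\<And>x. \<bar>g x\<bar> \<le> B"
  shows "integrable M (\<lambda>x. g x * f x)"
proof (rule Bochner_Integration.integrable_bound[of _ "\<lambda>x. B * f x"])
  show "integrable M (\<lambda>x. B * f x)" using assms by simp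
  show "(\<lambda>x. g x * f x) \<in> borel_measurable M" using assms by measurable
  have "B \<ge> 0" using assms(3)[of undefined] by linarith
  then show "AE x in M. norm (g x * f x) \<le> norm (B * f x)"
    using assms(3) by (auto simp: abs_mult intro!: mult_right_mono AE_I2)
qed

lemma LINT_norm_bound_integral:
  fixes f :: "'a \<Rightarrow> 'b::{banach, second_countable_topology}"
  assumes "integrable M f" "integrable M g" "\<And>x. norm (f x) \<le> g x"
  shows "norm (integral\<^sup>L M f) \<le> integral\<^sup>L M g"
  using assms by (intro order_trans[OF integral_norm_bound] integral_mono) auto

lemma conv_bounded_integrable:
  fixes F :: "'a::euclidean_space \<Rightarrow> real"
  assumes "integrable lborel F" "continuous_on UNIV \<kappa>" "\<And>z. \<bar>\<kappa> z\<bar> \<le> B"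
  shows "integrable lborel (\<lambda>w. \<kappa> (z - w) * F w)"
proof (rule integrable_bounded_mult_right)
  have "continuous_on UNIV (\<lambda>w. \<kappa> (z - w))"
    by (rule continuous_on_compose2[OF assms(2)]) (auto intro: continuous_intros)
  then show "(\<lambda>w. \<kappa> (z - w)) \<in> borel_measurable lborel"
    by (simp add: borel_measurable_continuous_onI)
qed (use assms in auto)

text \<open>Two kernels and two base points in one estimate: \<open>\<mu> = 0\<close> yields the sup
  bound of a convolution, and \<open>\<mu> = \<kappa>\<close> with different points its modulus of
  continuity.\<close>

lemma conv_diff_le:
  fixes F :: "'a::euclidean_space \<Rightarrow> real"
  assumes F: "integrable lborel F" and \<kappa>: "continuous_on UNIV \<kappa>" "\<And>z. \<bar>\<kappa> z\<bar> \<le> B"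
    and \<mu>: "continuous_on UNIV \<mu>" "\<And>z. \<bar>\<mu> z\<bar> \<le> B'"
    and le: "\<And>w. \<bar>\<kappa> (z - w) - \<mu> (z' - w)\<bar> \<le> d"
  shows "\<bar>conv \<kappa> F z - conv \<mu> F z'\<bar> \<le> d * (LINT w|lborel. \<bar>F w\<bar>)"
proof -
  have "conv \<kappa> F z - conv \<mu> F z' = (LINT w|lborel. \<kappa> (z - w) * F w - \<mu> (z' - w) * F w)"
    unfolding conv_def using F \<kappa> \<mu>
    by (intro Bochner_Integration.integral_diff[symmetric] conv_bounded_integrable) auto
  also have "\<bar>\<dots>\<bar> \<le> (LINT w|lborel. d * \<bar>F w\<bar>)"
    unfolding real_norm_def[symmetric]
  proof (rule LINT_norm_bound_integral)
    show "integrable lborel (\<lambda>w. \<kappa> (z - w) * F w - \<mu> (z' - w) * F w)"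
      using F \<kappa> \<mu> by (intro Bochner_Integration.integrable_diff conv_bounded_integrable) auto
    show "integrable lborel (\<lambda>w. d * norm (F w))" using F by simp
    show "norm (\<kappa> (z - w) * F w - \<mu> (z' - w) * F w) \<le> d * norm (F w)" for w
      using mult_right_mono[OF le[of w] abs_ge_zero[of "F w"]]
      by (simp add: left_diff_distrib[symmetric] abs_mult)
  qed
  finally show ?thesis by simp
qed

lemma conv_bound:
  fixes F :: "'a::euclidean_space \<Rightarrow> real"
  assumes F: "integrable lborel F" and \<kappa>: "continuous_on UNIV \<kappa>" "\<And>z. \<bar>\<kappa> z\<bar> \<le> B"
  shows "\<bar>conv \<kappa> F z\<bar> \<le> B * (LINT w|lborel. \<bar>F w\<bar>)"
  using conv_diff_le[OF F \<kappa>, of "\<lambda>_. 0" 0 z 0 B] \<kappa> by (simp add: conv_def)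

lemma uniformly_continuous_conv:
  fixes F :: "'a::euclidean_space \<Rightarrow> real"
  assumes F: "integrable lborel F" and \<kappa>: "uniformly_continuous_on UNIV \<kappa>" "\<And>z. \<bar>\<kappa> z\<bar> \<le> B"
  shows "uniformly_continuous_on UNIV (conv \<kappa> F)"
  unfolding uniformly_continuous_on_def
proof (intro allI impI)
  fix e :: real assume e: "e > 0"
  define I where "I = (LINT w|lborel. \<bar>F w\<bar>)"
  have I: "I \<ge> 0" unfolding I_def by simp
  \<comment> \<open>The \<open>+ 1\<close> covers the case that \<open>F\<close> vanishes almost
    everywhere.\<close>
  have e': "e / (I + 1) > 0" using e I by simp
  obtain d where d: "d > 0" "\<And>x y. dist y x < d \<Longrightarrow> dist (\<kappa> y) (\<kappa> x) < e / (I + 1)"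
    using \<kappa>(1) e' unfolding uniformly_continuous_on_def by (metis UNIV_I)
  have cont: "continuous_on UNIV \<kappa>" using \<kappa>(1) uniformly_continuous_imp_continuous by blast
  show "\<exists>d>0. \<forall>x\<in>UNIV. \<forall>x'\<in>UNIV. dist x' x < d \<longrightarrow> dist (conv \<kappa> F x') (conv \<kappa> F x) < e"
  proof (intro exI[of _ d] conjI ballI impI d)
    fix x y :: 'a assume xy: "dist y x < d"
    have "\<bar>conv \<kappa> F y - conv \<kappa> F x\<bar> \<le> e / (I + 1) * I"
      unfolding I_def
    proof (rule conv_diff_le[OF F cont \<kappa>(2) cont \<kappa>(2)])
      fix w
      have "dist (y - w) (x - w) < d" using xy by (simp add: dist_norm)
      from d(2)[OF this] show "\<bar>\<kappa> (y - w) - \<kappa> (x - w)\<bar> \<le> e / ((LINT w|lborel. \<bar>F w\<bar>) + 1)"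
        by (simp add: dist_real_def I_def)
    qed
    also have "\<dots> < e" using e I by (simp add: field_simps)
    finally show "dist (conv \<kappa> F y) (conv \<kappa> F x) < e" by (simp add: dist_real_def)
  qed
qed

text \<open>The derivative is stored as a gradient vector, so that its bound and its uniform
  continuity are those of one continuous, compactly supported function.\<close>

locale C1_kernel =
  fixes \<kappa> :: "'a::euclidean_space \<Rightarrow> real" and \<kappa>' :: "'a \<Rightarrow> 'a" and \<rho> :: real
  assumes deriv: "(\<kappa> has_derivative (\<lambda>h. \<kappa>' z \<bullet> h)) (at z)"
    and cont': "continuous_on UNIV \<kappa>'"
    and supp: "\<rho> \<le> norm z \<Longrightarrow> \<kappa> z = 0"
    and supp': "\<rho> \<le> norm z \<Longrightarrow> \<kappa>' z = 0"
begin

lemma cont: "continuous_on UNIV \<kappa>"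
  using has_derivative_continuous[OF deriv] by (auto intro: continuous_at_imp_continuous_on)

lemma cont'_dir: "continuous_on UNIV (\<lambda>z. \<kappa>' z \<bullet> h)"
  by (intro continuous_intros cont')

lemma uc: "uniformly_continuous_on UNIV \<kappa>"
  using uniformly_continuous_on_compact_support[OF cont supp] .

lemma uc'_dir: "uniformly_continuous_on UNIV (\<lambda>z. \<kappa>' z \<bullet> h)"
  by (rule uniformly_continuous_on_compact_support[OF cont'_dir, of \<rho>]) (simp add: supp')

lemma bounded: obtains B where "B \<ge> 0" "\<And>z. \<bar>\<kappa> z\<bar> \<le> B"
  using bounded_compact_support[OF cont supp] by auto

lemma bounded': obtains B where "B \<ge> 0" "\<And>z. norm (\<kappa>' z) \<le> B"
  using bounded_compact_support[OF cont' supp'] by auto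

lemma bounded'_dir: obtains B where "B \<ge> 0" "\<And>z. \<bar>\<kappa>' z \<bullet> h\<bar> \<le> B"
  by (rule bounded_compact_support[OF cont'_dir[of h], of \<rho>]) (auto simp: supp')

text \<open>The Taylor remainder is small relative to \<open>h\<close> uniformly in the base point,
  because the gradient is uniformly continuous. This uniformity allows it to be integrated against a
  function that is merely integrable.\<close>

lemma uniform_derivative:
  assumes "e > 0"
  obtains d where "d > 0" "\<And>z h. norm h < d \<Longrightarrow> \<bar>\<kappa> (z + h) - \<kappa> z - \<kappa>' z \<bullet> h\<bar> \<le> e * norm h"
proof -
  obtain d where d: "d > 0" and D: "\<And>x y. dist y x < d \<Longrightarrow> dist (\<kappa>' y) (\<kappa>' x) < e"
    using uniformly_continuous_on_compact_support[OF cont' supp'] assms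
    unfolding uniformly_continuous_on_def by (metis UNIV_I)
  show ?thesis
  proof (rule that[OF d])
    fix z h :: 'a assume h: "norm h < d"
    have "norm (\<kappa> (z + h) - \<kappa> z - \<kappa>' z \<bullet> (z + h - z)) \<le> norm (z + h - z) * e"
    proof (rule differentiable_bound_linearization[where S = "ball z d" and f' = "\<lambda>x h. \<kappa>' x \<bullet> h"])
      fix t :: real assume "t \<in> {0..1}"
      then have "norm (t *\<^sub>R h) \<le> 1 * norm h"
        unfolding norm_scaleR by (intro mult_right_mono) auto
      then show "z + t *\<^sub>R (z + h - z) \<in> ball z d" using h by (simp add: dist_norm)
    next
      fix x assume "x \<in> ball z d"
      then have *: "norm (\<kappa>' x - \<kappa>' z) < e" using D[of x z] by (simp add: dist_norm norm_minus_commute)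
      show "onorm ((\<lambda>h. \<kappa>' x \<bullet> h) - (\<lambda>h. \<kappa>' z \<bullet> h)) \<le> e"
        unfolding fun_diff_def
      proof (rule onorm_le)
        fix h
        have "norm (\<kappa>' x \<bullet> h - \<kappa>' z \<bullet> h) = \<bar>(\<kappa>' x - \<kappa>' z) \<bullet> h\<bar>" by (simp add: inner_diff_left)
        also have "\<dots> \<le> norm (\<kappa>' x - \<kappa>' z) * norm h" by (rule Cauchy_Schwarz_ineq2)
        also have "\<dots> \<le> e * norm h" using * by (intro mult_right_mono) auto
        finally show "norm (\<kappa>' x \<bullet> h - \<kappa>' z \<bullet> h) \<le> e * norm h" .
      qed
    qed (use d deriv in \<open>auto intro: has_derivative_at_withinI\<close>)
    then show "\<bar>\<kappa> (z + h) - \<kappa> z - \<kappa>' z \<bullet> h\<bar> \<le> e * norm h"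
      by (simp add: mult.commute)
  qed
qed

lemma conv_linear:
  assumes F: "integrable lborel F"
  shows "linear (\<lambda>h. conv (\<lambda>w. \<kappa>' w \<bullet> h) F z)"
proof -
  have int: "integrable lborel (\<lambda>w. (\<kappa>' (z - w) \<bullet> h) * F w)" for h
  proof -
    obtain B where "\<And>z. \<bar>\<kappa>' z \<bullet> h\<bar> \<le> B" using bounded'_dir[of h] by blast
    from conv_bounded_integrable[OF F cont'_dir this] show ?thesis .
  qed
  show ?thesis
  proof (rule linearI)
    show "conv (\<lambda>w. \<kappa>' w \<bullet> (h + h')) F z = conv (\<lambda>w. \<kappa>' w \<bullet> h) F z + conv (\<lambda>w. \<kappa>' w \<bullet> h') F z" for h h'
      unfolding conv_def using int by (simp add: inner_add_right distrib_right)
    show "conv (\<lambda>w. \<kappa>' w \<bullet> (c *\<^sub>R h)) F z = c *\<^sub>R conv (\<lambda>w. \<kappa>' w \<bullet> h) F z" for c h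
      unfolding conv_def by (simp add: mult.assoc)
  qed
qed

text \<open>The derivative falls on the kernel alone. The uniform Taylor remainder, integrated
  against the absolute value of \<open>F\<close>, takes the place of dominated convergence.\<close>

lemma conv_has_derivative:
  assumes F: "integrable lborel F"
  shows "(conv \<kappa> F has_derivative (\<lambda>h. conv (\<lambda>w. \<kappa>' w \<bullet> h) F z)) (at z)"
proof (rule has_derivative_at'[THEN iffD2], intro conjI allI impI)
  show "bounded_linear (\<lambda>h. conv (\<lambda>w. \<kappa>' w \<bullet> h) F z)"
    using conv_linear[OF F] linear_conv_bounded_linear by blast
next
  fix e :: real assume e: "e > 0"
  define I where "I = (LINT w|lborel. \<bar>F w\<bar>)"
  have I: "I \<ge> 0" unfolding I_def by simp
  have e': "e / (I + 1) > 0" using e I by simp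
  obtain d where d: "d > 0" and D: "\<And>z h. norm h < d \<Longrightarrow> \<bar>\<kappa> (z + h) - \<kappa> z - \<kappa>' z \<bullet> h\<bar> \<le> e / (I+1) * norm h"
    using uniform_derivative[OF e'] by blast
  obtain B where B: "\<And>z. \<bar>\<kappa> z\<bar> \<le> B" using bounded by blast
  show "\<exists>d>0. \<forall>y. 0 < norm (y - z) \<and> norm (y - z) < d \<longrightarrow>
      norm (conv \<kappa> F y - conv \<kappa> F z - conv (\<lambda>w. \<kappa>' w \<bullet> (y - z)) F z) / norm (y - z) < e"
  proof (intro exI[of _ d] conjI d allI impI)
    fix y assume y: "0 < norm (y - z) \<and> norm (y - z) < d"
    define h where "h = y - z"
    obtain B1 where B1: "\<And>z. \<bar>\<kappa>' z \<bullet> h\<bar> \<le> B1" using bounded'_dir by blast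
    have i1: "integrable lborel (\<lambda>w. \<kappa> (u - w) * F w)" for u
      using conv_bounded_integrable[OF F cont B] .
    have i2: "integrable lborel (\<lambda>w. (\<kappa>' (z - w) \<bullet> h) * F w)"
      using conv_bounded_integrable[OF F cont'_dir B1] .
    have "conv \<kappa> F y - conv \<kappa> F z - conv (\<lambda>w. \<kappa>' w \<bullet> h) F z
        = (LINT w|lborel. (\<kappa> (y - w) * F w - \<kappa> (z - w) * F w) - (\<kappa>' (z - w) \<bullet> h) * F w)"
      unfolding conv_def using i1 i2 by simp
    also have "norm \<dots> \<le> (LINT w|lborel. e / (I+1) * norm h * \<bar>F w\<bar>)"
    proof (rule LINT_norm_bound_integral)
      fix w
      have "\<bar>\<kappa> ((z - w) + h) - \<kappa> (z - w) - \<kappa>' (z - w) \<bullet> h\<bar> \<le> e / (I+1) * norm h"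
        using D y h_def by blast
      moreover have "(z - w) + h = y - w" by (simp add: h_def)
      ultimately have *: "\<bar>\<kappa> (y - w) - \<kappa> (z - w) - \<kappa>' (z - w) \<bullet> h\<bar> \<le> e / (I+1) * norm h" by simp
      show "norm ((\<kappa> (y - w) * F w - \<kappa> (z - w) * F w) - (\<kappa>' (z - w) \<bullet> h) * F w)
          \<le> e / (I+1) * norm h * \<bar>F w\<bar>"
        using mult_right_mono[OF * abs_ge_zero[of "F w"]]
        by (simp add: abs_mult[symmetric] left_diff_distrib)
    qed (use i1 i2 F in auto)
    also have "\<dots> = e * (I / (I+1)) * norm h" by (simp add: I_def)
    also have "\<dots> < e * norm h"
    proof -
      have "I / (I+1) < 1" "0 < e * norm h" using e I y by (auto simp: h_def)
      from mult_strict_right_mono[OF this] show ?thesis by (simp add: mult_ac)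
    qed
    finally show "norm (conv \<kappa> F y - conv \<kappa> F z - conv (\<lambda>w. \<kappa>' w \<bullet> (y - z)) F z) / norm (y - z) < e"
      using y by (simp add: h_def divide_less_eq)
  qed
qed

end


section \<open>Continuity of translations and approximation by convolution in L1\<close>

lemma nn_integral_lborel_affine:
  fixes t :: "'a::euclidean_space"
  assumes [measurable]: "f \<in> borel_measurable borel" and c: "c \<noteq> 0"
  shows "(\<integral>\<^sup>+x. f x \<partial>lborel) = ennreal (\<bar>c\<bar> ^ DIM('a)) * (\<integral>\<^sup>+x. f (t + c *\<^sub>R x) \<partial>lborel)"
  by (subst lborel_affine[OF c, of t])
     (simp add: nn_integral_density nn_integral_distr nn_integral_cmult)

lemma nn_integral_lborel_translation:
  fixes t :: "'a::euclidean_space"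
  assumes "f \<in> borel_measurable borel"
  shows "(\<integral>\<^sup>+x. f (t + x) \<partial>lborel) = (\<integral>\<^sup>+x. f x \<partial>lborel)"
  using nn_integral_lborel_affine[OF assms, of 1 t] by simp

lemma nn_integral_lborel_reflection:
  fixes t :: "'a::euclidean_space"
  assumes "f \<in> borel_measurable borel"
  shows "(\<integral>\<^sup>+x. f (t - x) \<partial>lborel) = (\<integral>\<^sup>+x. f x \<partial>lborel)"
  using nn_integral_lborel_affine[OF assms, of "-1" t] by simp

lemma emeasure_inner_compact:
  fixes A :: "'a::euclidean_space set"
  assumes A: "A \<in> sets borel" and fin: "emeasure lborel A < \<infinity>" and e: "(e::real) > 0"
  obtains C where "compact C" "C \<subseteq> A" "emeasure lborel (A - C) \<le> e"
proof -
  \<comment> \<open>Inner regularity is a statement about finite measures; Lebesgue measure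
    restricted to \<open>A\<close> is one.\<close>
  define M where "M = density lborel (indicator A)"
  have sM: "sets M = sets borel" by (simp add: M_def)
  have eM: "emeasure M B = emeasure lborel (A \<inter> B)" if "B \<in> sets borel" for B
    unfolding M_def using that A
    by (simp add: emeasure_density indicator_inter_arith[symmetric] nn_integral_indicator)
  have "emeasure M (space M) \<noteq> \<infinity>"
    using eM[of UNIV] fin by (simp add: M_def less_top)
  from inner_regular[OF sM this A]
  have S: "emeasure lborel A = (SUP K\<in>{K. K \<subseteq> A \<and> compact K}. emeasure M K)"
    using eM[OF A] by simp
  show ?thesis
  proof (cases "emeasure lborel A = 0")
    case True
    then show ?thesis using that[of "{}"] by simp
  next
    case False
    have "emeasure lborel A - e < emeasure lborel A"
    proof (rule ennreal_between)
      show "0 < emeasure lborel A" using False by (simp only: zero_less_iff_neq_zero) simp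
    qed (use fin e in \<open>auto simp: less_top\<close>)
    then obtain C where C: "C \<subseteq> A" "compact C" "emeasure lborel A - e < emeasure M C"
      unfolding S by (subst (asm) less_SUP_iff) auto
    have Cb: "C \<in> sets borel" using C(2) by (simp add: borel_compact)
    have "emeasure M C = emeasure lborel C" using eM[OF Cb] C(1) by (simp add: Int_absorb1)
    have "emeasure lborel A < emeasure lborel C + e"
    proof (rule ccontr)
      assume "\<not> emeasure lborel A < emeasure lborel C + e"
      then have "emeasure lborel C + e - e \<le> emeasure lborel A - e"
        by (intro ennreal_minus_mono) (auto simp: not_less)
      then show False using C(3) \<open>emeasure M C = emeasure lborel C\<close> by simp
    qed
    moreover have "emeasure lborel (A - C) = emeasure lborel A - emeasure lborel C"
      using A Cb C(1) fin by (intro emeasure_Diff) (auto simp: top_unique dest: emeasure_mono[of C A lborel])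
    ultimately have "emeasure lborel (A - C) \<le> e"
      using fin by (auto simp: ennreal_minus_le_iff less_imp_le add.commute)
    then show ?thesis using that C by blast
  qed
qed

lemma ennreal_abs_le_add:
  "\<bar>x\<bar> \<le> \<bar>y\<bar> + \<bar>w\<bar> \<Longrightarrow> ennreal \<bar>x\<bar> \<le> ennreal \<bar>y\<bar> + ennreal \<bar>w\<bar>"
  by (metis abs_ge_zero ennreal_leI ennreal_plus)

lemma ennreal_abs_le_add3:
  "\<bar>x\<bar> \<le> \<bar>y\<bar> + \<bar>w\<bar> + \<bar>u\<bar> \<Longrightarrow> ennreal \<bar>x\<bar> \<le> ennreal \<bar>y\<bar> + ennreal \<bar>w\<bar> + ennreal \<bar>u\<bar>"
  by (metis abs_ge_zero add_nonneg_nonneg ennreal_leI ennreal_plus)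

text \<open>Induction over integrable functions. The substance is the case of an indicator, where
  \<open>A\<close> is enclosed between a compact and an open set of nearly equal measure; the limit
  case is a three-term split with \<open>e/3\<close> each.\<close>

lemma L1_continuous_translation:
  fixes F :: "'a::euclidean_space \<Rightarrow> real"
  assumes "integrable lborel F" and "e > 0"
  obtains d where "d > 0" "\<And>h. norm h < d \<Longrightarrow> (\<integral>\<^sup>+z. ennreal \<bar>F (z - h) - F z\<bar> \<partial>lborel) \<le> ennreal e"
proof -
  have nt: "(\<integral>\<^sup>+z. f (z - h) \<partial>lborel) = (\<integral>\<^sup>+z. f z \<partial>lborel)" if "f \<in> borel_measurable borel"
    for f :: "'a \<Rightarrow> ennreal" and h
    using nn_integral_lborel_translation[OF that, of "-h"] by simp
  have "\<forall>e>0. \<exists>d>0. \<forall>h. norm h < d \<longrightarrow> (\<integral>\<^sup>+z. ennreal \<bar>F (z - h) - F z\<bar> \<partial>lborel) \<le> ennreal e"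
    using assms(1)
  proof (induction rule: integrable_induct)
    case (base A c)
    have A: "A \<in> sets borel" using base by simp
    show ?case
    proof (intro allI impI)
      fix e :: real assume e: "e > 0"
      \<comment> \<open>\<open>U - C\<close> has measure at most \<open>2 * e'\<close> and is
        counted twice, once translated: hence the 4. The \<open>+ 1\<close> covers
        \<open>c = 0\<close>.\<close>
      define e' where "e' = e / (4 * (\<bar>c\<bar> + 1))"
      have e': "e' > 0" using e by (simp add: e'_def)
      obtain U where U: "open U" "A \<subseteq> U" "emeasure lborel (U - A) \<le> e'"
        using outer_regular_lborel[OF A e'] by (metis less_imp_le)
      obtain C where C: "compact C" "C \<subseteq> A" "emeasure lborel (A - C) \<le> e'"
        using emeasure_inner_compact[OF A base(2) e'] by blast
      have Cb[measurable]: "C \<in> sets borel" and Ub[measurable]: "U \<in> sets borel"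
        using C(1) U(1) by (auto simp: borel_compact)
      obtain d where d: "d > 0" "(\<Union>x\<in>C. cball x d) \<subseteq> U"
        using compact_subset_open_imp_cball_epsilon_subset[OF C(1) U(1)] C(2) U(2) by blast
      have meas: "emeasure lborel (U - C) \<le> ennreal (2 * e')"
      proof -
        have "U - C = (U - A) \<union> (A - C)" using U C by blast
        then have "emeasure lborel (U - C) \<le> emeasure lborel (U - A) + emeasure lborel (A - C)"
          using A by (simp add: emeasure_subadditive)
        also have "\<dots> \<le> ennreal e' + ennreal e'" using U(3) C(3) by (intro add_mono) auto
        also have "\<dots> = ennreal (2 * e')" using e' by (simp flip: ennreal_plus)
        finally show ?thesis .
      qed
      show "\<exists>d>0. \<forall>h. norm h < d \<longrightarrow> (\<integral>\<^sup>+z. ennreal \<bar>indicator A (z - h) *\<^sub>R c - indicator A z *\<^sub>R c\<bar> \<partial>lborel) \<le> ennreal e"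
      proof (intro exI[of _ d] conjI d allI impI)
        fix h :: 'a assume h: "norm h < d"
        have *: "x \<in> C \<Longrightarrow> x + h \<in> U" "x \<in> C \<Longrightarrow> x - h \<in> U" for x
        proof -
          assume x: "x \<in> C"
          have "x + h \<in> cball x d" "x - h \<in> cball x d" using h by (auto simp: dist_norm)
          then show "x + h \<in> U" "x - h \<in> U" using d(2) x by blast+
        qed
        \<comment> \<open>If exactly one of \<open>z\<close> and \<open>z - h\<close> lies in
          \<open>A\<close>, then one of them lies in \<open>U - C\<close>: a point of
          \<open>C\<close> moved by less than \<open>d\<close> stays in \<open>U\<close>.\<close>
        have pw: "\<bar>indicator A (z - h) *\<^sub>R c - indicator A z *\<^sub>R c\<bar> \<le> \<bar>c\<bar> * (indicator (U - C) z + indicator (U - C) (z - h))" for z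
          using *(1)[of "z - h"] *(2)[of z] U(2) C(2)
          by (auto simp: indicator_def)
        have "(\<integral>\<^sup>+z. ennreal \<bar>indicator A (z - h) *\<^sub>R c - indicator A z *\<^sub>R c\<bar> \<partial>lborel)
           \<le> (\<integral>\<^sup>+z. ennreal \<bar>c\<bar> * (indicator (U - C) z + indicator (U - C) (z - h)) \<partial>lborel)"
        proof (intro nn_integral_mono)
          fix z
          have "ennreal \<bar>indicator A (z - h) *\<^sub>R c - indicator A z *\<^sub>R c\<bar> \<le> ennreal (\<bar>c\<bar> * (indicator (U - C) z + indicator (U - C) (z - h)))"
            using pw by (rule ennreal_leI)
          also have "\<dots> = ennreal \<bar>c\<bar> * (indicator (U - C) z + indicator (U - C) (z - h))"
            by (simp add: ennreal_mult ennreal_indicator)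
          finally show "ennreal \<bar>indicator A (z - h) *\<^sub>R c - indicator A z *\<^sub>R c\<bar> \<le> ennreal \<bar>c\<bar> * (indicator (U - C) z + indicator (U - C) (z - h))" .
        qed
        also have "\<dots> = ennreal \<bar>c\<bar> * (emeasure lborel (U - C) + emeasure lborel (U - C))"
          using nt[of "indicator (U - C)" h] by (simp add: nn_integral_cmult nn_integral_add)
        also have "\<dots> \<le> ennreal \<bar>c\<bar> * (ennreal (2 * e') + ennreal (2 * e'))"
          using meas by (intro mult_left_mono add_mono) auto
        also have "\<dots> = ennreal (\<bar>c\<bar> * (4 * e'))"
        proof -
          have "ennreal (2 * e') + ennreal (2 * e') = ennreal (4 * e')"
            using e' by (subst ennreal_plus[symmetric]) auto
          moreover have "ennreal \<bar>c\<bar> * ennreal (4 * e') = ennreal (\<bar>c\<bar> * (4 * e'))"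
            using e' by (intro ennreal_mult[symmetric]) auto
          ultimately show ?thesis by metis
        qed
        also have "\<dots> \<le> ennreal e"
          using e by (intro ennreal_leI) (simp add: e'_def divide_simps)
        finally show "(\<integral>\<^sup>+z. ennreal \<bar>indicator A (z - h) *\<^sub>R c - indicator A z *\<^sub>R c\<bar> \<partial>lborel) \<le> ennreal e" .
      qed
    qed
  next
    case (add f g)
    have [measurable]: "f \<in> borel_measurable borel" "g \<in> borel_measurable borel"
      using add.hyps by (auto dest: borel_measurable_integrable)
    show ?case
    proof (intro allI impI)
      fix e :: real assume e: "e > 0"
      obtain d1 where d1: "d1 > 0" "\<And>h. norm h < d1 \<Longrightarrow> (\<integral>\<^sup>+z. ennreal \<bar>f (z - h) - f z\<bar> \<partial>lborel) \<le> ennreal (e/2)"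
        using add.IH(1)[rule_format, of "e/2"] e by auto
      obtain d2 where d2: "d2 > 0" "\<And>h. norm h < d2 \<Longrightarrow> (\<integral>\<^sup>+z. ennreal \<bar>g (z - h) - g z\<bar> \<partial>lborel) \<le> ennreal (e/2)"
        using add.IH(2)[rule_format, of "e/2"] e by auto
      show "\<exists>d>0. \<forall>h. norm h < d \<longrightarrow> (\<integral>\<^sup>+z. ennreal \<bar>(f (z - h) + g (z - h)) - (f z + g z)\<bar> \<partial>lborel) \<le> ennreal e"
      proof (intro exI[of _ "min d1 d2"] conjI allI impI)
        show "min d1 d2 > 0" using d1 d2 by simp
        fix h :: 'a assume h: "norm h < min d1 d2"
        have "(\<integral>\<^sup>+z. ennreal \<bar>(f (z - h) + g (z - h)) - (f z + g z)\<bar> \<partial>lborel)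
           \<le> (\<integral>\<^sup>+z. ennreal \<bar>f (z - h) - f z\<bar> + ennreal \<bar>g (z - h) - g z\<bar> \<partial>lborel)"
          by (intro nn_integral_mono) (rule ennreal_abs_le_add, linarith)
        also have "\<dots> = (\<integral>\<^sup>+z. ennreal \<bar>f (z - h) - f z\<bar> \<partial>lborel) + (\<integral>\<^sup>+z. ennreal \<bar>g (z - h) - g z\<bar> \<partial>lborel)"
          by (intro nn_integral_add) auto
        also have "\<dots> \<le> ennreal (e/2) + ennreal (e/2)" using h d1 d2 by (intro add_mono) auto
        also have "\<dots> = ennreal e" using e by (simp flip: ennreal_plus)
        finally show "(\<integral>\<^sup>+z. ennreal \<bar>(f (z - h) + g (z - h)) - (f z + g z)\<bar> \<partial>lborel) \<le> ennreal e" .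
      qed
    qed
  next
    case (lim f s)
    have [measurable]: "f \<in> borel_measurable borel" "s i \<in> borel_measurable borel" for i
      using lim.hyps by (auto dest: borel_measurable_integrable)
    show ?case
    proof (intro allI impI)
      fix e :: real assume e: "e > 0"
      have "(\<lambda>i. \<integral>\<^sup>+z. norm (f z - s i z) \<partial>lborel) \<longlonglongrightarrow> 0"
      proof (rule nn_integral_dominated_convergence_norm[where w="\<lambda>z. 2 * norm (f z)"])
        have "integrable lborel (\<lambda>z. 2 * norm (f z))" using lim.hyps by simp
        from integrableD(2)[OF this] show "(\<integral>\<^sup>+z. ennreal (2 * norm (f z)) \<partial>lborel) < \<infinity>"
          by (simp add: less_top)
      qed (use lim.hyps in auto)
      then have "(\<lambda>i. \<integral>\<^sup>+z. norm (s i z - f z) \<partial>lborel) \<longlonglongrightarrow> 0"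
        by (simp add: abs_minus_commute)
      then have "\<forall>\<^sub>F i in sequentially. (\<integral>\<^sup>+z. norm (s i z - f z) \<partial>lborel) < ennreal (e/3)"
        using e by (intro order_tendstoD) auto
      then obtain i where i: "(\<integral>\<^sup>+z. ennreal \<bar>s i z - f z\<bar> \<partial>lborel) < ennreal (e/3)"
        by (auto simp: eventually_sequentially)
      obtain d where d: "d > 0" "\<And>h. norm h < d \<Longrightarrow> (\<integral>\<^sup>+z. ennreal \<bar>s i (z - h) - s i z\<bar> \<partial>lborel) \<le> ennreal (e/3)"
        using lim.IH[of i, rule_format, of "e/3"] e by auto
      show "\<exists>d>0. \<forall>h. norm h < d \<longrightarrow> (\<integral>\<^sup>+z. ennreal \<bar>f (z - h) - f z\<bar> \<partial>lborel) \<le> ennreal e"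
      proof (intro exI[of _ d] conjI d allI impI)
        fix h :: 'a assume h: "norm h < d"
        have "(\<integral>\<^sup>+z. ennreal \<bar>f (z - h) - f z\<bar> \<partial>lborel)
           \<le> (\<integral>\<^sup>+z. (ennreal \<bar>s i (z - h) - f (z - h)\<bar> + ennreal \<bar>s i (z - h) - s i z\<bar>) + ennreal \<bar>s i z - f z\<bar> \<partial>lborel)"
          by (intro nn_integral_mono) (rule ennreal_abs_le_add3, linarith)
        also have "\<dots> = ((\<integral>\<^sup>+z. ennreal \<bar>s i (z - h) - f (z - h)\<bar> \<partial>lborel) + (\<integral>\<^sup>+z. ennreal \<bar>s i (z - h) - s i z\<bar> \<partial>lborel))
            + (\<integral>\<^sup>+z. ennreal \<bar>s i z - f z\<bar> \<partial>lborel)"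
          by (simp add: nn_integral_add)
        also have "\<dots> \<le> (ennreal (e/3) + ennreal (e/3)) + ennreal (e/3)"
          using d(2)[OF h] i nt[of "\<lambda>z. ennreal \<bar>s i z - f z\<bar>" h]
          by (intro add_mono) auto
        also have "\<dots> = ennreal e" using e by (simp flip: ennreal_plus)
        finally show "(\<integral>\<^sup>+z. ennreal \<bar>f (z - h) - f z\<bar> \<partial>lborel) \<le> ennreal e" .
      qed
    qed
  qed
  then show ?thesis using assms(2) that by blast
qed

text \<open>As \<open>\<kappa>\<close> has mass 1, \<open>conv \<kappa> F - F\<close> is an average
  of differences \<open>F (z - w) - F z\<close> over \<open>norm w < d\<close>. Tonelli turns its L1
  norm into the same average of the L1 norms of these differences.\<close>

lemma conv_L1_approx:
  fixes F :: "'a::euclidean_space \<Rightarrow> real"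
  assumes F: "integrable lborel F" and \<kappa>: "continuous_on UNIV \<kappa>" "\<And>z. \<bar>\<kappa> z\<bar> \<le> B"
    and nonneg: "\<And>z. 0 \<le> \<kappa> z" and one: "(\<integral>\<^sup>+z. ennreal (\<kappa> z) \<partial>lborel) = 1"
    and supp: "\<And>z. d \<le> norm z \<Longrightarrow> \<kappa> z = 0"
    and trans: "\<And>h. norm h < d \<Longrightarrow> (\<integral>\<^sup>+z. ennreal \<bar>F (z - h) - F z\<bar> \<partial>lborel) \<le> e"
  shows "(\<integral>\<^sup>+z. ennreal \<bar>conv \<kappa> F z - F z\<bar> \<partial>lborel) \<le> e"
proof -
  have [measurable]: "F \<in> borel_measurable borel" using F by (auto dest: borel_measurable_integrable)
  have [measurable]: "\<kappa> \<in> borel_measurable borel" using \<kappa> by (simp add: borel_measurable_continuous_onI)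
  have one': "(\<integral>\<^sup>+w. ennreal (\<kappa> (z - w)) \<partial>lborel) = 1" for z
    using nn_integral_lborel_reflection[of "\<lambda>w. ennreal (\<kappa> w)" z] one by simp
  have ik: "integrable lborel (\<lambda>w. \<kappa> (z - w))" for z
    by (rule integrableI_nonneg) (use one'[of z] nonneg in auto)
  have ik1: "(LINT w|lborel. \<kappa> (z - w)) = 1" for z
    using one'[of z] nonneg by (simp add: integral_eq_nn_integral)
  have pw: "ennreal \<bar>conv \<kappa> F z - F z\<bar> \<le> (\<integral>\<^sup>+w. ennreal (\<kappa> w) * ennreal \<bar>F (z - w) - F z\<bar> \<partial>lborel)" for z
  proof -
    have "conv \<kappa> F z - F z = (LINT w|lborel. \<kappa> (z - w) * F w) - (LINT w|lborel. \<kappa> (z - w) * F z)"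
      unfolding conv_def using ik1[of z] by simp
    also have "\<dots> = (LINT w|lborel. \<kappa> (z - w) * (F w - F z))"
      using conv_bounded_integrable[OF F \<kappa>] ik by (simp add: right_diff_distrib)
    finally have "ennreal \<bar>conv \<kappa> F z - F z\<bar> = ennreal (norm (LINT w|lborel. \<kappa> (z - w) * (F w - F z)))" by simp
    also have "\<dots> \<le> (\<integral>\<^sup>+w. ennreal (norm (\<kappa> (z - w) * (F w - F z))) \<partial>lborel)"
      using conv_bounded_integrable[OF F \<kappa>] ik
      by (intro integral_norm_bound_ennreal) (simp add: right_diff_distrib)
    also have "\<dots> = (\<integral>\<^sup>+w. ennreal (\<kappa> (z - w)) * ennreal \<bar>F (z - (z - w)) - F z\<bar> \<partial>lborel)"
      using nonneg by (simp add: abs_mult ennreal_mult)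
    also have "\<dots> = (\<integral>\<^sup>+w. ennreal (\<kappa> w) * ennreal \<bar>F (z - w) - F z\<bar> \<partial>lborel)"
      by (rule nn_integral_lborel_reflection[of "\<lambda>w. ennreal (\<kappa> w) * ennreal \<bar>F (z - w) - F z\<bar>" z]) simp
    finally show ?thesis .
  qed
  have "(\<integral>\<^sup>+z. ennreal \<bar>conv \<kappa> F z - F z\<bar> \<partial>lborel)
      \<le> (\<integral>\<^sup>+z. (\<integral>\<^sup>+w. ennreal (\<kappa> w) * ennreal \<bar>F (z - w) - F z\<bar> \<partial>lborel) \<partial>lborel)"
    by (intro nn_integral_mono pw)
  also have "\<dots> = (\<integral>\<^sup>+w. (\<integral>\<^sup>+z. ennreal (\<kappa> w) * ennreal \<bar>F (z - w) - F z\<bar> \<partial>lborel) \<partial>lborel)"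
    by (rule lborel_pair.Fubini'[symmetric]) measurable
  also have "\<dots> = (\<integral>\<^sup>+w. ennreal (\<kappa> w) * (\<integral>\<^sup>+z. ennreal \<bar>F (z - w) - F z\<bar> \<partial>lborel) \<partial>lborel)"
    by (simp add: nn_integral_cmult)
  also have "\<dots> \<le> (\<integral>\<^sup>+w. ennreal (\<kappa> w) * e \<partial>lborel)"
  proof (rule nn_integral_mono)
    fix w show "ennreal (\<kappa> w) * (\<integral>\<^sup>+z. ennreal \<bar>F (z - w) - F z\<bar> \<partial>lborel) \<le> ennreal (\<kappa> w) * e"
      using trans[of w] supp[of w] by (cases "norm w < d") (auto intro: mult_left_mono)
  qed
  also have "\<dots> = e" using one by (simp add: nn_integral_multc)
  finally show ?thesis .
qed

subsection \<open>The standard mollifier\<close>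

text \<open>Profile of the standard mollifier as a function of the squared norm, which unlike the
  norm is differentiable at the origin.\<close>

definition bump :: "real \<Rightarrow> real" where
  "bump x = (if x < 1 then exp (1 / (x - 1)) else 0)"

definition bump' :: "real \<Rightarrow> real" where
  "bump' x = (if x < 1 then - exp (1 / (x - 1)) / (x - 1)\<^sup>2 else 0)"

text \<open>The two limits needed at the gluing point 1: that of the difference quotient, giving
  differentiability, and that of the derivative, giving its continuity.\<close>

lemma tendsto_bump_left: "((\<lambda>x::real. exp (1 / (x - 1)) / (x - 1)) \<longlongrightarrow> 0) (at_left 1)"
  "((\<lambda>x::real. - exp (1 / (x - 1)) / (x - 1)\<^sup>2) \<longlongrightarrow> 0) (at_left 1)"
  by real_asymp+

lemma DERIV_bump: "(bump has_real_derivative bump' x) (at x)"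
proof -
  consider "x < 1" | "x > 1" | "x = 1" by linarith
  then show ?thesis
  proof cases
    case 1
    have "((\<lambda>x. exp (1 / (x - 1))) has_real_derivative bump' x) (at x)"
      using 1 by (auto simp: bump'_def power2_eq_square intro!: derivative_eq_intros)
    then show ?thesis
      by (rule has_field_derivative_transform_within_open[where S="{..<1}"]) (use 1 in \<open>auto simp: bump_def\<close>)
  next
    case 2
    have "((\<lambda>x. 0) has_real_derivative bump' x) (at x)"
      using 2 by (auto simp: bump'_def)
    then show ?thesis
      by (rule has_field_derivative_transform_within_open[where S="{1<..}"]) (use 2 in \<open>auto simp: bump_def\<close>)
  next
    case 3
    have "((\<lambda>x. (bump x - bump 1) / (x - 1)) \<longlongrightarrow> 0) (at 1)"
    proof (rule filterlim_split_at)
      show "((\<lambda>x. (bump x - bump 1) / (x - 1)) \<longlongrightarrow> 0) (at_left 1)"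
        by (rule Lim_transform_eventually[OF tendsto_bump_left(1)])
           (auto simp: eventually_at_filter bump_def)
      show "((\<lambda>x. (bump x - bump 1) / (x - 1)) \<longlongrightarrow> 0) (at_right 1)"
        by (rule tendsto_eventually) (auto simp: eventually_at_filter bump_def)
    qed
    then show ?thesis using 3 by (simp add: has_field_derivative_iff bump'_def)
  qed
qed

lemma continuous_bump': "continuous_on UNIV bump'"
proof (intro continuous_at_imp_continuous_on ballI)
  fix x :: real
  consider "x < 1" | "x > 1" | "x = 1" by linarith
  then show "isCont bump' x"
  proof cases
    case 1
    have "continuous_on {..<1} (\<lambda>x::real. - exp (1 / (x - 1)) / (x - 1)\<^sup>2)"
      by (intro continuous_intros) auto
    then have "continuous_on {..<1} bump'"
      by (rule continuous_on_eq) (auto simp: bump'_def)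
    then show ?thesis using 1 by (auto simp: continuous_on_eq_continuous_at)
  next
    case 2
    have "continuous_on {1<..} bump'"
      by (rule continuous_on_eq[where f="\<lambda>x. 0"]) (auto simp: bump'_def)
    then show ?thesis using 2 by (auto simp: continuous_on_eq_continuous_at)
  next
    case 3
    have "(bump' \<longlongrightarrow> 0) (at 1)"
    proof (rule filterlim_split_at)
      show "(bump' \<longlongrightarrow> 0) (at_left 1)"
        by (rule Lim_transform_eventually[OF tendsto_bump_left(2)])
           (auto simp: eventually_at_filter bump'_def)
      show "(bump' \<longlongrightarrow> 0) (at_right 1)"
        by (rule tendsto_eventually) (auto simp: eventually_at_filter bump'_def)
    qed
    then show ?thesis using 3 by (simp add: isCont_def bump'_def)
  qed
qed

lemma eta0_eq_bump: "eta0 z = bump (z \<bullet> z)"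
  by (simp add: eta0_def bump_def norm_eq_sqrt_inner)

lemma eta0_nonneg: "0 \<le> eta0 z" and eta0_supp: "1 \<le> norm z \<Longrightarrow> eta0 z = 0"
  by (auto simp: eta0_def)

lemma eta0_has_derivative: "(eta0 has_derivative (\<lambda>h. (2 * bump' (z \<bullet> z)) *\<^sub>R z \<bullet> h)) (at z)"
proof -
  have "((\<lambda>z::real \<times> (real^3). bump (z \<bullet> z)) has_derivative (\<lambda>h. bump' (z \<bullet> z) * (z \<bullet> h + h \<bullet> z))) (at z)"
    using DERIV_bump[of "z \<bullet> z"] unfolding has_field_derivative_def
    by (rule has_derivative_compose[rotated]) (auto intro!: derivative_eq_intros)
  then show ?thesis
    unfolding eta0_eq_bump[abs_def]
    by (rule has_derivative_eq_rhs) (auto simp: fun_eq_iff inner_commute algebra_simps)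
qed

lemma continuous_eta0: "continuous_on UNIV eta0"
  using has_derivative_continuous[OF eta0_has_derivative] by (auto intro: continuous_at_imp_continuous_on)

lemma eta0_integrable: "integrable lborel eta0"
proof -
  have "integrable lborel (\<lambda>z. indicator (cball 0 1) z *\<^sub>R eta0 z)"
    by (rule borel_integrable_compact) (auto intro: continuous_on_subset[OF continuous_eta0])
  moreover have "(\<lambda>z. indicator (cball 0 1) z *\<^sub>R eta0 z) = eta0"
    using eta0_supp by (auto simp: fun_eq_iff indicator_def)
  ultimately show ?thesis by simp
qed

lemma eta0_integral_pos: "(LINT z|lborel. eta0 z) > 0"
proof (rule ccontr)
  assume "\<not> (LINT z|lborel. eta0 z) > 0"
  then have "(LINT z|lborel. eta0 z) = 0"
    using Bochner_Integration.integral_nonneg[of lborel eta0] eta0_nonneg by force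
  then have "AE z in lborel. eta0 z = 0"
    using eta0_integrable eta0_nonneg by (subst (asm) integral_nonneg_eq_0_iff_AE) auto
  then have "AE z in lborel. z \<notin> ball (0::real \<times> (real^3)) 1"
    by eventually_elim (auto simp: eta0_def)
  then have "negligible (ball (0::real \<times> (real^3)) 1)"
    by (simp add: AE_iff_null_sets negligible_iff_null_sets AE_completion)
  then show False
    using open_not_negligible[of "ball (0::real \<times> (real^3)) 1"] by simp
qed

definition eta_kernel :: "real \<Rightarrow> real \<times> (real^3) \<Rightarrow> real" where
  "eta_kernel e z = (1 / e ^ 4) * eta ((1 / e) *\<^sub>R z)"

text \<open>Of the six powers of \<open>e\<close>, four normalise the mass in the four-dimensional
  space-time; one comes from the chain rule for the rescaling and one from the rescaled point in the
  gradient.\<close>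

definition eta_kernel' :: "real \<Rightarrow> real \<times> (real^3) \<Rightarrow> real \<times> (real^3)" where
  "eta_kernel' e z = (2 * bump' (((1 / e) *\<^sub>R z) \<bullet> ((1 / e) *\<^sub>R z)) / (LINT w|lborel. eta0 w) / e ^ 6) *\<^sub>R z"

lemma eta_kernel_C1: 
  assumes e: "e > 0"
  shows "C1_kernel (eta_kernel e) (eta_kernel' e) e"
proof
  fix z
  define c where "c = (LINT w|lborel. eta0 w)"
  have c: "c > 0" using eta0_integral_pos by (simp add: c_def)
  have e6: "e ^ 6 = e * (e * e ^ 4)" by (simp add: power_eq_if)
  have "((\<lambda>z. eta0 ((1 / e) *\<^sub>R z)) has_derivative
     (\<lambda>h. (2 * bump' (((1 / e) *\<^sub>R z) \<bullet> ((1 / e) *\<^sub>R z))) *\<^sub>R ((1 / e) *\<^sub>R z) \<bullet> ((1 / e) *\<^sub>R h))) (at z)"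
    by (rule has_derivative_compose[OF _ eta0_has_derivative]) (auto intro!: derivative_eq_intros)
  from has_derivative_mult_right[OF this, of "1 / e ^ 4 / c"]
  have "((\<lambda>z. (1 / e ^ 4) * (eta0 ((1 / e) *\<^sub>R z) / c)) has_derivative
     (\<lambda>h. (1 / e ^ 4) * (((2 * bump' (((1 / e) *\<^sub>R z) \<bullet> ((1 / e) *\<^sub>R z))) *\<^sub>R ((1 / e) *\<^sub>R z) \<bullet> ((1 / e) *\<^sub>R h)) / c))) (at z)"
    by (simp add: mult_ac)
  then show "(eta_kernel e has_derivative (\<bullet>) (eta_kernel' e z)) (at z)"
    unfolding eta_kernel_def[abs_def] eta_def c_def[symmetric]
    by (rule has_derivative_eq_rhs)
       (simp add: fun_eq_iff eta_kernel'_def c_def[symmetric] e6 less_imp_neq[OF c, symmetric] less_imp_neq[OF e, symmetric])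
next
  have "continuous_on UNIV (\<lambda>z::real \<times> (real^3). bump' (((1 / e) *\<^sub>R z) \<bullet> ((1 / e) *\<^sub>R z)))"
    by (rule continuous_on_compose2[OF continuous_bump']) (use e in \<open>auto intro!: continuous_intros\<close>)
  then show "continuous_on UNIV (eta_kernel' e)"
    unfolding eta_kernel'_def[abs_def] using e eta0_integral_pos by (intro continuous_intros) auto
next
  fix z :: "real \<times> (real^3)" assume z: "e \<le> norm z"
  then show "eta_kernel e z = 0"
    using e eta0_supp[of "(1 / e) *\<^sub>R z"] by (simp add: eta_kernel_def eta_def)
  have "1 \<le> norm ((1 / e) *\<^sub>R z)" using z e by simp
  then have "1 \<le> ((1 / e) *\<^sub>R z) \<bullet> ((1 / e) *\<^sub>R z)"
    by (metis norm_eq_sqrt_inner real_sqrt_ge_1_iff)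
  then show "eta_kernel' e z = 0" unfolding eta_kernel'_def bump'_def by simp
qed

lemma eta_kernel_nonneg: "e > 0 \<Longrightarrow> 0 \<le> eta_kernel e z"
  using eta0_nonneg eta0_integral_pos by (auto simp: eta_kernel_def eta_def)

lemma eta_kernel_nn_integral:
  assumes e: "e > 0"
  shows "(\<integral>\<^sup>+z. ennreal (eta_kernel e z) \<partial>lborel) = 1"
proof -
  define c where "c = (LINT w|lborel. eta0 w)"
  have c: "c > 0" using eta0_integral_pos by (simp add: c_def)
  have [measurable]: "eta0 \<in> borel_measurable borel"
    using continuous_eta0 by (rule borel_measurable_continuous_onI)
  have "(\<integral>\<^sup>+z. ennreal (eta0 z / c) \<partial>lborel) = ennreal (LINT z|lborel. eta0 z / c)"
    using eta0_integrable eta0_nonneg c by (intro nn_integral_eq_integral) auto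
  also have "\<dots> = 1" using c by (simp add: c_def)
  finally have 1: "(\<integral>\<^sup>+z. ennreal (eta0 z / c) \<partial>lborel) = 1" .
  have "(\<integral>\<^sup>+z. ennreal (eta0 z / c) \<partial>lborel)
      = ennreal (\<bar>1/e\<bar> ^ DIM(real \<times> (real^3))) * (\<integral>\<^sup>+z. ennreal (eta0 (0 + (1/e) *\<^sub>R z) / c) \<partial>lborel)"
    using e by (intro nn_integral_lborel_affine) auto
  also have "\<dots> = (\<integral>\<^sup>+z. ennreal (1/e^4) * ennreal (eta0 ((1/e) *\<^sub>R z) / c) \<partial>lborel)"
    using e by (simp add: nn_integral_cmult power_one_over)
  also have "\<dots> = (\<integral>\<^sup>+z. ennreal (eta_kernel e z) \<partial>lborel)"
    using e c eta0_nonneg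
    by (intro nn_integral_cong) (simp add: eta_kernel_def eta_def c_def[symmetric] ennreal_mult[symmetric])
  finally show ?thesis using 1 by simp
qed

subsection \<open>Weak derivatives\<close>

lemma integral_lborel_translation:
  fixes f :: "'a::euclidean_space \<Rightarrow> real"
  assumes f: "f \<in> borel_measurable borel"
  shows "(LINT x|lborel. f (t + x)) = (LINT x|lborel. f x)"
proof -
  have "lborel = distr lborel borel (\<lambda>x. t + x)"
    using lborel_affine[of 1 t] by (simp add: density_1)
  then have "(LINT x|lborel. f x) = (LINT x|distr lborel borel (\<lambda>x. t + x). f x)" by simp
  also have "\<dots> = (LINT x|lborel. f (t + x))"
    using f by (intro integral_distr) auto
  finally show ?thesis by simp
qed

text \<open>By translation invariance every difference quotient of \<open>f\<close> has integral 0,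
  and the quotients converge boundedly with supports in one ball. No iterated integration along
  lines is involved.\<close>

lemma integral_directional_derivative_zero:
  fixes f :: "'a::euclidean_space \<Rightarrow> real"
  assumes df: "\<And>x. (f has_derivative f' x) (at x)" and cont: "continuous_on UNIV (\<lambda>x. f' x b)"
    and supp: "\<And>x. r \<le> norm x \<Longrightarrow> f x = 0" "\<And>x. r \<le> norm x \<Longrightarrow> f' x b = 0"
  shows "(LINT x|lborel. f' x b) = 0"
proof -
  have contf: "continuous_on UNIV f"
    using has_derivative_continuous[OF df] by (auto intro: continuous_at_imp_continuous_on)
  obtain B where B: "\<And>x. norm (f' x b) \<le> B" using bounded_compact_support[OF cont supp(2)] by blast
  have B0: "B \<ge> 0" using B[of 0] norm_ge_zero order_trans by blast
  have intf: "integrable lborel f"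
  proof -
    have "integrable lborel (\<lambda>z. indicator (cball 0 r) z *\<^sub>R f z)"
      by (rule borel_integrable_compact) (auto intro: continuous_on_subset[OF contf])
    moreover have "(\<lambda>z. indicator (cball 0 r) z *\<^sub>R f z) = f"
      using supp(1) by (auto simp: fun_eq_iff indicator_def)
    ultimately show ?thesis by simp
  qed
  have fm[measurable]: "f \<in> borel_measurable borel" using contf by (rule borel_measurable_continuous_onI)
  have fm'[measurable]: "(\<lambda>x. f' x b) \<in> borel_measurable borel" using cont by (rule borel_measurable_continuous_onI)
  have lin: "f' x (s *\<^sub>R b) = s * f' x b" for x s
    using has_derivative_linear[OF df, of x] by (simp add: linear_cmul)
  define q where "q n x = (f (x + inverse (real (Suc n)) *\<^sub>R b) - f x) / inverse (real (Suc n))" for n x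
  \<comment> \<open>Steps have length at most \<open>norm b\<close>, so the support grows from
    radius \<open>r\<close> to at most \<open>r + norm b\<close>; inside, the mean value inequality
    gives \<open>B\<close>.\<close>
  have q_bound: "\<bar>q n x\<bar> \<le> B * indicator (cball 0 (r + norm b)) x" for n x
  proof (cases "norm x \<le> r + norm b")
    case True
    define s where "s = inverse (real (Suc n))"
    have s: "s > 0" by (simp add: s_def)
    have "norm (f (x + s *\<^sub>R b) - f (x + 0 *\<^sub>R b)) \<le> B * norm (s - 0)"
    proof (rule differentiable_bound[where S=UNIV and f="\<lambda>s. f (x + s *\<^sub>R b)" and f' = "\<lambda>s h. f' (x + s *\<^sub>R b) (h *\<^sub>R b)"])
      fix t :: real
      show "((\<lambda>s. f (x + s *\<^sub>R b)) has_derivative (\<lambda>h. f' (x + t *\<^sub>R b) (h *\<^sub>R b))) (at t within UNIV)"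
        by (rule has_derivative_compose[OF _ df]) (auto intro!: derivative_eq_intros)
      show "onorm (\<lambda>h. f' (x + t *\<^sub>R b) (h *\<^sub>R b)) \<le> B"
        using B by (intro onorm_le) (auto simp: lin abs_mult mult.commute[of B] intro!: mult_left_mono)
    qed auto
    then have "\<bar>(f (x + s *\<^sub>R b) - f x) / s\<bar> \<le> B" using s by (simp add: abs_divide divide_le_eq)
    then have "\<bar>q n x\<bar> \<le> B" unfolding q_def s_def .
    then show ?thesis using True by simp
  next
    case False
    have "norm (inverse (real (Suc n)) *\<^sub>R b) \<le> 1 * norm b"
      unfolding norm_scaleR by (intro mult_right_mono) (auto simp: inverse_le_1_iff)
    then have "r \<le> norm (x + inverse (real (Suc n)) *\<^sub>R b)"
      using False norm_triangle_ineq4[of "x + inverse (real (Suc n)) *\<^sub>R b" "inverse (real (Suc n)) *\<^sub>R b"] by simp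
    moreover have "r \<le> norm x" using False norm_ge_zero[of b] by linarith
    ultimately show ?thesis using supp(1) False B0 by (simp add: q_def)
  qed
  have "(\<lambda>n. LINT x|lborel. q n x) \<longlonglongrightarrow> (LINT x|lborel. f' x b)"
  proof (rule integral_dominated_convergence[where w="\<lambda>x. B * indicator (cball 0 (r + norm b)) x"])
    show "(\<lambda>x. f' x b) \<in> borel_measurable lborel" by simp
    show "q n \<in> borel_measurable lborel" for n unfolding q_def by measurable
    show "integrable lborel (\<lambda>x. B * indicator (cball 0 (r + norm b)) x)"
      by (intro integrable_mult_right integrable_real_indicator) (use emeasure_bounded_finite[OF bounded_cball] in \<open>auto simp: less_top\<close>)
    show "AE x in lborel. (\<lambda>n. q n x) \<longlonglongrightarrow> f' x b"
    proof (rule AE_I2)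
      fix x
      have "((\<lambda>s. f (x + s *\<^sub>R b)) has_derivative (\<lambda>h. f' (x + 0 *\<^sub>R b) (h *\<^sub>R b))) (at 0)"
        by (rule has_derivative_compose[OF _ df]) (auto intro!: derivative_eq_intros)
      then have "((\<lambda>s. f (x + s *\<^sub>R b)) has_real_derivative f' x b) (at 0)"
        unfolding has_field_derivative_def by (rule has_derivative_eq_rhs) (simp add: lin fun_eq_iff)
      then have "((\<lambda>s. (f (x + s *\<^sub>R b) - f x) / s) \<longlongrightarrow> f' x b) (at 0)"
        by (simp add: has_field_derivative_iff)
      moreover have "filterlim (\<lambda>n. inverse (real (Suc n))) (at 0) sequentially"
        using LIMSEQ_inverse_real_of_nat by (simp add: filterlim_at)
      ultimately show "(\<lambda>n. q n x) \<longlonglongrightarrow> f' x b"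
        unfolding q_def by (rule filterlim_compose)
    qed
    show "AE x in lborel. norm (q n x) \<le> B * indicator (cball 0 (r + norm b)) x" for n
      using q_bound by simp
  qed
  moreover have "(LINT x|lborel. q n x) = 0" for n
  proof -
    have eq: "(LINT x|lborel. f (x + inverse (real (Suc n)) *\<^sub>R b)) = (LINT x|lborel. f x)"
      using integral_lborel_translation[OF fm, of "inverse (real (Suc n)) *\<^sub>R b"] by (simp add: add.commute)
    have "integrable lborel (\<lambda>x. f (inverse (real (Suc n)) *\<^sub>R b + x))"
      using intf lborel_affine[of 1 "inverse (real (Suc n)) *\<^sub>R b"]
      by (subst integrable_distr_eq[symmetric, where N=borel]) (auto simp: density_1)
    then show ?thesis
      unfolding q_def using eq intf by (simp add: add.commute)
  qed
  ultimately show ?thesis by (simp add: LIMSEQ_const_iff)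
qed

text \<open>The function \<open>\<psi>\<close> may be nonzero on the boundary of \<open>Om\<close>.
  There is no boundary term since \<open>u\<close> and its gradient are L1 limits of test functions
  \<open>\<phi> n\<close> and their gradients, and for those the identity says that a derivative of
  the compactly supported product \<open>\<phi> n * \<psi>\<close> has integral 0.\<close>

lemma W011_0_integration_by_parts:
  fixes u :: "real^3 \<Rightarrow> real"
  assumes W: "W011_0 Om u w" and Om: "open Om"
    and d\<psi>: "\<And>x. (\<psi> has_derivative \<psi>' x) (at x)" and cont: "continuous_on UNIV (\<lambda>x. \<psi>' x (axis j 1))"
    and B: "\<And>x. \<bar>\<psi> x\<bar> \<le> B" and B': "\<And>x. \<bar>\<psi>' x (axis j 1)\<bar> \<le> B'"
  shows "(LINT x:Om|lebesgue. u x * \<psi>' x (axis j 1)) = - (LINT x:Om|lebesgue. w j x * \<psi> x)"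
proof -
  let ?e = "axis j (1::real) :: real^3"
  have Ob: "Om \<in> sets borel" using Om by simp
  have iu: "set_integrable lebesgue Om u" and iw: "set_integrable lebesgue Om (w j)" using W by (auto simp: W011_0_def)
  obtain \<phi> where \<phi>: "\<And>n. test_fun (\<phi> n) Om"
    and l1: "(\<lambda>n. LINT x:Om|lebesgue. \<bar>\<phi> n x - u x\<bar>) \<longlonglongrightarrow> 0"
    and l2: "(\<lambda>n. LINT x:Om|lebesgue. \<bar>frechet_derivative (\<phi> n) (at x) ?e - w j x\<bar>) \<longlonglongrightarrow> 0"
    using W unfolding W011_0_def by blast
  have cont\<psi>: "continuous_on UNIV \<psi>"
    using has_derivative_continuous[OF d\<psi>] by (auto intro: continuous_at_imp_continuous_on)
  have m\<psi>[measurable]: "\<psi> \<in> borel_measurable lebesgue" "(\<lambda>x. \<psi>' x ?e) \<in> borel_measurable lebesgue"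
    using borel_measurable_continuous_onI[OF cont\<psi>] borel_measurable_continuous_onI[OF cont] by (auto intro: measurable_completion)
  have B0: "B \<ge> 0" "B' \<ge> 0" using B[of 0] B'[of 0] by linarith+
  define d where "d n x = frechet_derivative (\<phi> n) (at x) ?e" for n x
  \<comment> \<open>The identity for \<open>\<phi> n\<close> has value 0 and is subtracted; the L1
    errors of the function and of its derivative are then weighted by the bounds of
    \<open>\<psi>'\<close> and of \<open>\<psi>\<close>.\<close>
  have key: "\<bar>(LINT x:Om|lebesgue. u x * \<psi>' x ?e) + (LINT x:Om|lebesgue. w j x * \<psi> x)\<bar>
     \<le> B' * (LINT x:Om|lebesgue. \<bar>\<phi> n x - u x\<bar>) + B * (LINT x:Om|lebesgue. \<bar>d n x - w j x\<bar>)" for n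
  proof -
    have C: "Ck (Suc 0) (\<phi> n)" "compact (closure {z. \<phi> n z \<noteq> 0})" "closure {z. \<phi> n z \<noteq> 0} \<subseteq> Om"
      using \<phi>[of n] unfolding test_fun_def smooth_fun_def by auto
    have diff: "(\<phi> n has_derivative frechet_derivative (\<phi> n) (at x)) (at x)" for x
      using C(1) by (simp add: frechet_derivative_works[symmetric])
    have "?e \<in> Basis" by (auto simp: Basis_vec_def)
    then have contd: "continuous_on UNIV (d n)" using C(1) by (auto simp: d_def[abs_def])
    have cont\<phi>: "continuous_on UNIV (\<phi> n)"
      using has_derivative_continuous[OF diff] by (auto intro: continuous_at_imp_continuous_on)
    have zero: "\<phi> n x = 0 \<and> d n x = 0" if x: "x \<notin> closure {z. \<phi> n z \<noteq> 0}" for x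
    proof
      show "\<phi> n x = 0" using x closure_subset[of "{z. \<phi> n z \<noteq> 0}"] by auto
      have "((\<lambda>x. 0) has_derivative (\<lambda>h. 0)) (at x)" by simp
      then have "(\<phi> n has_derivative (\<lambda>h. 0)) (at x)"
        by (rule has_derivative_transform_within_open[where s="- closure {z. \<phi> n z \<noteq> 0}"])
           (use x closure_subset[of "{z. \<phi> n z \<noteq> 0}"] in auto)
      from frechet_derivative_at[OF this] show "d n x = 0" unfolding d_def by (metis)
    qed
    obtain r where r: "\<And>x. x \<in> closure {z. \<phi> n z \<noteq> 0} \<Longrightarrow> norm x < r"
      using compact_imp_bounded[OF C(2)] by (metis bounded_pos_less)
    have zr: "\<phi> n x = 0" "d n x = 0" if "r \<le> norm x" for x using zero[of x] r[of x] that by auto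
    have zOm: "\<phi> n x = 0" "d n x = 0" if "x \<notin> Om" for x using zero[of x] C(3) that by auto
    have "((\<lambda>x. \<phi> n x * \<psi> x) has_derivative (\<lambda>h. \<phi> n x * \<psi>' x h + frechet_derivative (\<phi> n) (at x) h * \<psi> x)) (at x)" for x
      by (rule has_derivative_mult[OF diff d\<psi>])
    note der = this
    have contsum: "continuous_on UNIV (\<lambda>x. \<phi> n x * \<psi>' x ?e + d n x * \<psi> x)"
      by (intro continuous_intros cont\<phi> cont contd cont\<psi>)
    have I0: "(LINT x|lborel. \<phi> n x * \<psi>' x ?e + d n x * \<psi> x) = 0"
      using integral_directional_derivative_zero[OF der, of ?e r] contsum zr by (simp add: d_def[symmetric])
    have I1: "(LINT x:Om|lebesgue. \<phi> n x * \<psi>' x ?e + d n x * \<psi> x) = 0"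
    proof -
      have "(LINT x:Om|lebesgue. \<phi> n x * \<psi>' x ?e + d n x * \<psi> x) = (LINT x|lebesgue. \<phi> n x * \<psi>' x ?e + d n x * \<psi> x)"
        unfolding set_lebesgue_integral_def by (intro Bochner_Integration.integral_cong) (auto simp: indicator_def zOm)
      also have "\<dots> = (LINT x|lborel. \<phi> n x * \<psi>' x ?e + d n x * \<psi> x)"
        using borel_measurable_continuous_onI[OF contsum] by (intro integral_completion) auto
      finally show ?thesis using I0 by simp
    qed
    have int\<phi>: "integrable lebesgue f" if cf: "continuous_on UNIV f" and zf: "\<And>x. r \<le> norm x \<Longrightarrow> f x = 0" for f :: "real^3 \<Rightarrow> real"
    proof -
      have "integrable lborel (\<lambda>z. indicator (cball 0 r) z *\<^sub>R f z)"
        by (rule borel_integrable_compact) (auto intro: continuous_on_subset[OF cf])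
      moreover have "(\<lambda>z. indicator (cball 0 r) z *\<^sub>R f z) = f"
        using zf by (auto simp: fun_eq_iff indicator_def)
      ultimately show ?thesis
        using borel_measurable_continuous_onI[OF cf] by (simp add: integrable_completion)
    qed
    have Ol: "Om \<in> sets lebesgue" using Om by simp
    have i\<phi>: "set_integrable lebesgue Om (\<phi> n)" "set_integrable lebesgue Om (d n)"
      using int\<phi>[OF cont\<phi> zr(1)] int\<phi>[OF contd zr(2)] Ol
      unfolding set_integrable_def by (auto intro: integrable_mult_indicator simp del: real_scaleR_def)
    have mult: "set_integrable lebesgue Om (\<lambda>x. f x * g x)"
      if "set_integrable lebesgue Om f" "g \<in> borel_measurable lebesgue" "\<And>x. \<bar>g x\<bar> \<le> C" for f g :: "real^3 \<Rightarrow> real" and C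
      using integrable_bounded_mult_right[OF that(1)[unfolded set_integrable_def] that(2,3)]
      by (simp add: set_integrable_def mult_ac)
    note ints = mult[OF iu m\<psi>(2) B'] mult[OF iw m\<psi>(1) B] mult[OF i\<phi>(1) m\<psi>(2) B'] mult[OF i\<phi>(2) m\<psi>(1) B]
    have "(LINT x:Om|lebesgue. u x * \<psi>' x ?e) + (LINT x:Om|lebesgue. w j x * \<psi> x)
       = (LINT x:Om|lebesgue. u x * \<psi>' x ?e) + (LINT x:Om|lebesgue. w j x * \<psi> x)
        - (LINT x:Om|lebesgue. \<phi> n x * \<psi>' x ?e + d n x * \<psi> x)" using I1 by simp
    also have "\<dots> = (LINT x:Om|lebesgue. (u x * \<psi>' x ?e + w j x * \<psi> x) - (\<phi> n x * \<psi>' x ?e + d n x * \<psi> x))"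
      using ints by (simp add: set_integral_add set_integral_diff)
    also have "\<bar>\<dots>\<bar> \<le> (LINT x:Om|lebesgue. B' * \<bar>\<phi> n x - u x\<bar> + B * \<bar>d n x - w j x\<bar>)"
      unfolding real_norm_def[symmetric] set_lebesgue_integral_def
    proof (rule LINT_norm_bound_integral)
      show "integrable lebesgue (\<lambda>x. indicat_real Om x *\<^sub>R (u x * \<psi>' x ?e + w j x * \<psi> x - (\<phi> n x * \<psi>' x ?e + d n x * \<psi> x)))"
        unfolding set_integrable_def[symmetric] using ints by (intro set_integral_diff set_integral_add)
      show "integrable lebesgue (\<lambda>x. indicat_real Om x *\<^sub>R (B' * norm (\<phi> n x - u x) + B * norm (d n x - w j x)))"
        unfolding set_integrable_def[symmetric] using i\<phi> iu iw
        by (intro set_integral_add set_integrable_mult_right set_integrable_norm set_integral_diff)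
      fix x
      have "\<bar>u x * \<psi>' x ?e + w j x * \<psi> x - (\<phi> n x * \<psi>' x ?e + d n x * \<psi> x)\<bar>
         = \<bar>\<psi>' x ?e * (u x - \<phi> n x) + \<psi> x * (w j x - d n x)\<bar>" by (simp add: algebra_simps)
      also have "\<dots> \<le> \<bar>\<psi>' x ?e\<bar> * \<bar>u x - \<phi> n x\<bar> + \<bar>\<psi> x\<bar> * \<bar>w j x - d n x\<bar>"
        by (metis abs_mult abs_triangle_ineq)
      also have "\<dots> \<le> B' * \<bar>u x - \<phi> n x\<bar> + B * \<bar>w j x - d n x\<bar>"
        using B B' by (intro add_mono mult_right_mono) auto
      finally show "norm (indicat_real Om x *\<^sub>R (u x * \<psi>' x ?e + w j x * \<psi> x - (\<phi> n x * \<psi>' x ?e + d n x * \<psi> x)))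
        \<le> indicat_real Om x *\<^sub>R (B' * norm (\<phi> n x - u x) + B * norm (d n x - w j x))"
        by (simp add: indicator_def abs_minus_commute)
    qed
    also have "\<dots> = B' * (LINT x:Om|lebesgue. \<bar>\<phi> n x - u x\<bar>) + B * (LINT x:Om|lebesgue. \<bar>d n x - w j x\<bar>)"
      using i\<phi> iu iw by (subst set_integral_add) (auto intro!: set_integrable_abs set_integral_diff)
    finally show ?thesis .
  qed
  have "(\<lambda>n. B' * (LINT x:Om|lebesgue. \<bar>\<phi> n x - u x\<bar>) + B * (LINT x:Om|lebesgue. \<bar>d n x - w j x\<bar>)) \<longlonglongrightarrow> B' * 0 + B * 0"
    using l1 l2 unfolding d_def by (intro tendsto_intros)
  then have "\<bar>(LINT x:Om|lebesgue. u x * \<psi>' x ?e) + (LINT x:Om|lebesgue. w j x * \<psi> x)\<bar> \<le> B' * 0 + B * 0"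
    by (rule tendsto_lowerbound) (use key in auto)
  then show ?thesis by simp
qed

subsection \<open>Change of variables for perturbations of the identity\<close>

lemma integrable_continuous_compact_support:
  fixes f :: "'a::euclidean_space \<Rightarrow> real"
  assumes cont: "continuous_on UNIV f" and supp: "\<And>x. x \<notin> ball c R \<Longrightarrow> f x = 0"
  shows "integrable lborel f"
proof -
  have "integrable lborel (\<lambda>z. indicator (cball c R) z *\<^sub>R f z)"
    by (rule borel_integrable_compact) (auto intro: continuous_on_subset[OF cont])
  moreover have "(\<lambda>z. indicator (cball c R) z *\<^sub>R f z) = f"
    using supp by (fastforce simp: fun_eq_iff indicator_def)
  ultimately show ?thesis by simp
qed

text \<open>The determinant of the identity minus \<open>h * a\<close>, expanded in
  \<open>h\<close>: up to sign the coefficients are the trace of \<open>a\<close>, the sum of its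
  principal 2 by 2 minors, and its determinant.\<close>

definition jac :: "(3 \<Rightarrow> 3 \<Rightarrow> real) \<Rightarrow> real \<Rightarrow> real" where
  "jac a h = 1 - h * (a 1 1 + a 2 2 + a 3 3)
    + h\<^sup>2 * (a 1 1 * a 2 2 + a 1 1 * a 3 3 + a 2 2 * a 3 3 - a 1 2 * a 2 1 - a 1 3 * a 3 1 - a 2 3 * a 3 2)
    - h ^ 3 * (a 1 1 * a 2 2 * a 3 3 + a 1 2 * a 2 3 * a 3 1 + a 1 3 * a 2 1 * a 3 2
        - a 1 1 * a 2 3 * a 3 2 - a 1 2 * a 2 1 * a 3 3 - a 1 3 * a 2 2 * a 3 1)"

lemma det_eq_jac: "det (\<chi> i j. (if i = j then 1 else 0) - h * a i j) = jac a h"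
  unfolding det_3 jac_def by (simp add: power2_eq_square power3_eq_cube algebra_simps)

text \<open>The source of the divergence in the transport formula: to first order in
  \<open>h\<close> only the trace survives.\<close>

lemma DERIV_jac: "(jac a has_real_derivative - (a 1 1 + a 2 2 + a 3 3)) (at 0)"
  unfolding jac_def[abs_def] by (auto intro!: derivative_eq_intros)

lemma jac_0 [simp]: "jac a 0 = 1"
  by (simp add: jac_def)

text \<open>The constant counts terms: three diagonal entries, six products of two entries, six
  products of three. For \<open>\<bar>h\<bar> \<le> 1\<close> the higher powers of \<open>h\<close>
  are at most \<open>\<bar>h\<bar>\<close>.\<close>

lemma jac_bound:
  assumes a: "\<And>i j. \<bar>a i j\<bar> \<le> L" and h: "\<bar>h\<bar> \<le> 1"
  shows "\<bar>jac a h - 1\<bar> \<le> (3 * L + 6 * L\<^sup>2 + 6 * L ^ 3) * \<bar>h\<bar>"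
proof -
  have L: "L \<ge> 0" using a[of 1 1] by linarith
  have 2: "\<bar>a i j * a k l\<bar> \<le> L\<^sup>2" for i j k l
    unfolding abs_mult power2_eq_square using a L by (intro mult_mono) auto
  have 3: "\<bar>a i j * a k l * a m n\<bar> \<le> L ^ 3" for i j k l m n
    using mult_mono[OF 2[of i j k l] a[of m n]] L by (simp add: abs_mult power3_eq_cube power2_eq_square)
  define t where "t = a 1 1 + a 2 2 + a 3 3"
  define e2 where "e2 = a 1 1 * a 2 2 + a 1 1 * a 3 3 + a 2 2 * a 3 3 - a 1 2 * a 2 1 - a 1 3 * a 3 1 - a 2 3 * a 3 2"
  define e3 where "e3 = a 1 1 * a 2 2 * a 3 3 + a 1 2 * a 2 3 * a 3 1 + a 1 3 * a 2 1 * a 3 2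
        - a 1 1 * a 2 3 * a 3 2 - a 1 2 * a 2 1 * a 3 3 - a 1 3 * a 2 2 * a 3 1"
  have t: "\<bar>t\<bar> \<le> 3 * L" unfolding t_def using a[of 1 1] a[of 2 2] a[of 3 3] by linarith
  have e2: "\<bar>e2\<bar> \<le> 6 * L\<^sup>2"
    unfolding e2_def using 2[of 1 1 2 2] 2[of 1 1 3 3] 2[of 2 2 3 3] 2[of 1 2 2 1] 2[of 1 3 3 1] 2[of 2 3 3 2] by linarith
  have e3: "\<bar>e3\<bar> \<le> 6 * L ^ 3"
    unfolding e3_def using 3[of 1 1 2 2 3 3] 3[of 1 2 2 3 3 1] 3[of 1 3 2 1 3 2] 3[of 1 1 2 3 3 2] 3[of 1 2 2 1 3 3] 3[of 1 3 2 2 3 1] by linarith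
  have h2: "\<bar>h\<^sup>2\<bar> \<le> \<bar>h\<bar>" "\<bar>h ^ 3\<bar> \<le> \<bar>h\<bar>"
    using h power_decreasing[of 1 2 "\<bar>h\<bar>"] power_decreasing[of 1 3 "\<bar>h\<bar>"] by (auto simp: power_abs)
  have "\<bar>jac a h - 1\<bar> = \<bar>- (h * t) + h\<^sup>2 * e2 - h ^ 3 * e3\<bar>"
    by (simp add: jac_def t_def e2_def e3_def)
  also have "\<dots> \<le> \<bar>h\<bar> * \<bar>t\<bar> + \<bar>h\<^sup>2\<bar> * \<bar>e2\<bar> + \<bar>h ^ 3\<bar> * \<bar>e3\<bar>"
    unfolding abs_mult[symmetric] by linarith
  also have "\<dots> \<le> \<bar>h\<bar> * (3 * L) + \<bar>h\<bar> * (6 * L\<^sup>2) + \<bar>h\<bar> * (6 * L ^ 3)"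
    using t e2 e3 h2 L by (intro add_mono mult_mono) auto
  finally show ?thesis by (simp add: algebra_simps)
qed

text \<open>As \<open>h *\<^sub>R w\<close> is a contraction, the map
  \<open>x - h *\<^sub>R w x\<close> is injective, and the fixed point of
  \<open>y + h *\<^sub>R w x\<close> shows that it is onto. So both integrals extend over the whole
  space and no image set has to be identified.\<close>

lemma change_of_variables_perturbation:
  fixes w :: "real^3 \<Rightarrow> real^3" and f :: "real^3 \<Rightarrow> real"
  assumes dw: "\<And>x. (w has_derivative Dw x) (at x)" and Dw: "\<And>x v. norm (Dw x v) \<le> L * norm v"
    and contDw: "\<And>v. continuous_on UNIV (\<lambda>x. Dw x v)"
    and h: "\<bar>h\<bar> * L < 1" and pos: "\<And>x. jac (\<lambda>i j. Dw x (axis j 1) $ i) h > 0"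
    and contf: "continuous_on UNIV f" and intf: "integrable lborel f"
  shows "(LINT x|lborel. f x) = (LINT x|lborel. f (x - h *\<^sub>R w x) * jac (\<lambda>i j. Dw x (axis j 1) $ i) h)"
    and "integrable lborel (\<lambda>x. f (x - h *\<^sub>R w x) * jac (\<lambda>i j. Dw x (axis j 1) $ i) h)"
proof -
  define S where "S x = x - h *\<^sub>R w x" for x
  define DS where "DS x v = v - h *\<^sub>R Dw x v" for x v
  define J where "J x = jac (\<lambda>i j. Dw x (axis j 1) $ i) h" for x
  have dS: "(S has_derivative DS x) (at x)" for x
    unfolding S_def[abs_def] DS_def[abs_def] by (intro has_derivative_diff has_derivative_ident has_derivative_scaleR_right dw)
  have lip: "norm (w x - w y) \<le> L * norm (x - y)" for x y
    by (rule differentiable_bound[where S=UNIV and f'=Dw]) (simp_all add: dw onorm_le Dw)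
  have lip': "dist (h *\<^sub>R w x) (h *\<^sub>R w y) \<le> \<bar>h\<bar> * L * dist x y" for x y
    using mult_left_mono[OF lip[of x y] abs_ge_zero[of h]]
    by (simp add: dist_norm scaleR_diff_right[symmetric] mult.assoc)
  have L: "0 \<le> \<bar>h\<bar> * L"
  proof -
    have "0 \<le> norm (Dw 0 (axis 1 1))" by simp
    also have "\<dots> \<le> L" using Dw[of 0 "axis 1 1"] by simp
    finally show ?thesis by simp
  qed
  have inj: "inj S"
  proof (rule injI)
    fix x y assume "S x = S y"
    then have "x - y = h *\<^sub>R w x - h *\<^sub>R w y" by (simp add: S_def algebra_simps)
    then have "dist x y \<le> \<bar>h\<bar> * L * dist x y" using lip'[of x y] by (simp add: dist_norm)
    then have "(1 - \<bar>h\<bar> * L) * dist x y \<le> 0" by (simp add: algebra_simps)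
    then show "x = y" using h by (simp add: mult_le_0_iff)
  qed
  have surj: "surj S"
    unfolding surj_def
  proof
    fix y
    have "\<exists>!x. y + h *\<^sub>R w x = x"
      by (rule banach_fix_type[OF L h]) (use lip' in auto)
    then obtain x where "y + h *\<^sub>R w x = x" by blast
    then show "\<exists>x. y = S x" by (intro exI[of _ x]) (simp add: S_def algebra_simps)
  qed
  have det: "det (matrix (DS x)) = J x" for x
  proof -
    have "matrix (DS x) = (\<chi> i j. (if i = j then 1 else 0) - h * Dw x (axis j 1) $ i)"
      by (simp add: matrix_def DS_def vec_eq_iff axis_def)
    then show ?thesis by (simp add: det_eq_jac J_def)
  qed
  \<comment> \<open>The change of variables rule is for functions with values in a Cartesian power
    of the reals, here \<open>real^1\<close>.\<close>
  let ?f = "\<lambda>x. vec (f x) :: real^1"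
  have fl: "integrable lebesgue f" using intf by (rule integrable_completion[THEN iffD2, rotated]) (use intf in auto)
  then have fa: "f absolutely_integrable_on UNIV" by (simp add: set_integrable_def)
  have If: "integral UNIV f = (LINT x|lborel. f x)"
    using integral_lborel[OF intf] by simp
  have "(\<lambda>x. \<bar>det (matrix (DS x))\<bar> *\<^sub>R ?f (S x)) absolutely_integrable_on UNIV \<and>
           integral UNIV (\<lambda>x. \<bar>det (matrix (DS x))\<bar> *\<^sub>R ?f (S x)) = vec (LINT x|lborel. f x)
     \<longleftrightarrow> ?f absolutely_integrable_on (S ` UNIV) \<and> integral (S ` UNIV) ?f = vec (LINT x|lborel. f x)"
    by (rule has_absolute_integral_change_of_variables) (use dS inj in auto)
  moreover have "(\<lambda>x. \<bar>det (matrix (DS x))\<bar> *\<^sub>R ?f (S x)) = (\<lambda>x. vec (f (S x) * J x))"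
    using abs_of_pos[OF pos] by (auto simp: fun_eq_iff det J_def vec_eq_iff)
  ultimately have *: "(\<lambda>x. f (S x) * J x) absolutely_integrable_on UNIV \<and> integral UNIV (\<lambda>x. f (S x) * J x) = (LINT x|lborel. f x)"
    using fa If surj by (simp add: absolutely_integrable_on_1_iff integral_on_1_eq vec_eq_iff)
  have contS: "continuous_on UNIV S"
    using has_derivative_continuous[OF dS] by (auto intro: continuous_at_imp_continuous_on)
  have contJ: "continuous_on UNIV J"
    unfolding J_def[abs_def] jac_def by (intro continuous_intros contDw)
  have cont: "continuous_on UNIV (\<lambda>x. f (S x) * J x)"
    by (intro continuous_intros contJ continuous_on_compose2[OF contf contS]) auto
  have m: "(\<lambda>x. f (S x) * J x) \<in> borel_measurable lborel"
    using borel_measurable_continuous_onI[OF cont] by simp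
  have il: "integrable lebesgue (\<lambda>x. f (S x) * J x)" using * by (simp add: set_integrable_def)
  then have "integrable lborel (\<lambda>x. f (S x) * J x)" using m by (simp add: integrable_completion)
  then show "integrable lborel (\<lambda>x. f (x - h *\<^sub>R w x) * jac (\<lambda>i j. Dw x (axis j 1) $ i) h)"
    by (simp add: S_def J_def)
  then have "(LINT x|lborel. f (S x) * J x) = integral UNIV (\<lambda>x. f (S x) * J x)"
    by (subst integral_lborel[symmetric]) (auto simp: S_def J_def)
  then show "(LINT x|lborel. f x) = (LINT x|lborel. f (x - h *\<^sub>R w x) * jac (\<lambda>i j. Dw x (axis j 1) $ i) h)"
    using * by (simp add: S_def J_def)
qed

subsection \<open>Functions of class C1 on space-time\<close>

lemma Basis_spacetime: "(1, 0) \<in> (Basis :: (real \<times> (real^3)) set)" "(0, axis j 1) \<in> (Basis :: (real \<times> (real^3)) set)"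
  by (auto simp: Basis_prod_def)

lemma C1_continuous_partials:
  assumes "Ck 1 g"
  shows "continuous_on UNIV (dt g)" "continuous_on UNIV (dx j g)"
  using assms Basis_spacetime unfolding dt_def[abs_def] dx_def[abs_def] by auto

lemma C1_has_derivative:
  assumes "Ck 1 g"
  shows "(g has_derivative (\<lambda>h. fst h * dt g z + (\<Sum>j\<in>UNIV. snd h $ j * dx j g z))) (at z)"
proof -
  have d: "(g has_derivative frechet_derivative g (at z)) (at z)"
    using assms by (cases z) (simp add: frechet_derivative_works[symmetric])
  interpret D: linear "frechet_derivative g (at z)" using has_derivative_linear[OF d] .
  have "frechet_derivative g (at z) h = fst h * dt g z + (\<Sum>j\<in>UNIV. snd h $ j * dx j g z)" for h
  proof -
    have "snd h = (\<Sum>j\<in>UNIV. snd h $ j *\<^sub>R axis j 1)"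
      using basis_expansion[of "snd h"] by (simp add: scalar_mult_eq_scaleR)
    then have "h = fst h *\<^sub>R (1, 0) + (\<Sum>j\<in>UNIV. snd h $ j *\<^sub>R (0, axis j 1))"
      by (simp add: prod_eq_iff fst_sum snd_sum)
    then have "frechet_derivative g (at z) h = frechet_derivative g (at z) (fst h *\<^sub>R (1, 0) + (\<Sum>j\<in>UNIV. snd h $ j *\<^sub>R (0, axis j 1)))"
      by simp
    also have "\<dots> = fst h * dt g z + (\<Sum>j\<in>UNIV. snd h $ j * dx j g z)"
      unfolding D.add D.sum D.scaleR dt_def dx_def by simp
    finally show ?thesis .
  qed
  then show ?thesis using d by (metis (no_types, lifting) has_derivative_eq_rhs ext)
qed

lemma C1_continuous: "Ck 1 g \<Longrightarrow> continuous_on UNIV g" for g :: "real \<times> (real^3) \<Rightarrow> real"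
  using has_derivative_continuous[OF C1_has_derivative] by (auto intro: continuous_at_imp_continuous_on)

text \<open>Provides the domination for difference quotients of \<open>g\<close>, which is C1 but
  need not be globally Lipschitz.\<close>

lemma C1_lipschitz_on_cball:
  fixes g :: "real \<times> (real^3) \<Rightarrow> real"
  assumes g: "Ck 1 g"
  obtains G where "G \<ge> 0" "\<And>z z'. z \<in> cball 0 \<rho> \<Longrightarrow> z' \<in> cball 0 \<rho> \<Longrightarrow> \<bar>g z - g z'\<bar> \<le> G * norm (z - z')"
proof -
  define D where "D z = \<bar>dt g z\<bar> + (\<Sum>j\<in>UNIV. \<bar>dx j g z\<bar>)" for z
  have "continuous_on UNIV D"
    unfolding D_def[abs_def] by (intro continuous_intros C1_continuous_partials g)
  then have "compact (D ` cball 0 \<rho>)"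
    by (intro compact_continuous_image) (auto intro: continuous_on_subset)
  then obtain G where G: "\<And>z. z \<in> cball 0 \<rho> \<Longrightarrow> \<bar>D z\<bar> \<le> G"
    using compact_imp_bounded bounded_iff by (metis imageI real_norm_def)
  show ?thesis
  proof (rule that[of "max G 0"])
    fix z z' :: "real \<times> (real^3)" assume zz: "z \<in> cball 0 \<rho>" "z' \<in> cball 0 \<rho>"
    have "norm (g z - g z') \<le> max G 0 * norm (z - z')"
    proof (rule differentiable_bound[OF convex_cball _ _ zz])
      fix x :: "real \<times> (real^3)" assume x: "x \<in> cball 0 \<rho>"
      show "(g has_derivative (\<lambda>h. fst h * dt g x + (\<Sum>j\<in>UNIV. snd h $ j * dx j g x))) (at x within cball 0 \<rho>)"
        using C1_has_derivative[OF g] by (rule has_derivative_at_withinI)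
      show "onorm (\<lambda>h. fst h * dt g x + (\<Sum>j\<in>UNIV. snd h $ j * dx j g x)) \<le> max G 0"
      proof (rule onorm_le)
        fix h :: "real \<times> (real^3)"
        have f: "\<bar>fst h\<bar> \<le> norm h" using norm_fst_le[of "fst h" "snd h"] by simp
        have s: "\<bar>snd h $ j\<bar> \<le> norm h" for j
          using component_le_norm_cart[of "snd h" j] norm_snd_le[of "snd h" "fst h"] by simp
        have "norm (fst h * dt g x + (\<Sum>j\<in>UNIV. snd h $ j * dx j g x)) \<le> \<bar>fst h\<bar> * \<bar>dt g x\<bar> + (\<Sum>j\<in>UNIV. \<bar>snd h $ j\<bar> * \<bar>dx j g x\<bar>)"
          unfolding abs_mult[symmetric] real_norm_def by (rule order_trans[OF abs_triangle_ineq add_left_mono]) (rule sum_abs)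
        also have "\<dots> \<le> norm h * \<bar>dt g x\<bar> + (\<Sum>j\<in>UNIV. norm h * \<bar>dx j g x\<bar>)"
          by (intro add_mono sum_mono mult_right_mono f s) auto
        also have "\<dots> = D x * norm h" by (simp add: D_def sum_distrib_left algebra_simps)
        also have "\<dots> \<le> max G 0 * norm h" using G[OF x] by (intro mult_right_mono) auto
        finally show "norm (fst h * dt g x + (\<Sum>j\<in>UNIV. snd h $ j * dx j g x)) \<le> max G 0 * norm h" .
      qed
    qed
    then show "\<bar>g z - g z'\<bar> \<le> max G 0 * norm (z - z')" by simp
  qed simp
qed

lemma Ck_1_one: "Ck 1 (\<lambda>z. 1 :: real)"
  by (simp add: frechet_derivative_const)

lemma dt_one: "dt (\<lambda>z. 1) z = 0" and dx_one: "dx j (\<lambda>z. 1) z = 0"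
  by (simp_all add: dt_def dx_def frechet_derivative_const)

subsection \<open>Smooth flows\<close>

text \<open>\<open>Y q r x\<close> is the position at time \<open>q\<close> of the trajectory that
  is at \<open>x\<close> at time \<open>r\<close>. The ODE is known on a time window only, and
  differentiability of \<open>Y\<close> in \<open>x\<close> is neither assumed nor derived.\<close>

locale smooth_flow =
  fixes b :: "real \<Rightarrow> real^3 \<Rightarrow> real^3" and Db :: "real \<Rightarrow> real^3 \<Rightarrow> real^3 \<Rightarrow> real^3"
    and T0 T1 L M :: real and c :: "real^3" and R :: real
    and Y :: "real \<Rightarrow> real \<Rightarrow> real^3 \<Rightarrow> real^3"
  assumes db: "r \<in> {T0..T1} \<Longrightarrow> (b r has_derivative Db r x) (at x)"
    and Db_bound: "r \<in> {T0..T1} \<Longrightarrow> norm (Db r x v) \<le> L * norm v"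
    and Db_cont: "r \<in> {T0..T1} \<Longrightarrow> continuous_on UNIV (\<lambda>x. Db r x v)"
    and L0: "L \<ge> 0"
    and b_bound: "r \<in> {T0..T1} \<Longrightarrow> norm (b r x) \<le> M"
    and b_uc: "uniformly_continuous_on ({T0..T1} \<times> UNIV) (\<lambda>(r, x). b r x)"
    and div_cont: "continuous_on ({T0..T1} \<times> UNIV) (\<lambda>(r, x). \<Sum>j\<in>UNIV. Db r x (axis j 1) $ j)"
    and b_supp: "r \<in> {T0..T1} \<Longrightarrow> x \<notin> ball c R \<Longrightarrow> b r x = 0"
    and flow_init: "Y r r x = x"
    and flow_ode: "q \<in> {T0..T1} \<Longrightarrow> ((\<lambda>q. Y q r x) has_vector_derivative b q (Y q r x)) (at q)"
begin

abbreviation "I \<equiv> {T0..T1}"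

definition divb :: "real \<Rightarrow> real^3 \<Rightarrow> real" where
  "divb r x = (\<Sum>j\<in>UNIV. Db r x (axis j 1) $ j)"

lemma b_lip: "r \<in> I \<Longrightarrow> norm (b r x - b r y) \<le> L * norm (x - y)"
  by (rule differentiable_bound[where S=UNIV and f'="Db r"]) (simp_all add: db onorm_le Db_bound)

text \<open>Gronwall for the squared distance, which stays differentiable where the curves meet, in
  both time directions. Applied to curves that agree at \<open>r\<close> it is uniqueness, hence the
  semigroup law and the rest points; in general it is Lipschitz dependence on the initial
  value.\<close>

lemma curves_estimate:
  assumes y: "\<And>q. q \<in> I \<Longrightarrow> (y has_vector_derivative b q (y q)) (at q)"
    and z: "\<And>q. q \<in> I \<Longrightarrow> (z has_vector_derivative b q (z q)) (at q)"
    and q: "q \<in> I" and r: "r \<in> I"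
  shows "norm (y q - z q) \<le> exp (L * \<bar>q - r\<bar>) * norm (y r - z r)"
proof -
  define f where "f \<tau> = (y \<tau> - z \<tau>) \<bullet> (y \<tau> - z \<tau>)" for \<tau>
  define f' where "f' \<tau> = 2 * ((y \<tau> - z \<tau>) \<bullet> (b \<tau> (y \<tau>) - b \<tau> (z \<tau>)))" for \<tau>
  have df: "(f has_real_derivative f' \<tau>) (at \<tau>)" if "\<tau> \<in> I" for \<tau>
  proof -
    have d: "((\<lambda>\<tau>. y \<tau> - z \<tau>) has_derivative (\<lambda>h. h *\<^sub>R (b \<tau> (y \<tau>) - b \<tau> (z \<tau>)))) (at \<tau>)"
      using has_vector_derivative_diff[OF y[OF that] z[OF that]] by (simp add: has_vector_derivative_def)
    show ?thesis
      unfolding f_def[abs_def] has_field_derivative_def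
      by (rule has_derivative_eq_rhs[OF has_derivative_inner[OF d d]])
         (auto simp: f'_def fun_eq_iff inner_commute)
  qed
  have bound: "\<bar>f' \<tau>\<bar> \<le> 2 * L * f \<tau>" if "\<tau> \<in> I" for \<tau>
  proof -
    have "\<bar>(y \<tau> - z \<tau>) \<bullet> (b \<tau> (y \<tau>) - b \<tau> (z \<tau>))\<bar> \<le> norm (y \<tau> - z \<tau>) * norm (b \<tau> (y \<tau>) - b \<tau> (z \<tau>))"
      by (rule Cauchy_Schwarz_ineq2)
    also have "\<dots> \<le> norm (y \<tau> - z \<tau>) * (L * norm (y \<tau> - z \<tau>))"
      by (intro mult_left_mono b_lip that) auto
    also have "\<dots> = L * f \<tau>" by (simp add: f_def dot_square_norm power2_eq_square)
    finally show ?thesis by (simp add: f'_def abs_mult)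
  qed
  have main: "f q \<le> exp (2 * L * \<bar>q - r\<bar>) * f r"
  proof (cases "r \<le> q")
    case True
    have "f q * exp (- (2 * L * q)) \<le> f r * exp (- (2 * L * r))"
    proof (rule DERIV_nonpos_imp_nonincreasing[OF True])
      fix x assume x: "r \<le> x" "x \<le> q"
      then have xI: "x \<in> I" using q r by auto
      have "((\<lambda>x. f x * exp (- (2 * L * x))) has_real_derivative (f' x - 2 * L * f x) * exp (- (2 * L * x))) (at x)"
        by (auto intro!: derivative_eq_intros df[OF xI] simp: algebra_simps)
      moreover have "(f' x - 2 * L * f x) * exp (- (2 * L * x)) \<le> 0"
        using bound[OF xI] by (intro mult_nonpos_nonneg) auto
      ultimately show "\<exists>y. ((\<lambda>x. f x * exp (- (2 * L * x))) has_real_derivative y) (at x) \<and> y \<le> 0" by blast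
    qed
    then have "f q * exp (- (2 * L * q)) * exp (2 * L * q) \<le> f r * exp (- (2 * L * r)) * exp (2 * L * q)"
      by (rule mult_right_mono) simp
    then show ?thesis using True by (simp add: mult.assoc exp_add[symmetric] right_diff_distrib algebra_simps)
  next
    case False
    then have le: "q \<le> r" by simp
    have "f q * exp (2 * L * q) \<le> f r * exp (2 * L * r)"
    proof (rule DERIV_nonneg_imp_nondecreasing[OF le])
      fix x assume x: "q \<le> x" "x \<le> r"
      then have xI: "x \<in> I" using q r by auto
      have "((\<lambda>x. f x * exp (2 * L * x)) has_real_derivative (f' x + 2 * L * f x) * exp (2 * L * x)) (at x)"
        by (auto intro!: derivative_eq_intros df[OF xI] simp: algebra_simps)
      moreover have "0 \<le> (f' x + 2 * L * f x) * exp (2 * L * x)"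
        using bound[OF xI] by (intro mult_nonneg_nonneg) auto
      ultimately show "\<exists>y. ((\<lambda>x. f x * exp (2 * L * x)) has_real_derivative y) (at x) \<and> 0 \<le> y" by blast
    qed
    then have "f q * exp (2 * L * q) * exp (- (2 * L * q)) \<le> f r * exp (2 * L * r) * exp (- (2 * L * q))"
      by (rule mult_right_mono) simp
    then show ?thesis using False by (simp add: mult.assoc exp_add[symmetric] right_diff_distrib algebra_simps)
  qed
  have "norm (y q - z q) ^ 2 \<le> (exp (L * \<bar>q - r\<bar>) * norm (y r - z r)) ^ 2"
    using main by (simp add: f_def dot_square_norm power_mult_distrib exp_double mult.assoc)
  then show ?thesis by (rule power2_le_imp_le) auto
qed

lemma flow_lip:
  "q \<in> I \<Longrightarrow> r \<in> I \<Longrightarrow> norm (Y q r x - Y q r y) \<le> exp (L * \<bar>q - r\<bar>) * norm (x - y)"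
  using curves_estimate[of "\<lambda>q. Y q r x" "\<lambda>q. Y q r y" q r] flow_ode by (simp add: flow_init)

lemma flow_semigroup: "q \<in> I \<Longrightarrow> r \<in> I \<Longrightarrow> p \<in> I \<Longrightarrow> Y q r (Y r p x) = Y q p x"
  using curves_estimate[of "\<lambda>q. Y q r (Y r p x)" "\<lambda>q. Y q p x" q r] flow_ode by (simp add: flow_init)

lemma flow_inverse: "q \<in> I \<Longrightarrow> r \<in> I \<Longrightarrow> Y r q (Y q r x) = x"
  by (simp add: flow_semigroup flow_init)

lemma flow_stationary:
  assumes "\<And>\<tau>. \<tau> \<in> I \<Longrightarrow> b \<tau> x = 0" and "q \<in> I" "r \<in> I"
  shows "Y q r x = x"
  using curves_estimate[of "\<lambda>q. Y q r x" "\<lambda>q. x" q r] flow_ode assms by (simp add: flow_init)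

lemma flow_outside: "x \<notin> ball c R \<Longrightarrow> q \<in> I \<Longrightarrow> r \<in> I \<Longrightarrow> Y q r x = x"
  by (rule flow_stationary) (auto intro: b_supp)

lemma flow_mem_ball_iff: "q \<in> I \<Longrightarrow> r \<in> I \<Longrightarrow> Y q r x \<in> ball c R \<longleftrightarrow> x \<in> ball c R"
  using flow_outside flow_inverse by metis

lemma flow_continuous: "q \<in> I \<Longrightarrow> r \<in> I \<Longrightarrow> continuous_on UNIV (Y q r)"
  by (rule lipschitz_on_continuous_on[where L="exp (L * \<bar>q - r\<bar>)"])
     (auto simp: lipschitz_on_def dist_norm flow_lip)

lemma flow_speed:
  assumes q: "q \<in> I" and r: "r \<in> I"
  shows "norm (Y q r x - x) \<le> M * \<bar>q - r\<bar>"
proof -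
  have "norm (Y q r x - Y r r x) \<le> M * norm (q - r)"
  proof (rule differentiable_bound[where S=I and f="\<lambda>q. Y q r x" and f'="\<lambda>q h. h *\<^sub>R b q (Y q r x)"])
    fix x' assume "x' \<in> I"
    then show "((\<lambda>q. Y q r x) has_derivative (\<lambda>h. h *\<^sub>R b x' (Y x' r x))) (at x' within I)"
      using flow_ode by (auto simp: has_vector_derivative_def intro: has_derivative_at_withinI)
    show "onorm (\<lambda>h. h *\<^sub>R b x' (Y x' r x)) \<le> M"
      using b_bound[OF \<open>x' \<in> I\<close>] by (intro onorm_le) (auto simp: mult.commute[of M] intro: mult_left_mono)
  qed (use q r in auto)
  then show ?thesis by (simp add: flow_init)
qed

text \<open>One explicit step, traced backwards from time \<open>r + h\<close> to \<open>r\<close>.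
  The error is \<open>o(h)\<close> uniformly in \<open>x\<close> and \<open>r\<close> because the
  field is uniformly continuous in space-time and bounded.\<close>

lemma flow_short_time:
  assumes e: "e > 0"
  obtains d where "d > 0" "\<And>r h x. r \<in> I \<Longrightarrow> r + h \<in> I \<Longrightarrow> \<bar>h\<bar> < d \<Longrightarrow>
    norm (Y r (r + h) x - (x - h *\<^sub>R b r x)) \<le> e * \<bar>h\<bar>"
proof -
  obtain d where d: "d > 0" and D: "\<And>r x r' x'. r \<in> I \<Longrightarrow> r' \<in> I \<Longrightarrow> dist (r', x') (r, x) < d \<Longrightarrow> norm (b r' x' - b r x) < e / 2"
    using b_uc e unfolding uniformly_continuous_on_def
    by (force simp: dist_norm dest: spec[of _ "e/2"])
  \<comment> \<open>Within time \<open>\<bar>h\<bar>\<close> the space-time point travels at most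
    \<open>(1 + \<bar>M\<bar>) * \<bar>h\<bar>\<close>, which must stay below \<open>d\<close>. The
    two halves of \<open>e\<close> pay for the variation of the field along the trajectory and for
    replacing time \<open>r + h\<close> by \<open>r\<close>.\<close>
  define d' where "d' = d / (1 + \<bar>M\<bar>)"
  show ?thesis
  proof (rule that[of d'])
    show "d' > 0" using d by (simp add: d'_def)
    fix r h x assume r: "r \<in> I" "r + h \<in> I" and h: "\<bar>h\<bar> < d'"
    have hd: "\<bar>h\<bar> * (1 + \<bar>M\<bar>) < d" using h by (simp add: d'_def pos_less_divide_eq)
    then have hd': "\<bar>h\<bar> + \<bar>M\<bar> * \<bar>h\<bar> < d" by (simp add: algebra_simps)
    have seg: "closed_segment (r + h) r \<subseteq> I"
      using r by (auto simp: closed_segment_eq_real_ivl split: if_splits)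
    have 1: "norm (Y r (r + h) x - Y (r + h) (r + h) x - (r - (r + h)) *\<^sub>R b (r + h) (Y (r + h) (r + h) x)) \<le> norm (r - (r + h)) * (e / 2)"
    proof (rule vector_differentiable_bound_linearization[where S="closed_segment (r+h) r" and f="\<lambda>q. Y q (r + h) x" and f'="\<lambda>q. b q (Y q (r + h) x)"])
      fix \<tau> assume \<tau>: "\<tau> \<in> closed_segment (r+h) r"
      then have \<tau>I: "\<tau> \<in> I" using seg by blast
      have t: "\<bar>\<tau> - (r + h)\<bar> \<le> \<bar>h\<bar>" using \<tau> by (auto simp: closed_segment_eq_real_ivl split: if_splits)
      show "((\<lambda>q. Y q (r + h) x) has_vector_derivative b \<tau> (Y \<tau> (r + h) x)) (at \<tau> within closed_segment (r + h) r)"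
        using flow_ode[OF \<tau>I] by (rule has_vector_derivative_at_within)
      have "dist (\<tau>, Y \<tau> (r + h) x) (r + h, x) \<le> \<bar>\<tau> - (r + h)\<bar> + norm (Y \<tau> (r + h) x - x)"
        unfolding dist_norm using norm_Pair_le[of "\<tau> - (r + h)" "Y \<tau> (r + h) x - x"] by simp
      also have "\<dots> \<le> \<bar>h\<bar> + \<bar>M\<bar> * \<bar>h\<bar>"
      proof (intro add_mono t)
        have "norm (Y \<tau> (r + h) x - x) \<le> M * \<bar>\<tau> - (r + h)\<bar>" by (rule flow_speed[OF \<tau>I r(2)])
        also have "\<dots> \<le> \<bar>M\<bar> * \<bar>h\<bar>" using t by (intro mult_mono) auto
        finally show "norm (Y \<tau> (r + h) x - x) \<le> \<bar>M\<bar> * \<bar>h\<bar>" .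
      qed
      also have "\<dots> < d" by (rule hd')
      finally show "norm (b \<tau> (Y \<tau> (r + h) x) - b (r + h) (Y (r + h) (r + h) x)) \<le> e / 2"
        using D[OF r(2) \<tau>I] by (simp add: flow_init less_imp_le)
    qed auto
    have hd'': "\<bar>h\<bar> < d"
      using hd' by (smt (verit) abs_ge_zero mult_nonneg_nonneg)
    have "norm (b (r + h) x - b r x) \<le> e / 2"
      using D[OF r(1) r(2), of x x] hd'' by (simp add: dist_Pair_Pair dist_real_def less_imp_le)
    then have 2: "norm (h *\<^sub>R (b r x - b (r + h) x)) \<le> \<bar>h\<bar> * (e / 2)"
      using mult_left_mono[OF _ abs_ge_zero[of h]] by (fastforce simp: norm_minus_commute)
    have "Y r (r + h) x - (x - h *\<^sub>R b r x) = (Y r (r + h) x - x + h *\<^sub>R b (r + h) x) + h *\<^sub>R (b r x - b (r + h) x)"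
      by (simp add: algebra_simps)
    also have "norm \<dots> \<le> norm (Y r (r + h) x - x + h *\<^sub>R b (r + h) x) + norm (h *\<^sub>R (b r x - b (r + h) x))"
      by (rule norm_triangle_ineq)
    also have "\<dots> \<le> \<bar>h\<bar> * (e / 2) + \<bar>h\<bar> * (e / 2)"
      using 1 2 by (intro add_mono) (auto simp: flow_init)
    finally show "norm (Y r (r + h) x - (x - h *\<^sub>R b r x)) \<le> e * \<bar>h\<bar>" by (simp add: algebra_simps)
  qed
qed


text \<open>Instead of differentiating the flow with respect to its initial value, one substitutes
  \<open>x - h b(r, x)\<close>, which agrees with the flow up to \<open>o(h)\<close>; a Lipschitz observable
  does not see the difference.\<close>

lemma transport_derivative:
  fixes \<phi> :: "real^3 \<Rightarrow> real"
  assumes \<phi>_lip: "\<And>x y. \<bar>\<phi> x - \<phi> y\<bar> \<le> \<Lambda> * norm (x - y)" and \<phi>_supp: "\<And>x. x \<notin> ball c R \<Longrightarrow> \<phi> x = 0"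
    and g: "Ck 1 g" and s: "s \<in> I" and r: "r \<in> I"
  shows "((\<lambda>r. LINT x|lborel. \<phi> (Y s r x) * g (r, x)) has_real_derivative
    (LINT x|lborel. \<phi> (Y s r x) * (dt g (r, x) + (\<Sum>j\<in>UNIV. dx j g (r, x) * b r x $ j) + g (r, x) * divb r x))) (at r within I)"
proof -
  define u where "u r x = \<phi> (Y s r x)" for r x
  define E where "E = exp (L * (T1 - T0))"
  have Lam: "\<Lambda> \<ge> 0" using \<phi>_lip[of 0 "axis 1 1"] abs_ge_zero order_trans by fastforce
  have M0: "M \<ge> 0" using b_bound[OF r, of 0] norm_ge_zero order_trans by blast
  have E: "E \<ge> 0" by (simp add: E_def)
  have u_lip: "\<bar>u q x - u q y\<bar> \<le> \<Lambda> * E * norm (x - y)" if q: "q \<in> I" for q x y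
  proof -
    have "norm (Y s q x - Y s q y) \<le> exp (L * \<bar>s - q\<bar>) * norm (x - y)" by (rule flow_lip[OF s q])
    also have "\<dots> \<le> E * norm (x - y)"
      unfolding E_def using L0 s q by (intro mult_right_mono) (auto intro: mult_left_mono)
    finally show ?thesis
      unfolding u_def using order_trans[OF \<phi>_lip mult_left_mono[OF _ Lam]] by (simp add: mult.assoc)
  qed
  have u_supp: "u q x = 0" if "q \<in> I" "x \<notin> ball c R" for q x
    unfolding u_def using flow_outside[OF that(2) s that(1)] \<phi>_supp that by simp
  have u_cont: "continuous_on UNIV (u q)" if q: "q \<in> I" for q
    by (rule lipschitz_on_continuous_on[where L="\<Lambda> * E"])
       (use u_lip[OF q] Lam E in \<open>auto simp: lipschitz_on_def dist_norm\<close>)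
  obtain U where U: "U \<ge> 0" "\<And>x. \<bar>u r x\<bar> \<le> U"
  proof (rule bounded_compact_support[OF u_cont[OF r], of "norm c + \<bar>R\<bar>"])
    fix z :: "real^3" assume "norm c + \<bar>R\<bar> \<le> norm z"
    then have "z \<notin> ball c R" using norm_triangle_ineq2[of z c] by (auto simp: dist_norm norm_minus_commute)
    then show "u r z = 0" by (rule u_supp[OF r])
  qed auto
  define a where "a x i j = Db r x (axis j 1) $ i" for x i j
  have a_eq: "a x = (\<lambda>i j. Db r x (axis j 1) $ i)" for x
    by (intro ext) (simp add: a_def)
  have a_bound: "\<bar>a x i j\<bar> \<le> L" for x i j
  proof -
    have "\<bar>a x i j\<bar> \<le> norm (Db r x (axis j 1))" unfolding a_def by (rule component_le_norm_cart)
    also have "\<dots> \<le> L" using Db_bound[OF r, of x "axis j 1"] by simp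
    finally show ?thesis .
  qed
  define CJ where "CJ = 3 * L + 6 * L\<^sup>2 + 6 * L ^ 3"
  have CJ: "CJ \<ge> 0" using L0 by (simp add: CJ_def)
  have jb: "\<bar>jac (a x) h - 1\<bar> \<le> CJ * \<bar>h\<bar>" if "\<bar>h\<bar> \<le> 1" for x h
    unfolding CJ_def by (rule jac_bound[OF a_bound that])
  \<comment> \<open>Radius of a ball containing every point at which \<open>g\<close> will be
    evaluated: times within 1 of \<open>r\<close>, and points of the spatial ball displaced by at
    most one unit of time at speed \<open>M\<close>.\<close>
  define \<rho> where "\<rho> = \<bar>r\<bar> + 1 + (norm c + \<bar>R\<bar> + M)"
  obtain G where G: "G \<ge> 0" "\<And>z z'. z \<in> cball 0 \<rho> \<Longrightarrow> z' \<in> cball 0 \<rho> \<Longrightarrow> \<bar>g z - g z'\<bar> \<le> G * norm (z - z')"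
    using C1_lipschitz_on_cball[OF g] by blast
  have "compact (g ` cball 0 \<rho>)"
    by (intro compact_continuous_image continuous_on_subset[OF C1_continuous[OF g]]) auto
  then obtain G0 where G0: "\<And>z. z \<in> cball 0 \<rho> \<Longrightarrow> \<bar>g z\<bar> \<le> G0"
    using compact_imp_bounded bounded_iff by (metis imageI real_norm_def)
  have "0 \<in> cball (0 :: real \<times> (real^3)) \<rho>" using M0 by (simp add: \<rho>_def)
  then have G00: "G0 \<ge> 0" using G0 abs_ge_zero order_trans by blast
  have in_ball: "(q, x - h *\<^sub>R b r x) \<in> cball 0 \<rho>" if "\<bar>q - r\<bar> \<le> 1" "\<bar>h\<bar> \<le> 1" "x \<in> ball c R" for q x h
  proof -
    have "norm (q, x - h *\<^sub>R b r x) \<le> norm q + norm (x - h *\<^sub>R b r x)" by (rule norm_Pair_le)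
    also have "norm q \<le> \<bar>r\<bar> + 1" using that(1) by simp
    also have "norm (x - h *\<^sub>R b r x) \<le> norm x + norm (h *\<^sub>R b r x)" by (rule norm_triangle_ineq4)
    also have "norm (h *\<^sub>R b r x) \<le> 1 * M" unfolding norm_scaleR using that(2) b_bound[OF r] by (intro mult_mono) auto
    also have "norm x \<le> norm c + \<bar>R\<bar>" using that(3) norm_triangle_ineq2[of x c] by (auto simp: dist_norm norm_minus_commute)
    finally show ?thesis by (simp add: \<rho>_def)
  qed
  define H where "H x = dt g (r, x) + (\<Sum>j\<in>UNIV. dx j g (r, x) * b r x $ j) + g (r, x) * divb r x" for x
  show ?thesis
    unfolding has_field_derivative_iff tendsto_at_iff_sequentially comp_def u_def[symmetric] H_def[symmetric]
  proof (intro allI impI)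
    fix q :: "nat \<Rightarrow> real"
    assume q: "\<forall>n. q n \<in> I - {r}" and qlim: "q \<longlonglongrightarrow> r"
    define h where "h n = q n - r" for n
    have hne: "h n \<noteq> 0" and qI: "q n \<in> I" and qh: "q n = r + h n" for n using q by (auto simp: h_def)
    have hlim: "h \<longlonglongrightarrow> 0" unfolding h_def using qlim by (simp add: LIM_zero)
    have hfl: "filterlim h (at 0) sequentially" using hlim hne by (simp add: filterlim_at)
    define S where "S n x = x - h n *\<^sub>R b r x" for n x
    \<comment> \<open>The integrand of the difference quotient after the substitution
      \<open>S n\<close> in the integral at time \<open>r\<close>. Both observables are then nearly
      equal at the same \<open>x\<close>, and only \<open>g\<close> and the Jacobian are
      differentiated.\<close>
    define D where "D n x = (u (q n) x * g (q n, x) - u r (S n x) * g (r, S n x) * jac (a x) (h n)) / h n" for n x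
    have S_out: "S n x = x" if "x \<notin> ball c R" for n x using b_supp[OF r that] by (simp add: S_def)
    have shift: "\<forall>\<^sub>F n in sequentially. \<forall>x. \<bar>u (q n) x - u r (S n x)\<bar> \<le> \<Lambda> * E * (e * \<bar>h n\<bar>)" if e: "e > 0" for e
    proof -
      obtain d where d: "d > 0" "\<And>r h x. r \<in> I \<Longrightarrow> r + h \<in> I \<Longrightarrow> \<bar>h\<bar> < d \<Longrightarrow> norm (Y r (r + h) x - (x - h *\<^sub>R b r x)) \<le> e * \<bar>h\<bar>"
        using flow_short_time[OF e] by blast
      have "\<forall>\<^sub>F n in sequentially. \<bar>h n\<bar> < d" using hlim d(1) by (auto simp: tendsto_iff dist_real_def)
      then show ?thesis
      proof eventually_elim
        case (elim n)
        show ?case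
        proof
          fix x
          have "u (q n) x = u r (Y r (r + h n) x)"
            unfolding u_def using flow_semigroup[OF s r qI[of n], of x] by (simp add: qh)
          then have "\<bar>u (q n) x - u r (S n x)\<bar> \<le> \<Lambda> * E * norm (Y r (r + h n) x - S n x)"
            using u_lip[OF r] by simp
          also have "\<dots> \<le> \<Lambda> * E * (e * \<bar>h n\<bar>)"
            unfolding S_def using d(2)[of r "h n" x] r qI[of n] elim Lam E by (intro mult_left_mono) (auto simp: qh)
          finally show "\<bar>u (q n) x - u r (S n x)\<bar> \<le> \<Lambda> * E * (e * \<bar>h n\<bar>)" .
        qed
      qed
    qed
    \<comment> \<open>This one threshold yields \<open>\<bar>h n\<bar> \<le> 1\<close>, the
      contraction condition for \<open>S n\<close>, and a positive Jacobian.\<close>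
    have small: "\<forall>\<^sub>F n in sequentially. \<bar>h n\<bar> < 1 / (1 + L + CJ)"
      using hlim L0 CJ by (auto simp: tendsto_iff dist_real_def)
    \<comment> \<open>Product rule: the change of the observable times the bound of
      \<open>g\<close>, plus the bound of the observable times the change of \<open>g\<close> over a
      distance of at most \<open>(1 + M) * \<bar>h n\<bar>\<close> and the deviation of the Jacobian
      from 1.\<close>
    define Cb where "Cb = \<Lambda> * E * G0 + U * (G * (1 + M) + G0 * CJ)"
    have bound: "\<forall>\<^sub>F n in sequentially. \<forall>x. \<bar>D n x\<bar> \<le> Cb * indicator (ball c R) x"
      using shift[OF zero_less_one] small
    proof eventually_elim
      case (elim n)
      have h1: "\<bar>h n\<bar> \<le> 1" using elim(2) L0 CJ by (smt (verit) divide_le_eq_1)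
      show ?case
      proof
        fix x
        show "\<bar>D n x\<bar> \<le> Cb * indicator (ball c R) x"
        proof (cases "x \<in> ball c R")
          case False
          then show ?thesis using u_supp[OF qI] u_supp[OF r] S_out by (simp add: D_def)
        next
          case True
          have b1: "(q n, x) \<in> cball 0 \<rho>" "(r, x - h n *\<^sub>R b r x) \<in> cball 0 \<rho>"
            using in_ball[of "q n" 0 x] in_ball[of r "h n" x] h1 True by (auto simp: qh)
          have gd: "\<bar>g (q n, x) - g (r, S n x)\<bar> \<le> G * (1 + M) * \<bar>h n\<bar>"
          proof -
            have "norm ((q n, x) - (r, S n x)) \<le> norm (q n - r) + norm (x - S n x)"
              using norm_Pair_le[of "q n - r" "x - S n x"] by simp
            also have "\<dots> \<le> \<bar>h n\<bar> + \<bar>h n\<bar> * M"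
              using b_bound[OF r, of x] by (auto simp: qh S_def intro: mult_left_mono)
            finally have "G * norm ((q n, x) - (r, S n x)) \<le> G * (\<bar>h n\<bar> + \<bar>h n\<bar> * M)"
              by (rule mult_left_mono) (rule G(1))
            then show ?thesis using G(2)[OF b1] unfolding S_def by (simp add: algebra_simps)
          qed
          have "\<bar>g (q n, x) - g (r, S n x) * jac (a x) (h n)\<bar> = \<bar>(g (q n, x) - g (r, S n x)) - g (r, S n x) * (jac (a x) (h n) - 1)\<bar>"
            by (simp add: algebra_simps)
          also have "\<dots> \<le> \<bar>g (q n, x) - g (r, S n x)\<bar> + \<bar>g (r, S n x)\<bar> * \<bar>jac (a x) (h n) - 1\<bar>"
            unfolding abs_mult[symmetric] by (rule abs_triangle_ineq4)
          also have "\<dots> \<le> G * (1 + M) * \<bar>h n\<bar> + G0 * (CJ * \<bar>h n\<bar>)"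
            using gd jb[OF h1] G0[OF b1(2)] G00 unfolding S_def by (intro add_mono mult_mono) auto
          finally have q2: "\<bar>g (q n, x) - g (r, S n x) * jac (a x) (h n)\<bar> \<le> (G * (1 + M) + G0 * CJ) * \<bar>h n\<bar>"
            by (simp add: algebra_simps)
          have "\<bar>D n x * h n\<bar> = \<bar>(u (q n) x - u r (S n x)) * g (q n, x) + u r (S n x) * (g (q n, x) - g (r, S n x) * jac (a x) (h n))\<bar>"
          proof -
            have "D n x * h n = u (q n) x * g (q n, x) - u r (S n x) * g (r, S n x) * jac (a x) (h n)"
              using hne by (simp add: D_def)
            then show ?thesis by (simp add: algebra_simps)
          qed
          also have "\<dots> \<le> \<bar>u (q n) x - u r (S n x)\<bar> * \<bar>g (q n, x)\<bar> + \<bar>u r (S n x)\<bar> * \<bar>g (q n, x) - g (r, S n x) * jac (a x) (h n)\<bar>"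
            unfolding abs_mult[symmetric] by (rule abs_triangle_ineq)
          also have "\<dots> \<le> (\<Lambda> * E * (1 * \<bar>h n\<bar>)) * G0 + U * ((G * (1 + M) + G0 * CJ) * \<bar>h n\<bar>)"
            using elim(1) G0[OF b1(1)] U q2 Lam E by (intro add_mono mult_mono) auto
          also have "\<dots> = Cb * \<bar>h n\<bar>" by (simp add: Cb_def algebra_simps)
          finally have "\<bar>D n x\<bar> \<le> Cb" using hne[of n] by (simp add: abs_mult)
          then show ?thesis using True by simp
        qed
      qed
    qed
    have good: "\<forall>\<^sub>F n in sequentially. integrable lborel (D n) \<and>
        ((LINT x|lborel. u (q n) x * g (q n, x)) - (LINT x|lborel. u r x * g (r, x))) / (q n - r) = (LINT x|lborel. D n x)"
      using small
    proof eventually_elim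
      case (elim n)
      have pos1: "1 + L + CJ > 0" using L0 CJ by linarith
      have hs: "\<bar>h n\<bar> * (1 + L + CJ) < 1" using elim pos1 by (simp add: pos_less_divide_eq)
      have h1: "\<bar>h n\<bar> \<le> 1" using elim L0 CJ by (smt (verit) divide_le_eq_1)
      have hL: "\<bar>h n\<bar> * L < 1"
        using hs CJ mult_left_mono[of L "1 + L + CJ" "\<bar>h n\<bar>"] by linarith
      have hCJ: "CJ * \<bar>h n\<bar> < 1"
        using hs L0 mult_left_mono[of CJ "1 + L + CJ" "\<bar>h n\<bar>"] by (simp add: mult.commute)
      have pos: "jac (\<lambda>i j. Db r x (axis j 1) $ i) (h n) > 0" for x
        using jb[OF h1, of x] hCJ unfolding a_def by linarith
      have gc: "continuous_on UNIV (\<lambda>x. g (q, x))" for q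
        by (rule continuous_on_compose2[OF C1_continuous[OF g]]) (auto intro: continuous_intros)
      have ci: "continuous_on UNIV (\<lambda>x. u q x * g (q, x))" "integrable lborel (\<lambda>x. u q x * g (q, x))" if "q \<in> I" for q
      proof -
        show "continuous_on UNIV (\<lambda>x. u q x * g (q, x))" by (intro continuous_intros u_cont[OF that] gc)
        then show "integrable lborel (\<lambda>x. u q x * g (q, x))"
          by (rule integrable_continuous_compact_support[where c=c and R=R]) (simp add: u_supp[OF that])
      qed
      note cov = change_of_variables_perturbation[where w="b r" and Dw="Db r" and L=L and h="h n",
          OF db[OF r] Db_bound[OF r] Db_cont[OF r] hL pos ci[OF r]]
      have i2: "integrable lborel (\<lambda>x. u r (S n x) * g (r, S n x) * jac (a x) (h n))"
        using cov(2) by (simp add: S_def a_eq)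
      have e2: "(LINT x|lborel. u r x * g (r, x)) = (LINT x|lborel. u r (S n x) * g (r, S n x) * jac (a x) (h n))"
        using cov(1) by (simp add: S_def a_eq)
      have "(LINT x|lborel. D n x) = ((LINT x|lborel. u (q n) x * g (q n, x)) - (LINT x|lborel. u r (S n x) * g (r, S n x) * jac (a x) (h n))) / h n"
        unfolding D_def using ci(2)[OF qI[of n]] i2 by simp
      moreover have "integrable lborel (D n)"
        unfolding D_def using ci(2)[OF qI[of n]] i2 by (intro integrable_divide Bochner_Integration.integrable_diff)
      ultimately show ?case using e2 by (simp add: h_def)
    qed
    have pointwise: "(\<lambda>n. D n x) \<longlonglongrightarrow> u r x * H x" for x
    proof -
      have d1: "((\<lambda>h. g (r + h, x)) has_real_derivative dt g (r, x)) (at 0)"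
      proof -
        have "((\<lambda>h. g (r + h, x)) has_derivative (\<lambda>h. fst (h, 0::real^3) * dt g (r + 0, x) + (\<Sum>j\<in>UNIV. snd (h, 0::real^3) $ j * dx j g (r + 0, x)))) (at 0)"
          by (rule has_derivative_compose[OF _ C1_has_derivative[OF g]]) (auto intro!: derivative_eq_intros)
        then show ?thesis unfolding has_field_derivative_def
          by (rule has_derivative_eq_rhs) (auto simp: fun_eq_iff mult.commute)
      qed
      have d2: "((\<lambda>h. g (r, x - h *\<^sub>R b r x)) has_real_derivative - (\<Sum>j\<in>UNIV. dx j g (r, x) * b r x $ j)) (at 0)"
      proof -
        have "((\<lambda>h. g (r, x - h *\<^sub>R b r x)) has_derivative (\<lambda>h. fst (0::real, - h *\<^sub>R b r x) * dt g (r, x - 0 *\<^sub>R b r x)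
            + (\<Sum>j\<in>UNIV. snd (0::real, - h *\<^sub>R b r x) $ j * dx j g (r, x - 0 *\<^sub>R b r x)))) (at 0)"
          by (rule has_derivative_compose[OF _ C1_has_derivative[OF g]]) (auto intro!: derivative_eq_intros)
        then show ?thesis unfolding has_field_derivative_def
          by (rule has_derivative_eq_rhs) (auto simp: fun_eq_iff sum_negf[symmetric] sum_distrib_left sum_distrib_right mult_ac simp del: sum_negf intro!: sum.cong)
      qed
      have dv: "a x 1 1 + a x 2 2 + a x 3 3 = divb r x"
        by (simp add: a_def divb_def sum_3)
      \<comment> \<open>The displacement and the Jacobian each contribute a minus sign, and their
        product is subtracted, so the transport term and the divergence appear with a plus.\<close>
      have "((\<lambda>h. g (r + h, x) - g (r, x - h *\<^sub>R b r x) * jac (a x) h) has_real_derivative H x) (at 0)"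
        by (rule derivative_eq_intros d1 d2 DERIV_jac refl)+ (simp add: H_def dv)
      then have "((\<lambda>h. (g (r + h, x) - g (r, x - h *\<^sub>R b r x) * jac (a x) h) / h) \<longlongrightarrow> H x) (at 0)"
        by (simp add: has_field_derivative_iff)
      from filterlim_compose[OF this hfl]
      have l1: "(\<lambda>n. (g (q n, x) - g (r, S n x) * jac (a x) (h n)) / h n) \<longlonglongrightarrow> H x"
        by (simp add: qh S_def)
      have Slim: "(\<lambda>n. S n x) \<longlonglongrightarrow> x"
      proof -
        have "(\<lambda>n. x - h n *\<^sub>R b r x) \<longlonglongrightarrow> x - 0 *\<^sub>R b r x" by (intro tendsto_intros hlim)
        then show ?thesis by (simp add: S_def)
      qed
      have l2: "(\<lambda>n. u r (S n x)) \<longlonglongrightarrow> u r x"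
        using u_cont[OF r] Slim continuous_on_tendsto_compose[of UNIV "u r" "\<lambda>n. S n x" x] by simp
      have l3: "(\<lambda>n. (u (q n) x - u r (S n x)) / h n) \<longlonglongrightarrow> 0"
      proof (rule LIMSEQ_I)
        fix e :: real assume e: "e > 0"
        define e' where "e' = e / (\<Lambda> * E + 1)"
        have LE: "\<Lambda> * E \<ge> 0" using Lam E by simp
        have e': "e' > 0" using e LE by (simp add: e'_def)
        have "\<forall>\<^sub>F n in sequentially. norm ((u (q n) x - u r (S n x)) / h n - 0) < e"
          using shift[OF e']
        proof eventually_elim
          case (elim n)
          have "\<bar>(u (q n) x - u r (S n x)) / h n\<bar> \<le> \<Lambda> * E * e'"
            using elim[rule_format, of x] hne[of n] by (simp add: abs_divide divide_le_eq mult.assoc)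
          also have "\<dots> < e" using e LE by (simp add: e'_def field_simps)
          finally show ?case by simp
        qed
        then show "\<exists>no. \<forall>n\<ge>no. norm ((u (q n) x - u r (S n x)) / h n - 0) < e"
          by (simp add: eventually_sequentially)
      qed
      have l4: "(\<lambda>n. g (q n, x)) \<longlonglongrightarrow> g (r, x)"
        using continuous_on_tendsto_compose[OF C1_continuous[OF g] tendsto_Pair[OF qlim tendsto_const[of x]]] by simp
      have "(\<lambda>n. (u (q n) x - u r (S n x)) / h n * g (q n, x) + u r (S n x) * ((g (q n, x) - g (r, S n x) * jac (a x) (h n)) / h n))
          \<longlonglongrightarrow> 0 * g (r, x) + u r x * H x"
        by (intro tendsto_intros l1 l2 l3 l4)
      moreover have "(u (q n) x - u r (S n x)) / h n * g (q n, x) + u r (S n x) * ((g (q n, x) - g (r, S n x) * jac (a x) (h n)) / h n) = D n x" for n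
        using hne[of n] by (simp add: D_def field_simps)
      ultimately show ?thesis by simp
    qed
    obtain N where N: "\<And>n. n \<ge> N \<Longrightarrow> \<forall>x. \<bar>D n x\<bar> \<le> Cb * indicator (ball c R) x"
      "\<And>n. n \<ge> N \<Longrightarrow> integrable lborel (D n) \<and>
        ((LINT x|lborel. u (q n) x * g (q n, x)) - (LINT x|lborel. u r x * g (r, x))) / (q n - r) = (LINT x|lborel. D n x)"
      using eventually_conj[OF bound good] unfolding eventually_sequentially by blast
    have mD: "D (i + N) \<in> borel_measurable borel" for i
      using N(2)[of "i + N"] borel_measurable_integrable[of lborel "D (i + N)"] by simp
    have "(\<lambda>n. LINT x|lborel. D (n + N) x) \<longlonglongrightarrow> (LINT x|lborel. u r x * H x)"
    proof (rule integral_dominated_convergence[where w="\<lambda>x. Cb * indicator (ball c R) x"])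
      show "(\<lambda>x. u r x * H x) \<in> borel_measurable lborel"
      proof (rule borel_measurable_LIMSEQ_real)
        show "(\<lambda>n. D (n + N) x) \<longlonglongrightarrow> u r x * H x" for x
          using pointwise by (rule LIMSEQ_ignore_initial_segment)
      qed (use mD in auto)
      show "integrable lborel (\<lambda>x. Cb * indicator (ball c R) x)"
        by (intro integrable_mult_right integrable_real_indicator)
           (use emeasure_bounded_finite[OF bounded_ball] in \<open>auto simp: less_top\<close>)
    qed (use N mD AE_I2[OF LIMSEQ_ignore_initial_segment[OF pointwise]] in auto)
    then have "(\<lambda>n. ((LINT x|lborel. u (q (n + N)) x * g (q (n + N), x)) - (LINT x|lborel. u r x * g (r, x))) / (q (n + N) - r))
        \<longlonglongrightarrow> (LINT x|lborel. u r x * H x)"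
      using N(2) by simp
    then show "(\<lambda>n. ((LINT x|lborel. u (q n) x * g (q n, x)) - (LINT x|lborel. u r x * g (r, x))) / (q n - r)) \<longlonglongrightarrow> (LINT x|lborel. u r x * H x)"
      by (rule LIMSEQ_offset)
  qed
qed

end

lemma interval_integral_nn_bound:
  fixes f :: "real \<Rightarrow> real"
  assumes s: "s \<in> {T0..T1}" and t: "t \<in> {T0..T1}"
    and le: "(\<integral>\<^sup>+r. ennreal \<bar>f r\<bar> * indicator {T0..T1} r \<partial>lborel) \<le> ennreal C" and C: "C \<ge> 0"
  shows "\<bar>LBINT r=s..t. f r\<bar> \<le> C"
proof -
  have *: "\<bar>LINT r:A|lborel. f r\<bar> \<le> C" if A: "A \<subseteq> {T0..T1}" for A
  proof (cases "set_integrable lborel A f")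
    case True
    have "ennreal \<bar>LINT r:A|lborel. f r\<bar> \<le> (\<integral>\<^sup>+r. ennreal (norm (indicator A r *\<^sub>R f r)) \<partial>lborel)"
      unfolding set_lebesgue_integral_def real_norm_def[symmetric]
      using True by (intro integral_norm_bound_ennreal) (simp add: set_integrable_def)
    also have "\<dots> \<le> (\<integral>\<^sup>+r. ennreal \<bar>f r\<bar> * indicator {T0..T1} r \<partial>lborel)"
      using A by (intro nn_integral_mono) (auto simp: indicator_def)
    also have "\<dots> \<le> ennreal C" by (rule le)
    finally show ?thesis using C by simp
  next
    \<comment> \<open>By convention the integral of a non-integrable function is 0, which satisfies
      the bound.\<close>
    case False
    then have "(LINT r:A|lborel. f r) = 0"
      unfolding set_lebesgue_integral_def set_integrable_def by (rule not_integrable_integral_eq)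
    then show ?thesis using C by simp
  qed
  show ?thesis
    using s t unfolding interval_lebesgue_integral_def
    by (auto intro!: * simp: einterval_iff)
qed

section \<open>The integrated transport identity and the compression estimate\<close>

context smooth_flow
begin

lemma b_continuous: "continuous_on (I \<times> UNIV) (\<lambda>(r, x). b r x)"
  using b_uc by (rule uniformly_continuous_imp_continuous)

lemma transport_integrand_continuous:
  fixes \<phi> :: "real^3 \<Rightarrow> real"
  assumes \<phi>_lip: "\<And>x y. \<bar>\<phi> x - \<phi> y\<bar> \<le> \<Lambda> * norm (x - y)" and \<phi>_supp: "\<And>x. x \<notin> ball c R \<Longrightarrow> \<phi> x = 0"
    and s: "s \<in> I" and H: "continuous_on (I \<times> UNIV) (\<lambda>(r, x). H r x)"
  shows "continuous_on (I \<times> UNIV) (\<lambda>(r, x). \<phi> (Y s r x) * H r x)"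
    and "continuous_on I (\<lambda>r. LINT x|lborel. \<phi> (Y s r x) * H r x)"
proof -
  have Lam: "\<Lambda> \<ge> 0" using \<phi>_lip[of 0 "axis 1 1"] abs_ge_zero order_trans by fastforce
  define E where "E = exp (L * (T1 - T0))"
  have E: "E \<ge> 0" by (simp add: E_def)
  define M' where "M' = \<bar>M\<bar>"
  have ulip: "\<bar>\<phi> (Y s r x) - \<phi> (Y s q y)\<bar> \<le> \<Lambda> * (E * (M' * \<bar>r - q\<bar> + norm (x - y)))" if r: "r \<in> I" and q: "q \<in> I" for r q x y
  proof -
    \<comment> \<open>A change of the initial time is converted into a change of the initial point:
      from time \<open>q\<close> to time \<open>r\<close> a point moves by at most speed times
      elapsed time.\<close>
    have "Y s q y = Y s r (Y r q y)" using flow_semigroup[OF s r q] by simp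
    then have "norm (Y s r x - Y s q y) \<le> exp (L * \<bar>s - r\<bar>) * norm (x - Y r q y)" using flow_lip[OF s r] by simp
    also have "\<dots> \<le> E * norm (x - Y r q y)"
      unfolding E_def using L0 s r by (intro mult_right_mono) (auto intro: mult_left_mono)
    also have "\<dots> \<le> E * (M' * \<bar>r - q\<bar> + norm (x - y))"
    proof (intro mult_left_mono E)
      have "norm (x - Y r q y) \<le> norm (x - y) + norm (Y r q y - y)"
        using norm_triangle_ineq[of "x - y" "y - Y r q y"] by (simp add: norm_minus_commute)
      also have "norm (Y r q y - y) \<le> M' * \<bar>r - q\<bar>"
        using flow_speed[OF r q, of y] by (rule order_trans) (auto simp: M'_def intro: mult_right_mono)
      finally show "norm (x - Y r q y) \<le> M' * \<bar>r - q\<bar> + norm (x - y)" by simp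
    qed
    finally show ?thesis using order_trans[OF \<phi>_lip mult_left_mono[OF _ Lam]] by blast
  qed
  have uc: "continuous_on (I \<times> UNIV) (\<lambda>(r, x). \<phi> (Y s r x))"
    unfolding continuous_on_sequentially
  proof (intro allI ballI impI)
    fix z a assume a: "a \<in> I \<times> (UNIV :: (real^3) set)" and z: "(\<forall>n. z n \<in> I \<times> (UNIV :: (real^3) set)) \<and> z \<longlonglongrightarrow> a"
    obtain r x where rx: "a = (r, x)" by (cases a)
    define q where "q n = fst (z n)" for n
    define y where "y n = snd (z n)" for n
    have zqy: "z n = (q n, y n)" for n by (simp add: q_def y_def)
    have lim: "q \<longlonglongrightarrow> r" "y \<longlonglongrightarrow> x"
      using z rx tendsto_fst[of z a sequentially] tendsto_snd[of z a sequentially] by (auto simp: q_def[abs_def] y_def[abs_def])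
    have 0: "(\<lambda>n. \<Lambda> * (E * (M' * \<bar>q n - r\<bar> + norm (y n - x)))) \<longlonglongrightarrow> \<Lambda> * (E * (M' * \<bar>r - r\<bar> + norm (x - x)))"
      by (intro tendsto_intros lim)
    have "(\<lambda>n. \<phi> (Y s (q n) (y n)) - \<phi> (Y s r x)) \<longlonglongrightarrow> 0"
    proof (rule Lim_null_comparison)
      show "\<forall>\<^sub>F n in sequentially. norm (\<phi> (Y s (q n) (y n)) - \<phi> (Y s r x)) \<le> \<Lambda> * (E * (M' * \<bar>q n - r\<bar> + norm (y n - x)))"
        using z a rx by (intro always_eventually allI) (auto simp: zqy intro!: ulip)
    qed (use 0 in simp)
    then show "((\<lambda>(r, x). \<phi> (Y s r x)) \<circ> z) \<longlonglongrightarrow> (case a of (r, x) \<Rightarrow> \<phi> (Y s r x))"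
      by (simp add: o_def zqy rx LIM_zero_iff)
  qed
  have "continuous_on (I \<times> UNIV) (\<lambda>z. (case z of (r, x) \<Rightarrow> \<phi> (Y s r x)) * (case z of (r, x) \<Rightarrow> H r x))"
    by (intro continuous_intros uc H)
  then show c: "continuous_on (I \<times> UNIV) (\<lambda>(r, x). \<phi> (Y s r x) * H r x)"
    by (simp add: case_prod_unfold)
  have supp: "\<phi> (Y s r x) * H r x = 0" if "r \<in> I" "x \<notin> ball c R" for r x
    using flow_outside[OF that(2) s that(1)] \<phi>_supp that by simp
  have "compact ((\<lambda>(r, x). \<phi> (Y s r x) * H r x) ` (I \<times> cball c R))"
    by (intro compact_continuous_image continuous_on_subset[OF c] compact_Times) auto
  then obtain B where B: "\<And>r x. r \<in> I \<Longrightarrow> x \<in> cball c R \<Longrightarrow> \<bar>\<phi> (Y s r x) * H r x\<bar> \<le> B"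
    using compact_imp_bounded bounded_iff by (force simp: bounded_iff)
  have cx: "continuous_on UNIV (\<lambda>x. \<phi> (Y s r x) * H r x)" if r: "r \<in> I" for r
  proof -
    have "continuous_on UNIV (\<lambda>x::real^3. (r, x))" by (intro continuous_intros)
    from continuous_on_compose2[OF c this] r show ?thesis by (auto simp: image_subset_iff)
  qed
  show "continuous_on I (\<lambda>r. LINT x|lborel. \<phi> (Y s r x) * H r x)"
    unfolding continuous_on_sequentially
  proof (intro allI ballI impI)
    fix q r assume r: "r \<in> I" and q: "(\<forall>n. q n \<in> I) \<and> q \<longlonglongrightarrow> r"
    show "((\<lambda>r. LINT x|lborel. \<phi> (Y s r x) * H r x) \<circ> q) \<longlonglongrightarrow> (LINT x|lborel. \<phi> (Y s r x) * H r x)"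
      unfolding o_def
    proof (rule integral_dominated_convergence[where w="\<lambda>x. B * indicator (ball c R) x"])
      show "(\<lambda>x. \<phi> (Y s r x) * H r x) \<in> borel_measurable lborel"
        using borel_measurable_continuous_onI[OF cx[OF r]] by simp
      show "(\<lambda>x. \<phi> (Y s (q n) x) * H (q n) x) \<in> borel_measurable lborel" for n
        using borel_measurable_continuous_onI[OF cx] q by simp
      show "integrable lborel (\<lambda>x. B * indicator (ball c R) x)"
        by (intro integrable_mult_right integrable_real_indicator)
           (use emeasure_bounded_finite[OF bounded_ball] in \<open>auto simp: less_top\<close>)
      show "AE x in lborel. norm (\<phi> (Y s (q n) x) * H (q n) x) \<le> B * indicator (ball c R) x" for n
      proof (rule AE_I2)
        fix x
        show "norm (\<phi> (Y s (q n) x) * H (q n) x) \<le> B * indicator (ball c R) x"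
          using B[of "q n" x] supp[of "q n" x] q by (cases "x \<in> ball c R") auto
      qed
      show "AE x in lborel. (\<lambda>n. \<phi> (Y s (q n) x) * H (q n) x) \<longlonglongrightarrow> \<phi> (Y s r x) * H r x"
      proof (rule AE_I2)
        fix x :: "real^3"
        have "(\<lambda>n. (q n, x)) \<longlonglongrightarrow> (r, x)" using q by (intro tendsto_intros) auto
        from continuous_on_tendsto_compose[OF c this] r q
        show "(\<lambda>n. \<phi> (Y s (q n) x) * H (q n) x) \<longlonglongrightarrow> \<phi> (Y s r x) * H r x" by simp
      qed
    qed
  qed
qed

lemma divb_continuous: "continuous_on (I \<times> UNIV) (\<lambda>(r, x). divb r x)"
  using div_cont by (simp add: divb_def)

lemma transport_rhs_continuous:
  assumes g: "Ck 1 g"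
  shows "continuous_on (I \<times> UNIV) (\<lambda>(r, x). dt g (r, x) + (\<Sum>j\<in>UNIV. dx j g (r, x) * b r x $ j) + g (r, x) * divb r x)"
proof -
  have "continuous_on (I \<times> UNIV) (\<lambda>z. dt g z + (\<Sum>j\<in>UNIV. dx j g z * (case z of (r, x) \<Rightarrow> b r x) $ j) + g z * (case z of (r, x) \<Rightarrow> divb r x))"
    by (intro continuous_intros divb_continuous b_continuous continuous_on_subset[OF C1_continuous[OF g]]
        continuous_on_subset[OF C1_continuous_partials(1)[OF g]] continuous_on_subset[OF C1_continuous_partials(2)[OF g]]) auto
  then show ?thesis by (simp add: case_prod_unfold)
qed

text \<open>Integration over the initial time \<open>r\<close> from \<open>s\<close> to
  \<open>t\<close>; at \<open>r = s\<close> the flow is the identity, which produces the term with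
  \<open>g (s, x)\<close>. The integral is oriented, so \<open>t < s\<close> is included.\<close>

lemma transport:
  fixes \<phi> :: "real^3 \<Rightarrow> real"
  assumes \<phi>_lip: "\<And>x y. \<bar>\<phi> x - \<phi> y\<bar> \<le> \<Lambda> * norm (x - y)" and \<phi>_supp: "\<And>x. x \<notin> ball c R \<Longrightarrow> \<phi> x = 0"
    and g: "Ck 1 g" and s: "s \<in> I" and t: "t \<in> I"
  shows "(LINT x|lborel. \<phi> (Y s t x) * g (t, x)) = (LINT x|lborel. \<phi> x * g (s, x)) +
    (LBINT r=s..t. (LINT x|lborel. \<phi> (Y s r x) * (dt g (r, x) + (\<Sum>j\<in>UNIV. dx j g (r, x) * b r x $ j) + g (r, x) * divb r x)))"
proof -
  have sub: "{min s t..max s t} \<subseteq> I" using s t by auto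
  have "(LBINT r=s..t. (LINT x|lborel. \<phi> (Y s r x) * (dt g (r, x) + (\<Sum>j\<in>UNIV. dx j g (r, x) * b r x $ j) + g (r, x) * divb r x)))
     = (LINT x|lborel. \<phi> (Y s t x) * g (t, x)) - (LINT x|lborel. \<phi> (Y s s x) * g (s, x))"
  proof (rule interval_integral_FTC_finite)
    show "continuous_on {min s t..max s t} (\<lambda>r. LINT x|lborel. \<phi> (Y s r x) * (dt g (r, x) + (\<Sum>j\<in>UNIV. dx j g (r, x) * b r x $ j) + g (r, x) * divb r x))"
      by (rule continuous_on_subset[OF transport_integrand_continuous(2)[OF \<phi>_lip \<phi>_supp s transport_rhs_continuous[OF g]] sub])
    fix r assume "min s t \<le> r" "r \<le> max s t"
    then have r: "r \<in> I" using sub by auto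
    show "((\<lambda>r. LINT x|lborel. \<phi> (Y s r x) * g (r, x)) has_vector_derivative
        (LINT x|lborel. \<phi> (Y s r x) * (dt g (r, x) + (\<Sum>j\<in>UNIV. dx j g (r, x) * b r x $ j) + g (r, x) * divb r x)))
       (at r within {min s t..max s t})"
      using DERIV_subset[OF transport_derivative[OF \<phi>_lip \<phi>_supp g s r] sub]
      by (simp add: has_real_derivative_iff_has_vector_derivative)
  qed
  then show ?thesis by (simp add: flow_init)
qed

text \<open>Gronwall through the logarithmic derivative of \<open>J + d\<close>. The shift
  \<open>d\<close> keeps the logarithm defined when \<open>J\<close> vanishes and tends to 0 at the
  end. The majorant \<open>m\<close> has extended values: where it is infinite the pointwise bound
  says nothing, and finiteness is asked of its time integral alone.\<close>

lemma compressibility: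
  fixes \<phi> :: "real^3 \<Rightarrow> real" and m :: "real \<Rightarrow> ennreal"
  assumes \<phi>_lip: "\<And>x y. \<bar>\<phi> x - \<phi> y\<bar> \<le> \<Lambda> * norm (x - y)" and \<phi>_supp: "\<And>x. x \<notin> ball c R \<Longrightarrow> \<phi> x = 0"
    and \<phi>_nonneg: "\<And>x. 0 \<le> \<phi> x" and s: "s \<in> I" and t: "t \<in> I"
    and m: "\<And>r x. r \<in> I \<Longrightarrow> ennreal \<bar>divb r x\<bar> \<le> m r"
    and m_int: "(\<integral>\<^sup>+r. m r * indicator I r \<partial>lborel) \<le> ennreal C" and C: "C \<ge> 0"
  shows "(LINT x|lborel. \<phi> (Y s t x)) \<le> exp C * (LINT x|lborel. \<phi> x)"
proof -
  define J where "J r = (LINT x|lborel. \<phi> (Y s r x))" for r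
  define J' where "J' r = (LINT x|lborel. \<phi> (Y s r x) * divb r x)" for r
  have J0: "J r \<ge> 0" for r unfolding J_def by (intro Bochner_Integration.integral_nonneg) (simp add: \<phi>_nonneg)
  have dJ: "(J has_real_derivative J' r) (at r within I)" if r: "r \<in> I" for r
    using transport_derivative[OF \<phi>_lip \<phi>_supp Ck_1_one s r] by (simp add: J_def[abs_def] J'_def dt_one dx_one)
  have cJ': "continuous_on I J'"
    unfolding J'_def[abs_def] by (rule transport_integrand_continuous(2)[OF \<phi>_lip \<phi>_supp s divb_continuous])
  have cJ: "continuous_on I J"
    using dJ DERIV_continuous_on by blast
  have int: "integrable lborel (\<lambda>x. \<phi> (Y s r x))" if r: "r \<in> I" for r
  proof (rule integrable_continuous_compact_support)
    have "continuous_on UNIV \<phi>"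
      by (rule lipschitz_on_continuous_on[where L="\<bar>\<Lambda>\<bar>"])
         (auto simp: lipschitz_on_def dist_norm intro!: order_trans[OF \<phi>_lip] mult_right_mono)
    then show "continuous_on UNIV (\<lambda>x. \<phi> (Y s r x))"
      by (rule continuous_on_compose2[OF _ flow_continuous[OF s r]]) auto
    show "\<phi> (Y s r x) = 0" if "x \<notin> ball c R" for x
      using flow_outside[OF that s r] \<phi>_supp that by simp
  qed
  have J'_le: "ennreal \<bar>J' r / (J r + d)\<bar> \<le> m r" if r: "r \<in> I" and d: "d > 0" for r d
  proof (cases "m r = top")
    case False
    then obtain k where k: "m r = ennreal k" "k \<ge> 0" by (cases "m r") auto
    have dk: "\<bar>divb r x\<bar> \<le> k" for x using m[OF r, of x] k by simp
    have "\<bar>J' r\<bar> \<le> (LINT x|lborel. k * \<phi> (Y s r x))"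
      unfolding J'_def real_norm_def[symmetric]
    proof (rule LINT_norm_bound_integral)
      have "continuous_on UNIV (\<lambda>x::real^3. (r, x))" by (intro continuous_intros)
      from continuous_on_compose2[OF divb_continuous this] r
      have "continuous_on UNIV (divb r)" by (auto simp: image_subset_iff)
      then have "divb r \<in> borel_measurable lborel" by (simp add: borel_measurable_continuous_onI)
      from integrable_bounded_mult_right[OF int[OF r] this dk]
      show "integrable lborel (\<lambda>x. \<phi> (Y s r x) * divb r x)" by (simp add: mult.commute)
      show "integrable lborel (\<lambda>x. k * \<phi> (Y s r x))" using int[OF r] by simp
      show "norm (\<phi> (Y s r x) * divb r x) \<le> k * \<phi> (Y s r x)" for x
        using mult_left_mono[OF dk[of x] \<phi>_nonneg[of "Y s r x"]] \<phi>_nonneg by (simp add: abs_mult mult.commute)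
    qed
    also have "\<dots> = k * J r" by (simp add: J_def)
    also have "\<dots> \<le> k * (J r + d)" using k d by (intro mult_left_mono) auto
    finally have "\<bar>J' r / (J r + d)\<bar> \<le> k" using J0[of r] d by (simp add: abs_divide divide_le_eq)
    then show ?thesis using k by (simp add: ennreal_leI)
  qed simp
  have sub: "{min s t..max s t} \<subseteq> I" using s t by auto
  have ineq: "J t + d \<le> exp C * (J s + d)" if d: "d > 0" for d
  proof -
    have pos: "J r + d > 0" for r using J0[of r] d by linarith
    have "(LBINT r=s..t. J' r / (J r + d)) = ln (J t + d) - ln (J s + d)"
    proof (rule interval_integral_FTC_finite)
      have "continuous_on I (\<lambda>r. J' r / (J r + d))"
        by (intro continuous_intros cJ' cJ) (use pos in \<open>auto simp: less_imp_neq[symmetric]\<close>)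
      then show "continuous_on {min s t..max s t} (\<lambda>r. J' r / (J r + d))"
        using sub by (rule continuous_on_subset)
      fix r assume "min s t \<le> r" "r \<le> max s t"
      then have r: "r \<in> I" using sub by auto
      have "((\<lambda>r. ln (J r + d)) has_real_derivative J' r / (J r + d)) (at r within I)"
        by (rule derivative_eq_intros dJ[OF r] pos refl)+ simp
      from DERIV_subset[OF this sub]
      show "((\<lambda>r. ln (J r + d)) has_vector_derivative J' r / (J r + d)) (at r within {min s t..max s t})"
        by (simp add: has_real_derivative_iff_has_vector_derivative)
    qed
    moreover have "\<bar>LBINT r=s..t. J' r / (J r + d)\<bar> \<le> C"
    proof (rule interval_integral_nn_bound[OF s t _ C])
      have "(\<integral>\<^sup>+r. ennreal \<bar>J' r / (J r + d)\<bar> * indicator I r \<partial>lborel) \<le> (\<integral>\<^sup>+r. m r * indicator I r \<partial>lborel)"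
        using J'_le[OF _ d] by (intro nn_integral_mono) (auto simp: indicator_def)
      then show "(\<integral>\<^sup>+r. ennreal \<bar>J' r / (J r + d)\<bar> * indicator I r \<partial>lborel) \<le> ennreal C"
        using m_int by (rule order_trans)
    qed
    ultimately have "ln (J t + d) \<le> C + ln (J s + d)" by linarith
    then have "exp (ln (J t + d)) \<le> exp (C + ln (J s + d))" by simp
    then show ?thesis using pos by (simp add: exp_add)
  qed
  have "J t \<le> exp C * J s"
  proof (rule field_le_epsilon)
    fix e :: real assume e: "e > 0"
    have "J t \<le> J t + e / exp C" using e by simp
    also have "\<dots> \<le> exp C * (J s + e / exp C)" using ineq e by simp
    also have "\<dots> = exp C * J s + e" by (simp add: distrib_left)
    finally show "J t \<le> exp C * J s + e" .
  qed
  then show ?thesis by (simp add: J_def flow_init)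
qed

end

subsection \<open>Almost everywhere convergence along subsequences\<close>

text \<open>What L2 convergence leaves: every subsequence has a further subsequence that converges
  almost everywhere. Quantifying over all subsequences lets one extract a common one for two
  sequences of maps and recover limits along the whole sequence for integrals.\<close>

definition subseq_AE_lim :: "'a measure \<Rightarrow> (nat \<Rightarrow> 'a \<Rightarrow> 'b::topological_space) \<Rightarrow> ('a \<Rightarrow> 'b) \<Rightarrow> bool" where
  "subseq_AE_lim M T T' \<longleftrightarrow>
    (\<forall>\<sigma> :: nat \<Rightarrow> nat. strict_mono \<sigma> \<longrightarrow> (\<exists>\<tau> :: nat \<Rightarrow> nat. strict_mono \<tau> \<and> (AE x in M. (\<lambda>n. T (\<sigma> (\<tau> n)) x) \<longlonglongrightarrow> T' x)))"

lemma subseq_AE_limD: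
  assumes "subseq_AE_lim M T T'" "strict_mono \<sigma>"
  obtains \<tau> where "strict_mono (\<tau> :: nat \<Rightarrow> nat)" "AE x in M. (\<lambda>n. T (\<sigma> (\<tau> n)) x) \<longlonglongrightarrow> T' x"
  using assms unfolding subseq_AE_lim_def by blast

lemma LIMSEQ_subsubseq:
  fixes a :: "nat \<Rightarrow> 'a::topological_space"
  assumes "\<And>\<sigma> :: nat \<Rightarrow> nat. strict_mono \<sigma> \<Longrightarrow> \<exists>\<tau>. strict_mono (\<tau> :: nat \<Rightarrow> nat) \<and> (\<lambda>n. a (\<sigma> (\<tau> n))) \<longlonglongrightarrow> l"
  shows "a \<longlonglongrightarrow> l"
proof (rule ccontr)
  assume "\<not> a \<longlonglongrightarrow> l"
  then obtain S where S: "open S" "l \<in> S" "\<not> eventually (\<lambda>n. a n \<in> S) sequentially"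
    unfolding tendsto_def by blast
  then have inf: "infinite {n. a n \<notin> S}"
    by (simp add: eventually_cofinite[symmetric] cofinite_eq_sequentially)
  \<comment> \<open>Enumerating the infinitely many indices whose terms avoid the neighbourhood
    gives a subsequence none of whose subsequences tends to \<open>l\<close>.\<close>
  define \<sigma> where "\<sigma> = enumerate {n. a n \<notin> S}"
  have \<sigma>: "strict_mono \<sigma>" unfolding \<sigma>_def using inf by (rule strict_mono_enumerate)
  then obtain \<tau> where \<tau>: "(\<lambda>n. a (\<sigma> (\<tau> n))) \<longlonglongrightarrow> l" using assms by blast
  have "eventually (\<lambda>n. a (\<sigma> (\<tau> n)) \<in> S) sequentially" using topological_tendstoD[OF \<tau> S(1,2)] .
  moreover have "a (\<sigma> n) \<notin> S" for n unfolding \<sigma>_def using enumerate_in_set[OF inf] by blast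
  ultimately show False by (simp add: eventually_sequentially)
qed

subsection \<open>Maps of bounded compression\<close>

text \<open>Preimages of all Lebesgue sets are required to be Lebesgue sets, more than a Lebesgue
  measurable map offers in general. This is what keeps compositions with Lebesgue measurable
  functions measurable.\<close>

definition compressing :: "real \<Rightarrow> (real^3 \<Rightarrow> real^3) \<Rightarrow> bool" where
  "compressing C T \<longleftrightarrow> (\<forall>B\<in>sets lebesgue. T -` B \<in> sets lebesgue \<and>
      emeasure lebesgue (T -` B) \<le> ennreal C * emeasure lebesgue B)"

lemma ennreal_le_epsilon_mult:
  fixes x y :: ennreal
  assumes C: "C \<ge> 0" and *: "\<And>e::real. e > 0 \<Longrightarrow> x \<le> ennreal C * (y + ennreal e)"
  shows "x \<le> ennreal C * y"
proof (rule ennreal_le_epsilon)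
  fix e :: real assume e: "e > 0"
  have "x \<le> ennreal C * (y + ennreal (e / (C + 1)))" using * C e by simp
  also have "\<dots> = ennreal C * y + ennreal (C * (e / (C + 1)))"
    using C e by (subst ennreal_mult) (auto simp: distrib_left)
  also have "\<dots> \<le> ennreal C * y + ennreal e"
    using C e by (intro add_left_mono ennreal_leI) (simp add: divide_simps)
  finally show "x \<le> ennreal C * y + ennreal e" .
qed

text \<open>Outer regularity carries the estimate from open sets to any set with measurable
  preimage. In particular Borel null sets have null preimages, and completeness then gives
  measurable preimages for all Lebesgue sets, each a Borel set up to part of a Borel null
  set.\<close>

lemma compressingI_open:
  assumes m: "T \<in> borel_measurable lebesgue" and C: "C \<ge> 0"
    and U: "\<And>U. open U \<Longrightarrow> emeasure lebesgue (T -` U) \<le> ennreal C * emeasure lebesgue U"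
  shows "compressing C T"
proof -
  have outer: "emeasure lebesgue (T -` B) \<le> ennreal C * emeasure lebesgue B"
    if B: "B \<in> sets lebesgue" "T -` B \<in> sets lebesgue" for B
  proof (rule ennreal_le_epsilon_mult[OF C])
    fix e :: real assume e: "e > 0"
    obtain W where W: "open W" "B \<subseteq> W" "W - B \<in> lmeasurable" "emeasure lebesgue (W - B) < ennreal e"
      using sets_lebesgue_outer_open[OF B(1) e] by blast
    have "T -` W \<in> sets lebesgue" using measurable_sets[OF m, of W] W(1) by simp
    then have "emeasure lebesgue (T -` B) \<le> emeasure lebesgue (T -` W)"
      using W(2) by (intro emeasure_mono) auto
    also have "\<dots> \<le> ennreal C * emeasure lebesgue W" by (rule U[OF W(1)])
    also have "emeasure lebesgue W \<le> emeasure lebesgue B + emeasure lebesgue (W - B)"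
    proof -
      have "W = B \<union> (W - B)" using W(2) by blast
      then show ?thesis using emeasure_subadditive[of B lebesgue "W - B"] B(1) W(3) by (metis fmeasurableD)
    qed
    also have "\<dots> \<le> emeasure lebesgue B + ennreal e" using W(4) by (intro add_left_mono) auto
    finally show "emeasure lebesgue (T -` B) \<le> ennreal C * (emeasure lebesgue B + ennreal e)"
      by (simp add: mult_left_mono)
  qed
  have "T -` B \<in> sets lebesgue" if B: "B \<in> sets lebesgue" for B
  proof -
    obtain S N N' where SN: "B = S \<union> N" "N \<subseteq> N'" "N' \<in> null_sets lborel" "S \<in> sets lborel"
      using sets_completionE[OF B] by blast
    have S: "T -` S \<in> sets lebesgue" using measurable_sets[OF m, of S] SN(4) by simp
    have N'1: "T -` N' \<in> sets lebesgue" using measurable_sets[OF m, of N'] SN(3) by auto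
    have "N' \<in> null_sets lebesgue" using SN(3) by (rule null_sets_completionI)
    then have N'2: "N' \<in> sets lebesgue" "emeasure lebesgue N' = 0" by (blast dest: null_setsD1 null_setsD2)+
    have "emeasure lebesgue (T -` N') \<le> ennreal C * 0" using outer[OF N'2(1) N'1] N'2(2) by (simp only:)
    then have "T -` N' \<in> null_sets lebesgue" using N'1 by (intro null_setsI) auto
    moreover have "T -` N \<subseteq> T -` N'" using SN(2) by auto
    ultimately have "T -` N \<in> sets lebesgue" by (meson completion.complete null_setsD2 null_sets_completion_subset)
    then show ?thesis using S SN(1) by (simp add: vimage_Un)
  qed
  then show ?thesis unfolding compressing_def using outer by blast
qed

lemma compressingD:
  assumes "compressing C T" "B \<in> sets lebesgue"
  shows "T -` B \<in> sets lebesgue" "emeasure lebesgue (T -` B) \<le> ennreal C * emeasure lebesgue B"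
  using assms unfolding compressing_def by blast+

lemma compressing_measurable: "compressing C T \<Longrightarrow> T \<in> measurable lebesgue lebesgue"
  unfolding compressing_def by (intro measurableI) auto

lemma compressing_borel_measurable: "compressing C T \<Longrightarrow> T \<in> borel_measurable lebesgue"
  unfolding compressing_def by (intro measurableI) auto

lemma compressing_null_set:
  assumes "compressing C T" "N \<in> null_sets lebesgue"
  shows "T -` N \<in> null_sets lebesgue"
proof -
  have N: "N \<in> sets lebesgue" "emeasure lebesgue N = 0" using assms(2) by (blast dest: null_setsD1 null_setsD2)+
  then have "emeasure lebesgue (T -` N) \<le> ennreal C * 0"
    using compressingD(2)[OF assms(1) N(1)] by (simp only:)
  then show ?thesis using compressingD(1)[OF assms(1) N(1)] by (intro null_setsI) auto
qed

lemma compressing_AE: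
  assumes "compressing C T" "AE x in lebesgue. P x"
  shows "AE x in lebesgue. P (T x)"
proof -
  obtain N where N: "N \<in> null_sets lebesgue" "{x. \<not> P x} \<subseteq> N"
    using assms(2) by (auto simp: eventually_ae_filter)
  show ?thesis
    using compressing_null_set[OF assms(1) N(1)] N(2) by (intro AE_I'[of "T -` N"]) auto
qed

text \<open>The image measure of Lebesgue measure under \<open>T\<close> is at most \<open>C\<close>
  times Lebesgue measure.\<close>

lemma compressing_nn_integral:
  assumes T: "compressing C T" and f: "f \<in> borel_measurable lebesgue"
  shows "(\<integral>\<^sup>+x. f (T x) \<partial>lebesgue) \<le> ennreal C * (\<integral>\<^sup>+x. f x \<partial>lebesgue)"
proof -
  note m = compressing_measurable[OF T]
  have "(\<integral>\<^sup>+x. f (T x) \<partial>lebesgue) = (\<integral>\<^sup>+x. f x \<partial>distr lebesgue lebesgue T)"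
    using m f by (simp add: nn_integral_distr)
  also have "\<dots> \<le> (\<integral>\<^sup>+x. f x \<partial>scale_measure (ennreal C) lebesgue)"
  proof (rule nn_integral_mono_measure)
    show "distr lebesgue lebesgue T \<le> scale_measure (ennreal C) lebesgue"
    proof -
      have "emeasure (distr lebesgue lebesgue T) X \<le> emeasure (scale_measure (ennreal C) lebesgue) X" for X
      proof (cases "X \<in> sets lebesgue")
        case True
        then show ?thesis using compressingD(2)[OF T True] m by (simp add: emeasure_distr del: emeasure_completion)
      next
        case False
        then show ?thesis using emeasure_notin_sets[of X "distr lebesgue lebesgue T"] by simp
      qed
      then show ?thesis by (simp add: le_measure_iff le_fun_def space_scale_measure)
    qed
  qed simp
  also have "\<dots> = ennreal C * (\<integral>\<^sup>+x. f x \<partial>lebesgue)" using f by (simp add: nn_integral_scale_measure)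
  finally show ?thesis .
qed

section \<open>Lipschitz approximation of open sets and bounded compression of limits\<close>

definition lip_approx :: "'a::metric_space set \<Rightarrow> nat \<Rightarrow> 'a \<Rightarrow> real" where
  "lip_approx V n x = min 1 (real n * infdist x (- V))"

lemma lip_approx_lipschitz: "\<bar>lip_approx V n x - lip_approx V n y\<bar> \<le> real n * dist x y"
proof -
  have "\<bar>infdist x (- V) - infdist y (- V)\<bar> \<le> dist x y"
    using infdist_triangle[of x "- V" y] infdist_triangle[of y "- V" x] by (simp add: dist_commute)
  then have "\<bar>real n * infdist x (- V) - real n * infdist y (- V)\<bar> \<le> real n * dist x y"
    unfolding right_diff_distrib[symmetric] abs_mult by (simp add: mult_left_mono)
  then show ?thesis unfolding lip_approx_def by linarith
qed

lemma lip_approx_range: "0 \<le> lip_approx V n x" "lip_approx V n x \<le> 1"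
  by (auto simp: lip_approx_def infdist_nonneg)

lemma lip_approx_outside: "x \<notin> V \<Longrightarrow> lip_approx V n x = 0"
  by (simp add: lip_approx_def)

lemma lip_approx_le_indicator: "lip_approx V n x \<le> indicator V x"
  using lip_approx_outside[of x V n] lip_approx_range(2)[of V n x] by (auto simp: indicator_def)

text \<open>A point of an open set has positive distance from the complement, so the truncation at 1
  is eventually active. \<open>V = UNIV\<close> must be excluded: \<open>infdist x {}\<close> is 0
  by convention, and the approximants would all vanish.\<close>

lemma lip_approx_tendsto:
  assumes V: "open V" "V \<noteq> UNIV"
  shows "(\<lambda>n. lip_approx V n x) \<longlonglongrightarrow> indicator V x"
proof (cases "x \<in> V")
  case True
  have "infdist x (- V) \<noteq> 0"
    using V True in_closed_iff_infdist_zero[of "- V" x] by auto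
  then have d: "infdist x (- V) > 0" using infdist_nonneg[of x "- V"] by linarith
  obtain N where N: "real N \<ge> 1 / infdist x (- V)" using real_arch_simple by blast
  have "lip_approx V n x = 1" if "n \<ge> N" for n
  proof -
    have "1 / infdist x (- V) \<le> real n" using N that by linarith
    then show ?thesis using d by (simp add: lip_approx_def min_def pos_divide_le_eq)
  qed
  then have "\<forall>\<^sub>F n in sequentially. lip_approx V n x = 1" by (auto simp: eventually_sequentially)
  then show ?thesis using True by (auto intro: tendsto_eventually)
qed (simp add: lip_approx_outside)

lemma continuous_lip_approx: "continuous_on UNIV (lip_approx V n)"
  by (rule lipschitz_on_continuous_on[where L="real n"])
     (auto simp: lipschitz_on_def dist_real_def lip_approx_lipschitz)

text \<open>Bounded compression passes from Lipschitz observables supported in the ball to all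
  Lebesgue sets; outside the ball the map is the identity, which costs the additional 1.\<close>

lemma compressingI_lipschitz:
  fixes T :: "real^3 \<Rightarrow> real^3"
  assumes cont: "continuous_on UNIV T" and C: "C \<ge> 0"
    and ball: "\<And>x. T x \<in> ball c R \<longleftrightarrow> x \<in> ball c R" and outside: "\<And>x. x \<notin> ball c R \<Longrightarrow> T x = x"
    and lip: "\<And>\<phi> \<Lambda>. (\<And>x y. \<bar>\<phi> x - \<phi> y\<bar> \<le> \<Lambda> * norm (x - y)) \<Longrightarrow> (\<And>x. x \<notin> ball c R \<Longrightarrow> \<phi> x = 0) \<Longrightarrow>
       (\<And>x. 0 \<le> \<phi> x) \<Longrightarrow> (LINT x|lborel. \<phi> (T x)) \<le> C * (LINT x|lborel. \<phi> x)"
  shows "compressing (C + 1) T"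
proof (rule compressingI_open)
  have Tm[measurable]: "T \<in> borel_measurable borel" using cont by (rule borel_measurable_continuous_onI)
  show "T \<in> borel_measurable lebesgue" by (simp add: measurable_completion)
  show "C + 1 \<ge> 0" using C by simp
  fix U :: "(real^3) set" assume U: "open U"
  define V where "V = U \<inter> ball c R"
  have V: "open V" "V \<noteq> UNIV" "V \<subseteq> ball c R"
    using U bounded_subset[OF bounded_ball, of V c R] not_bounded_UNIV by (auto simp: V_def)
  have Vm[measurable]: "V \<in> sets borel" and Um[measurable]: "U \<in> sets borel" using V U by auto
  define \<phi> where "\<phi> = lip_approx V"
  have z: "\<phi> n x = 0" if "x \<notin> ball c R" for n x
    unfolding \<phi>_def using V(3) that by (intro lip_approx_outside) auto
  have c\<phi>: "continuous_on UNIV (\<phi> n)" for n unfolding \<phi>_def by (rule continuous_lip_approx)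
  then have [measurable]: "\<phi> n \<in> borel_measurable borel" for n by (rule borel_measurable_continuous_onI)
  have Vbd: "(\<integral>\<^sup>+x. ennreal (\<phi> n (T x)) \<partial>lborel) \<le> ennreal C * emeasure lborel V" for n
  proof -
    have i1: "integrable lborel (\<lambda>x. \<phi> n (T x))"
      using continuous_on_compose2[OF c\<phi> cont, of n] ball z
      by (intro integrable_continuous_compact_support[where c=c and R=R]) auto
    have i2: "integrable lborel (\<phi> n)"
      using c\<phi> z by (intro integrable_continuous_compact_support[where c=c and R=R]) auto
    have nn: "0 \<le> \<phi> n x" for x unfolding \<phi>_def by (rule lip_approx_range)
    have "(\<integral>\<^sup>+x. ennreal (\<phi> n (T x)) \<partial>lborel) = ennreal (LINT x|lborel. \<phi> n (T x))"
      using i1 nn by (intro nn_integral_eq_integral) auto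
    also have "\<dots> \<le> ennreal (C * (LINT x|lborel. \<phi> n x))"
      by (intro ennreal_leI lip[where \<Lambda>="real n"])
         (use z nn lip_approx_lipschitz[of V n] in \<open>auto simp: \<phi>_def dist_norm\<close>)
    also have "\<dots> = ennreal C * (\<integral>\<^sup>+x. ennreal (\<phi> n x) \<partial>lborel)"
      using i2 nn C by (simp add: nn_integral_eq_integral ennreal_mult)
    also have "\<dots> \<le> ennreal C * (\<integral>\<^sup>+x. indicator V x \<partial>lborel)"
      unfolding \<phi>_def using lip_approx_le_indicator[of V n]
      by (intro mult_left_mono nn_integral_mono) (auto simp flip: ennreal_indicator intro: ennreal_leI)
    finally show ?thesis by simp
  qed
  have "emeasure lborel (T -` V) = (\<integral>\<^sup>+x. indicator V (T x) \<partial>lborel)"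
  proof -
    have "T -` V \<in> sets lborel" using measurable_sets[OF Tm Vm] by simp
    then have "emeasure lborel (T -` V) = (\<integral>\<^sup>+x. indicator (T -` V) x \<partial>lborel)" by simp
    then show ?thesis by (simp add: indicator_def)
  qed
  also have "\<dots> = (\<integral>\<^sup>+x. liminf (\<lambda>n. ennreal (\<phi> n (T x))) \<partial>lborel)"
  proof (intro nn_integral_cong)
    fix x
    have "(\<lambda>n. ennreal (\<phi> n (T x))) \<longlonglongrightarrow> ennreal (indicator V (T x))"
      unfolding \<phi>_def using lip_approx_tendsto[OF V(1,2)] by (intro tendsto_ennrealI)
    then show "indicator V (T x) = liminf (\<lambda>n. ennreal (\<phi> n (T x)))"
      using lim_imp_Liminf[OF sequentially_bot] by (metis ennreal_indicator)
  qed
  also have "\<dots> \<le> liminf (\<lambda>n. \<integral>\<^sup>+x. ennreal (\<phi> n (T x)) \<partial>lborel)"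
    by (intro nn_integral_liminf) simp
  also have "\<dots> \<le> ennreal C * emeasure lborel V"
    by (intro Liminf_le) (use Vbd in \<open>auto intro: always_eventually\<close>)
  finally have TV: "emeasure lborel (T -` V) \<le> ennreal C * emeasure lborel V" .
  have TVm: "T -` V \<in> sets borel" and TUm: "T -` U \<in> sets borel"
    using measurable_sets[OF Tm Vm] measurable_sets[OF Tm Um] by auto
  have "T -` U \<subseteq> T -` V \<union> U"
  proof
    fix x assume x: "x \<in> T -` U"
    show "x \<in> T -` V \<union> U"
    proof (cases "x \<in> ball c R")
      case True
      then have "T x \<in> ball c R" by (simp only: ball)
      then show ?thesis using x unfolding V_def by blast
    next
      case False
      from outside[OF this] x show ?thesis by auto
    qed
  qed
  then have "emeasure lborel (T -` U) \<le> emeasure lborel (T -` V \<union> U)"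
    using TVm by (intro emeasure_mono) auto
  also have "\<dots> \<le> emeasure lborel (T -` V) + emeasure lborel U"
    using TVm by (intro emeasure_subadditive) auto
  also have "\<dots> \<le> ennreal C * emeasure lborel U + emeasure lborel U"
  proof (intro add_right_mono order_trans[OF TV] mult_left_mono emeasure_mono)
  qed (auto simp: V_def)
  also have "\<dots> = ennreal (C + 1) * emeasure lborel U"
    using C by (simp add: distrib_right)
  finally show "emeasure lebesgue (T -` U) \<le> ennreal (C + 1) * emeasure lebesgue U"
    using TUm by simp
qed

text \<open>For open \<open>U\<close>, a limit point in \<open>U\<close> forces the approximating
  points into \<open>U\<close> eventually, so the indicator of the preimage is at most the lower
  limit of the approximating indicators. Fatou's lemma then suffices, and convergence along one
  subsequence is enough.\<close>

lemma compressing_limit: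
  assumes T: "\<And>k. compressing C (T k)" and lim: "subseq_AE_lim lebesgue T T'"
    and m: "T' \<in> borel_measurable lebesgue" and C: "C \<ge> 0"
  shows "compressing C T'"
proof (rule compressingI_open[OF m C])
  fix U :: "(real^3) set" assume U: "open U"
  obtain \<tau> where \<tau>: "strict_mono \<tau>" "AE x in lebesgue. (\<lambda>n. T (id (\<tau> n)) x) \<longlonglongrightarrow> T' x"
    using subseq_AE_limD[OF lim strict_mono_id] by blast
  have Ul: "U \<in> sets lebesgue" using U by simp
  have s: "T -` U \<in> sets lebesgue" if "T \<in> borel_measurable lebesgue" for T :: "real^3 \<Rightarrow> real^3"
    using measurable_sets[OF that, of U] U by simp
  have "emeasure lebesgue (T' -` U) = (\<integral>\<^sup>+x. indicator (T' -` U) x \<partial>lebesgue)"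
    using s[OF m] by simp
  also have "\<dots> \<le> (\<integral>\<^sup>+x. liminf (\<lambda>n. indicator (T (\<tau> n) -` U) x) \<partial>lebesgue)"
  proof (rule nn_integral_mono_AE)
    show "AE x in lebesgue. indicator (T' -` U) x \<le> (liminf (\<lambda>n. indicator (T (\<tau> n) -` U) x) :: ennreal)"
      using \<tau>(2)
    proof eventually_elim
      case (elim x)
      show ?case
      proof (cases "T' x \<in> U")
        case True
        then have "\<forall>\<^sub>F n in sequentially. T (\<tau> n) x \<in> U"
          using topological_tendstoD[OF elim U] by simp
        then have "\<forall>\<^sub>F n in sequentially. (1::ennreal) \<le> indicator (T (\<tau> n) -` U) x"
          by eventually_elim auto
        then have "1 \<le> (liminf (\<lambda>n. indicator (T (\<tau> n) -` U) x) :: ennreal)" by (rule Liminf_bounded)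
        then show ?thesis using True by simp
      qed simp
    qed
  qed
  also have "\<dots> \<le> liminf (\<lambda>n. \<integral>\<^sup>+x. indicator (T (\<tau> n) -` U) x \<partial>lebesgue)"
    using s[OF compressing_borel_measurable[OF T]] by (intro nn_integral_liminf) auto
  also have "\<dots> \<le> ennreal C * emeasure lebesgue U"
  proof (intro Liminf_le always_eventually allI)
    fix n
    show "(\<integral>\<^sup>+x. indicator (T (\<tau> n) -` U) x \<partial>lebesgue) \<le> ennreal C * emeasure lebesgue U"
      using compressingD[OF T Ul] by (simp only: nn_integral_indicator)
  qed simp
  finally show "emeasure lebesgue (T' -` U) \<le> ennreal C * emeasure lebesgue U" .
qed

lemma emeasure_ball_less_top: "emeasure lebesgue (ball (c::'a::euclidean_space) R) < top"
  using emeasure_bounded_finite[OF bounded_ball, of c R] by (simp add: less_top)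

lemma nn_integral_add4:
  assumes [measurable]: "f1 \<in> borel_measurable M" "f2 \<in> borel_measurable M" "f3 \<in> borel_measurable M" "f4 \<in> borel_measurable M"
  shows "(\<integral>\<^sup>+x. f1 x + f2 x + f3 x + f4 x \<partial>M) = (\<integral>\<^sup>+x. f1 x \<partial>M) + (\<integral>\<^sup>+x. f2 x \<partial>M) + (\<integral>\<^sup>+x. f3 x \<partial>M) + (\<integral>\<^sup>+x. f4 x \<partial>M)"
  by (simp add: nn_integral_add)

lemma nn_integral_bounded_tendsto_zero:
  fixes f :: "nat \<Rightarrow> real^3 \<Rightarrow> real"
  assumes m: "\<And>n. f n \<in> borel_measurable lebesgue" and bd: "\<And>n x. x \<in> ball c R \<Longrightarrow> \<bar>f n x\<bar> \<le> B"
    and lim: "AE x in lebesgue. x \<in> ball c R \<longrightarrow> (\<lambda>n. f n x) \<longlonglongrightarrow> 0"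
  shows "(\<lambda>n. \<integral>\<^sup>+x. ennreal \<bar>f n x\<bar> * indicator (ball c R) x \<partial>lebesgue) \<longlonglongrightarrow> 0"
proof -
  have [measurable]: "ball c R \<in> sets lebesgue" by simp
  have "(\<lambda>n. \<integral>\<^sup>+x. ennreal \<bar>f n x\<bar> * indicator (ball c R) x \<partial>lebesgue) \<longlonglongrightarrow> (\<integral>\<^sup>+x. 0 \<partial>(lebesgue :: (real^3) measure))"
  proof (rule nn_integral_dominated_convergence[where w="\<lambda>x. ennreal B * indicator (ball c R) x"])
    show "(\<lambda>x. ennreal \<bar>f n x\<bar> * indicator (ball c R) x) \<in> borel_measurable lebesgue" for n
      using m[of n] by measurable
    show "AE x in lebesgue. ennreal \<bar>f n x\<bar> * indicator (ball c R) x \<le> ennreal B * indicator (ball c R) x" for n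
      using bd[of _ n] by (intro AE_I2) (auto simp: indicator_def intro!: ennreal_leI)
    have "(\<integral>\<^sup>+x. ennreal B * indicator (ball c R) x \<partial>lebesgue) = ennreal B * emeasure lebesgue (ball c R)"
      by (subst nn_integral_cmult) (simp_all del: emeasure_completion)
    also have "\<dots> < \<infinity>" using emeasure_ball_less_top[of c R] by (auto simp: ennreal_mult_less_top simp del: emeasure_completion)
    finally show "(\<integral>\<^sup>+x. ennreal B * indicator (ball c R) x \<partial>lebesgue) < \<infinity>" .
    show "AE x in lebesgue. (\<lambda>n. ennreal \<bar>f n x\<bar> * indicator (ball c R) x) \<longlonglongrightarrow> 0"
      using lim
    proof eventually_elim
      case (elim x)
      show ?case
      proof (cases "x \<in> ball c R")
        case True
        then have "(\<lambda>n. \<bar>f n x\<bar>) \<longlonglongrightarrow> 0" using elim tendsto_rabs_zero by blast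
        then have "(\<lambda>n. ennreal \<bar>f n x\<bar>) \<longlonglongrightarrow> ennreal 0" by (rule tendsto_ennrealI)
        then show ?thesis using True by simp
      qed simp
    qed
  qed simp_all
  then show ?thesis by simp
qed

text \<open>Lusin's theorem in the form of approximation by continuous maps handles the composition
  of two maps that are only defined almost everywhere.\<close>

lemma limit_flow_inverse:
  fixes T S :: "nat \<Rightarrow> real^3 \<Rightarrow> real^3"
  assumes T: "\<And>k. compressing C (T k)" "compressing C T'" "subseq_AE_lim lebesgue T T'"
    and S: "\<And>k. S k \<in> borel_measurable lebesgue" "S' \<in> borel_measurable lebesgue" "subseq_AE_lim lebesgue S S'"
    and inv: "\<And>k x. S k (T k x) = x" and C: "C \<ge> 0"
    and Tb: "\<And>k x. x \<in> ball c R \<Longrightarrow> T k x \<in> ball c R" "\<And>x. x \<in> ball c R \<Longrightarrow> T' x \<in> ball c R"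
    and Sb: "\<And>k x. x \<in> ball c R \<Longrightarrow> S k x \<in> ball c R" "\<And>x. x \<in> ball c R \<Longrightarrow> S' x \<in> ball c R"
  shows "AE x in lebesgue. x \<in> ball c R \<longrightarrow> S' (T' x) = x"
proof (cases "R > 0")
  case False
  then have "ball c R = {}" by simp
  then show ?thesis by (simp only: empty_iff) simp
next
  case True
  let ?B = "ball c R"
  have [measurable]: "?B \<in> sets lebesgue" by simp
  obtain \<sigma>1 where \<sigma>1: "strict_mono (\<sigma>1 :: nat \<Rightarrow> nat)" "AE x in lebesgue. (\<lambda>n. T (id (\<sigma>1 n)) x) \<longlonglongrightarrow> T' x"
    using subseq_AE_limD[OF T(3) strict_mono_id] by blast
  \<comment> \<open>Extracting inside \<open>\<sigma>1\<close> makes both \<open>T\<close> and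
    \<open>S\<close> converge almost everywhere along the same indices.\<close>
  obtain \<tau> where \<tau>: "strict_mono (\<tau> :: nat \<Rightarrow> nat)" "AE x in lebesgue. (\<lambda>n. S (\<sigma>1 (\<tau> n)) x) \<longlonglongrightarrow> S' x"
    using subseq_AE_limD[OF S(3) \<sigma>1(1)] by blast
  define \<sigma> where "\<sigma> n = \<sigma>1 (\<tau> n)" for n
  have Tlim: "AE x in lebesgue. (\<lambda>n. T (\<sigma> n) x) \<longlonglongrightarrow> T' x"
    using \<sigma>1(2) by eventually_elim (use LIMSEQ_subseq_LIMSEQ[OF _ \<tau>(1)] in \<open>auto simp: o_def \<sigma>_def\<close>)
  have Slim: "AE x in lebesgue. (\<lambda>n. S (\<sigma> n) x) \<longlonglongrightarrow> S' x"
    using \<tau>(2) by (simp add: \<sigma>_def)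
  have mT: "T k \<in> borel_measurable lebesgue" "T' \<in> borel_measurable lebesgue" for k
    using T(1,2) by (auto intro: compressing_borel_measurable)
  have S'm: "S' measurable_on UNIV"
    by (rule lebesgue_measurable_imp_measurable_on) (use S(2) in auto)
  then obtain N g where N: "negligible N" and g: "\<And>n. continuous_on UNIV (g n)" and gl: "\<And>x. x \<notin> N \<Longrightarrow> (\<lambda>n. g n x) \<longlonglongrightarrow> S' x"
    unfolding measurable_on_def by auto
  have cb: "convex (cball c R)" "closed (cball c R)" "cball c R \<noteq> {}" using True by auto
  \<comment> \<open>Projection onto the closed ball bounds the approximating maps. It is continuous
    and fixes the values of \<open>S'\<close> at points of the ball, so it does not change the limit
    there.\<close>
  define G where "G n x = closest_point (cball c R) (g n x)" for n x
  have Gc: "continuous_on UNIV (G n)" for n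
    unfolding G_def[abs_def] by (rule continuous_on_compose2[OF continuous_on_closest_point[OF cb, of UNIV] g]) auto
  have Gm[measurable]: "G n \<in> borel_measurable borel" for n using Gc by (rule borel_measurable_continuous_onI)
  have Gl: "(\<lambda>n. G n x) \<longlonglongrightarrow> S' x" if "x \<notin> N" "x \<in> ?B" for x
  proof -
    have "(\<lambda>n. closest_point (cball c R) (g n x)) \<longlonglongrightarrow> closest_point (cball c R) (S' x)"
      using continuous_on_tendsto_compose[OF continuous_on_closest_point[OF cb, of UNIV] gl[OF that(1)]] by simp
    moreover have "closest_point (cball c R) (S' x) = S' x"
      using Sb(2)[OF that(2)] by (intro closest_point_self) auto
    ultimately show ?thesis by (simp add: G_def)
  qed
  have Gb: "G n x \<in> cball c R" for n x
    unfolding G_def using cb by (intro closest_point_in_set) auto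
  have dist2R: "norm (x - y) \<le> 2 * R" if "x \<in> cball c R" "y \<in> cball c R" for x y :: "real^3"
    using that dist_triangle2[of x y c] by (simp add: dist_norm[symmetric] dist_commute)
  have Nae: "AE x in lebesgue. x \<notin> N"
    using N by (intro AE_not_in) (simp add: negligible_iff_null_sets)
  define e where "e n = (\<integral>\<^sup>+x. ennreal \<bar>norm (S' x - G n x)\<bar> * indicator ?B x \<partial>lebesgue)" for n
  define \<beta> where "\<beta> k = (\<integral>\<^sup>+x. ennreal \<bar>norm (S' x - S (\<sigma> k) x)\<bar> * indicator ?B x \<partial>lebesgue)" for k
  define \<alpha> where "\<alpha> n k = (\<integral>\<^sup>+x. ennreal \<bar>norm (G n (T' x) - G n (T (\<sigma> k) x))\<bar> * indicator ?B x \<partial>lebesgue)" for n k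
  have Gml[measurable]: "G n \<in> borel_measurable lebesgue" for n by (simp add: measurable_completion)
  have GTm: "(\<lambda>x. G n (T k x)) \<in> borel_measurable lebesgue" "(\<lambda>x. G n (T' x)) \<in> borel_measurable lebesgue" for n k
    using measurable_compose[OF mT(1) Gm] measurable_compose[OF mT(2) Gm] by auto
  have elim: "e \<longlonglongrightarrow> 0"
    unfolding e_def
  proof (rule nn_integral_bounded_tendsto_zero[where B="2 * R"])
    show "(\<lambda>x. norm (S' x - G n x)) \<in> borel_measurable lebesgue" for n using S(2) Gml by measurable
    show "\<bar>norm (S' x - G n x)\<bar> \<le> 2 * R" if "x \<in> ?B" for n x
      using dist2R[of "S' x" "G n x"] Sb(2)[OF that] Gb by auto
    show "AE x in lebesgue. x \<in> ?B \<longrightarrow> (\<lambda>n. norm (S' x - G n x)) \<longlonglongrightarrow> 0"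
      using Nae
    proof eventually_elim
      case (elim x)
      show ?case
      proof
        assume "x \<in> ?B"
        from Gl[OF elim this] have "(\<lambda>n. norm (S' x - G n x)) \<longlonglongrightarrow> norm (S' x - S' x)" by (intro tendsto_intros)
        then show "(\<lambda>n. norm (S' x - G n x)) \<longlonglongrightarrow> 0" by simp
      qed
    qed
  qed
  have \<beta>lim: "\<beta> \<longlonglongrightarrow> 0"
    unfolding \<beta>_def
  proof (rule nn_integral_bounded_tendsto_zero[where B="2 * R"])
    show "(\<lambda>x. norm (S' x - S (\<sigma> k) x)) \<in> borel_measurable lebesgue" for k using S by measurable
    show "\<bar>norm (S' x - S (\<sigma> k) x)\<bar> \<le> 2 * R" if "x \<in> ?B" for k x
      using dist2R[of "S' x" "S (\<sigma> k) x"] Sb(2)[OF that] Sb(1)[OF that, of "\<sigma> k"] by auto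
    show "AE x in lebesgue. x \<in> ?B \<longrightarrow> (\<lambda>k. norm (S' x - S (\<sigma> k) x)) \<longlonglongrightarrow> 0"
      using Slim
    proof eventually_elim
      case (elim x)
      then have "(\<lambda>k. norm (S' x - S (\<sigma> k) x)) \<longlonglongrightarrow> norm (S' x - S' x)" by (intro tendsto_intros)
      then show ?case by simp
    qed
  qed
  have \<alpha>lim: "\<alpha> n \<longlonglongrightarrow> 0" for n
    unfolding \<alpha>_def
  proof (rule nn_integral_bounded_tendsto_zero[where B="2 * R"])
    show "(\<lambda>x. norm (G n (T' x) - G n (T (\<sigma> k) x))) \<in> borel_measurable lebesgue" for k using GTm by measurable
    show "\<bar>norm (G n (T' x) - G n (T (\<sigma> k) x))\<bar> \<le> 2 * R" if "x \<in> ?B" for k x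
      using dist2R[OF Gb Gb] by simp
    show "AE x in lebesgue. x \<in> ?B \<longrightarrow> (\<lambda>k. norm (G n (T' x) - G n (T (\<sigma> k) x))) \<longlonglongrightarrow> 0"
      using Tlim
    proof eventually_elim
      case (elim x)
      have "(\<lambda>k. G n (T (\<sigma> k) x)) \<longlonglongrightarrow> G n (T' x)"
        using continuous_on_tendsto_compose[OF Gc elim] by simp
      then have "(\<lambda>k. norm (G n (T' x) - G n (T (\<sigma> k) x))) \<longlonglongrightarrow> norm (G n (T' x) - G n (T' x))" by (intro tendsto_intros)
      then show ?case by simp
    qed
  qed
  define D where "D = (\<integral>\<^sup>+x. ennreal (norm (S' (T' x) - x)) * indicator ?B x \<partial>lebesgue)"
  have comp: "(\<integral>\<^sup>+x. ennreal \<bar>f (U x)\<bar> * indicator ?B x \<partial>lebesgue) \<le> ennreal C * (\<integral>\<^sup>+x. ennreal \<bar>f x\<bar> * indicator ?B x \<partial>lebesgue)"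
    if U: "compressing C U" "\<And>x. x \<in> ?B \<Longrightarrow> U x \<in> ?B" and f: "f \<in> borel_measurable lebesgue" for f :: "real^3 \<Rightarrow> real" and U
  proof -
    have "(\<integral>\<^sup>+x. ennreal \<bar>f (U x)\<bar> * indicator ?B x \<partial>lebesgue) \<le> (\<integral>\<^sup>+x. ennreal \<bar>f (U x)\<bar> * indicator ?B (U x) \<partial>lebesgue)"
      using U(2) by (intro nn_integral_mono) (auto simp: indicator_def simp del: mem_ball)
    also have "\<dots> \<le> ennreal C * (\<integral>\<^sup>+x. ennreal \<bar>f x\<bar> * indicator ?B x \<partial>lebesgue)"
      by (intro compressing_nn_integral[OF U(1), of "\<lambda>x. ennreal \<bar>f x\<bar> * indicator ?B x"] borel_measurable_times_ennreal
          borel_measurable_indicator measurable_compose[OF _ measurable_ennreal] borel_measurable_abs f) simp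
    finally show ?thesis .
  qed
  \<comment> \<open>The chain runs from \<open>S' (T' x)\<close> via \<open>G n (T' x)\<close>,
    \<open>G n (T x)\<close> and \<open>S' (T x)\<close> to \<open>S (T x) = x\<close>, with
    \<open>T\<close> and \<open>S\<close> at index \<open>\<sigma> k\<close>. Bounded compression
    removes the inner map from the first, third and fourth differences; continuity of
    \<open>G n\<close> handles the second.\<close>
  have Dle: "D \<le> ennreal C * e n + \<alpha> n k + ennreal C * e n + ennreal C * \<beta> k" for n k
  proof -
    let ?T = "T (\<sigma> k)"
    have mS'T: "(\<lambda>x. S' (U x)) \<in> borel_measurable lebesgue" if "compressing C U" for U
      using measurable_compose[OF compressing_measurable[OF that] S(2)] .
    have mST: "(\<lambda>x. S k (U x)) \<in> borel_measurable lebesgue" if "compressing C U" for U k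
      using measurable_compose[OF compressing_measurable[OF that] S(1)] .
    note ms = mS'T[OF T(2)] mS'T[OF T(1)] mST[OF T(1)] GTm
    have "D \<le> (\<integral>\<^sup>+x. ((ennreal \<bar>norm (S' (T' x) - G n (T' x))\<bar> * indicator ?B x + ennreal \<bar>norm (G n (T' x) - G n (?T x))\<bar> * indicator ?B x)
        + ennreal \<bar>norm (S' (?T x) - G n (?T x))\<bar> * indicator ?B x) + ennreal \<bar>norm (S' (?T x) - S (\<sigma> k) (?T x))\<bar> * indicator ?B x \<partial>lebesgue)"
      unfolding D_def
    proof (rule nn_integral_mono)
      fix x
      have "norm (S' (T' x) - x) \<le> norm (S' (T' x) - G n (T' x)) + norm (G n (T' x) - G n (?T x)) + norm (G n (?T x) - S' (?T x)) + norm (S' (?T x) - x)"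
        using norm_triangle_ineq[of "S' (T' x) - G n (T' x)" "G n (T' x) - G n (?T x)"]
          norm_triangle_ineq[of "S' (T' x) - G n (?T x)" "G n (?T x) - S' (?T x)"]
          norm_triangle_ineq[of "S' (T' x) - S' (?T x)" "S' (?T x) - x"] by simp
      also have "\<dots> = \<bar>norm (S' (T' x) - G n (T' x))\<bar> + \<bar>norm (G n (T' x) - G n (?T x))\<bar> + \<bar>norm (S' (?T x) - G n (?T x))\<bar> + \<bar>norm (S' (?T x) - S (\<sigma> k) (?T x))\<bar>"
        by (simp add: inv norm_minus_commute)
      finally have "ennreal (norm (S' (T' x) - x)) \<le> ennreal (\<bar>norm (S' (T' x) - G n (T' x))\<bar> + \<bar>norm (G n (T' x) - G n (?T x))\<bar> + \<bar>norm (S' (?T x) - G n (?T x))\<bar> + \<bar>norm (S' (?T x) - S (\<sigma> k) (?T x))\<bar>)"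
        by (rule ennreal_leI)
      also have "\<dots> = ennreal \<bar>norm (S' (T' x) - G n (T' x))\<bar> + ennreal \<bar>norm (G n (T' x) - G n (?T x))\<bar> + ennreal \<bar>norm (S' (?T x) - G n (?T x))\<bar> + ennreal \<bar>norm (S' (?T x) - S (\<sigma> k) (?T x))\<bar>"
        by (simp only: ennreal_plus abs_ge_zero add_nonneg_nonneg)
      finally show "ennreal (norm (S' (T' x) - x)) * indicator ?B x \<le> ((ennreal \<bar>norm (S' (T' x) - G n (T' x))\<bar> * indicator ?B x + ennreal \<bar>norm (G n (T' x) - G n (?T x))\<bar> * indicator ?B x)
        + ennreal \<bar>norm (S' (?T x) - G n (?T x))\<bar> * indicator ?B x) + ennreal \<bar>norm (S' (?T x) - S (\<sigma> k) (?T x))\<bar> * indicator ?B x"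
        by (cases "x \<in> ?B") simp_all
    qed
    also have "\<dots> = ((\<integral>\<^sup>+x. ennreal \<bar>norm (S' (T' x) - G n (T' x))\<bar> * indicator ?B x \<partial>lebesgue) + \<alpha> n k)
        + (\<integral>\<^sup>+x. ennreal \<bar>norm (S' (?T x) - G n (?T x))\<bar> * indicator ?B x \<partial>lebesgue) + (\<integral>\<^sup>+x. ennreal \<bar>norm (S' (?T x) - S (\<sigma> k) (?T x))\<bar> * indicator ?B x \<partial>lebesgue)"
      unfolding \<alpha>_def
      by (intro nn_integral_add4 borel_measurable_times_ennreal borel_measurable_indicator
          measurable_compose[OF _ measurable_ennreal] borel_measurable_abs measurable_compose[OF _ borel_measurable_norm] borel_measurable_diff ms) simp_all
    also have "\<dots> \<le> (ennreal C * e n + \<alpha> n k) + ennreal C * e n + ennreal C * \<beta> k"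
      unfolding e_def \<beta>_def
    proof (intro add_mono order_refl)
      show "(\<integral>\<^sup>+x. ennreal \<bar>norm (S' (T' x) - G n (T' x))\<bar> * indicator ?B x \<partial>lebesgue) \<le> ennreal C * (\<integral>\<^sup>+x. ennreal \<bar>norm (S' x - G n x)\<bar> * indicator ?B x \<partial>lebesgue)"
        by (rule comp[OF T(2) Tb(2), where f="\<lambda>x. norm (S' x - G n x)"]) (use S(2) Gml in measurable)
      show "(\<integral>\<^sup>+x. ennreal \<bar>norm (S' (?T x) - G n (?T x))\<bar> * indicator ?B x \<partial>lebesgue) \<le> ennreal C * (\<integral>\<^sup>+x. ennreal \<bar>norm (S' x - G n x)\<bar> * indicator ?B x \<partial>lebesgue)"
        by (rule comp[OF T(1) Tb(1), where f="\<lambda>x. norm (S' x - G n x)"]) (use S(2) Gml in measurable)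
      show "(\<integral>\<^sup>+x. ennreal \<bar>norm (S' (?T x) - S (\<sigma> k) (?T x))\<bar> * indicator ?B x \<partial>lebesgue) \<le> ennreal C * (\<integral>\<^sup>+x. ennreal \<bar>norm (S' x - S (\<sigma> k) x)\<bar> * indicator ?B x \<partial>lebesgue)"
        by (rule comp[OF T(1) Tb(1), where f="\<lambda>x. norm (S' x - S (\<sigma> k) x)"]) (use S in measurable)
    qed
    finally show ?thesis .
  qed
  \<comment> \<open>The order of the limits matters: \<open>k\<close> goes to infinity with
    \<open>n\<close> fixed, since the convergence of \<open>\<alpha> n k\<close> depends on the
    continuous map \<open>G n\<close>.\<close>
  have Dle2: "D \<le> ennreal C * e n + 0 + ennreal C * e n + ennreal C * 0" for n
  proof (rule LIMSEQ_le_const)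
    show "(\<lambda>k. ennreal C * e n + \<alpha> n k + ennreal C * e n + ennreal C * \<beta> k) \<longlonglongrightarrow> ennreal C * e n + 0 + ennreal C * e n + ennreal C * 0"
      by (intro tendsto_add tendsto_const \<alpha>lim ennreal_tendsto_cmult \<beta>lim) (simp_all add: less_top[symmetric])
  qed (use Dle in auto)
  have "D \<le> ennreal C * 0 + 0 + ennreal C * 0 + ennreal C * 0"
  proof (rule LIMSEQ_le_const)
    show "(\<lambda>n. ennreal C * e n + 0 + ennreal C * e n + ennreal C * 0) \<longlonglongrightarrow> ennreal C * 0 + 0 + ennreal C * 0 + ennreal C * 0"
      by (intro tendsto_add tendsto_const ennreal_tendsto_cmult elim) (simp_all add: less_top[symmetric])
  qed (use Dle2 in auto)
  then have "D = 0" by simp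
  moreover have "(\<lambda>x. S' (T' x)) \<in> borel_measurable lebesgue"
    using measurable_compose[OF compressing_measurable[OF T(2)] S(2)] .
  moreover have "(\<lambda>x::real^3. x) \<in> borel_measurable lebesgue" by (rule measurable_completion) simp
  ultimately have "AE x in lebesgue. ennreal (norm (S' (T' x) - x)) * indicator ?B x = 0"
    unfolding D_def
    by (subst (asm) nn_integral_0_iff_AE)
       (auto intro!: borel_measurable_times_ennreal borel_measurable_indicator measurable_compose[OF _ measurable_ennreal]
          measurable_compose[OF _ borel_measurable_norm] borel_measurable_diff simp del: mem_ball)
  then show ?thesis
    by eventually_elim (auto simp: indicator_def split: if_splits)
qed

text \<open>Along a subsequence this is dominated convergence with majorant
  \<open>B * \<bar>f x\<bar>\<close>. The limit does not depend on the subsequence, so the whole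
  sequence converges.\<close>

lemma limit_observable:
  fixes T :: "nat \<Rightarrow> real^3 \<Rightarrow> real^3" and \<phi> f :: "real^3 \<Rightarrow> real"
  assumes lim: "subseq_AE_lim lebesgue T T'" and m: "\<And>k. T k \<in> borel_measurable lebesgue" "T' \<in> borel_measurable lebesgue"
    and \<phi>: "continuous_on UNIV \<phi>" "\<And>x. \<bar>\<phi> x\<bar> \<le> B" and f: "integrable lebesgue f"
  shows "(\<lambda>k. LINT x|lebesgue. \<phi> (T k x) * f x) \<longlonglongrightarrow> (LINT x|lebesgue. \<phi> (T' x) * f x)"
proof (rule LIMSEQ_subsubseq)
  fix \<sigma> :: "nat \<Rightarrow> nat" assume "strict_mono \<sigma>"
  then obtain \<tau> :: "nat \<Rightarrow> nat" where \<tau>: "strict_mono \<tau>" "AE x in lebesgue. (\<lambda>n. T (\<sigma> (\<tau> n)) x) \<longlonglongrightarrow> T' x"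
    using subseq_AE_limD[OF lim] by blast
  have \<phi>m: "\<phi> \<in> borel_measurable borel" using \<phi>(1) by (rule borel_measurable_continuous_onI)
  have fm: "f \<in> borel_measurable lebesgue" using f by (rule borel_measurable_integrable)
  have "(\<lambda>n. LINT x|lebesgue. \<phi> (T (\<sigma> (\<tau> n)) x) * f x) \<longlonglongrightarrow> (LINT x|lebesgue. \<phi> (T' x) * f x)"
  proof (rule integral_dominated_convergence[where w="\<lambda>x. B * \<bar>f x\<bar>"])
    show "(\<lambda>x. \<phi> (T' x) * f x) \<in> borel_measurable lebesgue"
      using measurable_compose[OF m(2) \<phi>m] fm by (rule borel_measurable_times)
    show "(\<lambda>x. \<phi> (T (\<sigma> (\<tau> n)) x) * f x) \<in> borel_measurable lebesgue" for n
      using measurable_compose[OF m(1) \<phi>m] fm by (rule borel_measurable_times)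
    show "integrable lebesgue (\<lambda>x. B * \<bar>f x\<bar>)" using f by simp
    show "AE x in lebesgue. norm (\<phi> (T (\<sigma> (\<tau> n)) x) * f x) \<le> B * \<bar>f x\<bar>" for n
      using \<phi>(2) by (intro AE_I2) (auto simp: abs_mult intro: mult_right_mono)
    show "AE x in lebesgue. (\<lambda>n. \<phi> (T (\<sigma> (\<tau> n)) x) * f x) \<longlonglongrightarrow> \<phi> (T' x) * f x"
      using \<tau>(2)
    proof eventually_elim
      case (elim x)
      then show ?case using continuous_on_tendsto_compose[OF \<phi>(1) elim] by (intro tendsto_intros) auto
    qed
  qed
  then show "\<exists>\<tau> :: nat \<Rightarrow> nat. strict_mono \<tau> \<and> (\<lambda>n. LINT x|lebesgue. \<phi> (T (\<sigma> (\<tau> n)) x) * f x) \<longlonglongrightarrow> (LINT x|lebesgue. \<phi> (T' x) * f x)"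
    using \<tau>(1) by blast
qed

subsection \<open>Passage to the limit in the transport identity\<close>

lemma interval_integrable_subset:
  fixes f :: "real \<Rightarrow> real"
  assumes s: "s \<in> {T0..T1}" and t: "t \<in> {T0..T1}" and f: "set_integrable lborel {T0..T1} f"
  shows "interval_lebesgue_integrable lborel (ereal s) (ereal t) f"
  unfolding interval_lebesgue_integrable_def
  using s t by (auto intro!: set_integrable_subset[OF f] simp: einterval_iff)

lemma interval_integral_dominated:
  fixes f :: "nat \<Rightarrow> real \<Rightarrow> real"
  assumes s: "s \<in> {T0..T1}" and t: "t \<in> {T0..T1}"
    and m: "\<And>n. (\<lambda>r. indicator {T0..T1} r * f n r) \<in> borel_measurable borel"
    and w: "set_integrable lborel {T0..T1} w" and bd: "\<And>n r. r \<in> {T0..T1} \<Longrightarrow> \<bar>f n r\<bar> \<le> w r"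
    and lim: "\<And>r. r \<in> {T0..T1} \<Longrightarrow> (\<lambda>n. f n r) \<longlonglongrightarrow> f' r"
  shows "(\<lambda>r. indicator {T0..T1} r * f' r) \<in> borel_measurable borel"
    and "(\<lambda>n. LBINT r=s..t. f n r) \<longlonglongrightarrow> (LBINT r=s..t. f' r)"
proof -
  show m': "(\<lambda>r. indicator {T0..T1} r * f' r) \<in> borel_measurable borel"
  proof (rule borel_measurable_LIMSEQ_real[OF _ m])
    show "(\<lambda>n. indicator {T0..T1} r * f n r) \<longlonglongrightarrow> indicator {T0..T1} r * f' r" for r
      using lim[of r] by (auto simp: indicator_def)
  qed
  have *: "(\<lambda>n. LINT r:A|lborel. f n r) \<longlonglongrightarrow> (LINT r:A|lborel. f' r)" if A: "A \<subseteq> {T0..T1}" "A \<in> sets borel" for A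
    unfolding set_lebesgue_integral_def
  proof (rule integral_dominated_convergence[where w="\<lambda>r. indicator {T0..T1} r *\<^sub>R w r"])
    have eq: "(\<lambda>r. indicator A r *\<^sub>R h r) = (\<lambda>r. indicator A r * (indicator {T0..T1} r * h r))" for h :: "real \<Rightarrow> real"
      using A by (auto simp: fun_eq_iff indicator_def)
    show "(\<lambda>r. indicator A r *\<^sub>R f' r) \<in> borel_measurable lborel" "(\<lambda>r. indicator A r *\<^sub>R f n r) \<in> borel_measurable lborel" for n
      unfolding eq using A(2) m m' by simp_all
    show "integrable lborel (\<lambda>r. indicat_real {T0..T1} r *\<^sub>R w r)" using w by (simp add: set_integrable_def)
    show "AE r in lborel. (\<lambda>n. indicat_real A r *\<^sub>R f n r) \<longlonglongrightarrow> indicat_real A r *\<^sub>R f' r"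
      using A lim by (intro AE_I2) (auto simp: indicator_def)
    show "AE r in lborel. norm (indicat_real A r *\<^sub>R f n r) \<le> indicat_real {T0..T1} r *\<^sub>R w r" for n
    proof (rule AE_I2)
      fix r show "norm (indicat_real A r *\<^sub>R f n r) \<le> indicat_real {T0..T1} r *\<^sub>R w r"
        using A bd[of r n] by (auto simp: indicator_def intro: order_trans[OF abs_ge_zero])
    qed
  qed
  have "einterval (ereal s) (ereal t) \<subseteq> {T0..T1}" "einterval (ereal t) (ereal s) \<subseteq> {T0..T1}"
    using s t by (auto simp: einterval_iff)
  then show "(\<lambda>n. LBINT r=s..t. f n r) \<longlonglongrightarrow> (LBINT r=s..t. f' r)"
    unfolding interval_lebesgue_integral_def by (auto intro!: * tendsto_minus)
qed

text \<open>The time \<open>s\<close> is fixed; \<open>That r\<close> plays the role of the limit flow \<open>X(s, r, \<cdot>)\<close>.\<close>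

locale transport_limit =
  fixes T0 T1 s t :: real and c :: "real^3" and R :: real and That :: "real \<Rightarrow> real^3 \<Rightarrow> real^3"
    and H :: "real \<Rightarrow> real^3 \<Rightarrow> real" and g :: "real \<times> (real^3) \<Rightarrow> real"
  assumes sI: "s \<in> {T0..T1}" and tI: "t \<in> {T0..T1}"
    and That_meas: "r \<in> {T0..T1} \<Longrightarrow> That r \<in> borel_measurable lebesgue"
    and That_out: "r \<in> {T0..T1} \<Longrightarrow> x \<notin> ball c R \<Longrightarrow> That r x = x"
    and H_meas: "(\<lambda>z. H (fst z) (snd z)) \<in> borel_measurable borel"
    and H_sect: "integrable lborel (\<lambda>x. indicator (ball c R) x * H r x)"
    and H_int: "integrable lborel (\<lambda>z. indicator ({T0..T1} \<times> ball c R) z * H (fst z) (snd z))"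
    and g_cont: "continuous_on UNIV g"
begin

abbreviation "I \<equiv> {T0..T1}"
abbreviation "KB \<equiv> ball c R"

definition V :: "(real^3 \<Rightarrow> real) \<Rightarrow> real \<Rightarrow> real" where
  "V \<theta> r = (LINT x|lebesgue. \<theta> (That r x) * H r x)"

definition w :: "real \<Rightarrow> real" where
  "w r = (LINT x|lebesgue. \<bar>indicator KB x * H r x\<bar>)"

definition admissible :: "real \<Rightarrow> (real^3 \<Rightarrow> real) \<Rightarrow> bool" where
  "admissible B \<theta> \<longleftrightarrow> \<theta> \<in> borel_measurable borel \<and> (\<forall>x. \<bar>\<theta> x\<bar> \<le> B * indicator KB x)"

text \<open>Measurability in \<open>r\<close> is carried along with the identity:
  \<open>That r\<close> is assumed measurable for each fixed \<open>r\<close> only, so Fubini does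
  not provide it. It comes from the approximating flows and survives pointwise limits.\<close>

definition Q :: "(real^3 \<Rightarrow> real) \<Rightarrow> bool" where
  "Q \<theta> \<longleftrightarrow> (\<lambda>r. indicator I r * V \<theta> r) \<in> borel_measurable borel \<and>
    (LINT x|lebesgue. \<theta> (That t x) * g (t, x)) = (LINT x|lebesgue. \<theta> x * g (s, x)) + (LBINT r=s..t. V \<theta> r)"

lemma H_sect': "integrable lebesgue (\<lambda>x. indicator KB x * H r x)"
  using H_sect[of r] borel_measurable_integrable[OF H_sect[of r]] by (simp add: integrable_completion)

lemma g_sect: "integrable lebesgue (\<lambda>x. indicator KB x * g (r, x))"
proof -
  have cx: "continuous_on UNIV (\<lambda>x. g (r, x))"
    by (rule continuous_on_compose2[OF g_cont]) (auto intro: continuous_intros)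
  have "integrable lborel (\<lambda>x. indicator (cball c R) x *\<^sub>R g (r, x))"
    by (rule borel_integrable_compact) (auto intro: continuous_on_subset[OF cx])
  then have "integrable lborel (\<lambda>x. indicator KB x *\<^sub>R (indicator (cball c R) x *\<^sub>R g (r, x)))"
    by (rule integrable_mult_indicator[rotated]) simp
  moreover have "(\<lambda>x. indicator KB x *\<^sub>R (indicator (cball c R) x *\<^sub>R g (r, x))) = (\<lambda>x. indicator KB x * g (r, x))"
    by (auto simp: fun_eq_iff indicator_def)
  ultimately have i: "integrable lborel (\<lambda>x. indicator KB x * g (r, x))" by simp
  from borel_measurable_integrable[OF this] i show ?thesis by (simp add: integrable_completion)
qed

lemma w_integrable: "set_integrable lborel I w"
proof -
  have "integrable (lborel \<Otimes>\<^sub>M lborel) (\<lambda>z. norm (indicator (I \<times> KB) z * H (fst z) (snd z)))"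
    unfolding lborel_prod by (rule integrable_norm[OF H_int])
  from lborel_pair.integrable_fst'[OF this]
  have "integrable lborel (\<lambda>r. LINT x|lborel. norm (indicator (I \<times> KB) (r, x) * H r x))" by simp
  moreover have "(LINT x|lborel. norm (indicator (I \<times> KB) (r, x) * H r x)) = indicator I r *\<^sub>R w r" for r
  proof -
    have "w r = (LINT x|lborel. \<bar>indicator KB x * H r x\<bar>)"
      unfolding w_def using borel_measurable_integrable[OF H_sect[of r]] by (intro integral_completion) simp
    then show ?thesis by (cases "r \<in> I") (simp_all add: indicator_times)
  qed
  ultimately show ?thesis by (simp add: set_integrable_def)
qed

lemma admissible_nonneg: "admissible B \<theta> \<Longrightarrow> x \<in> KB \<Longrightarrow> 0 \<le> B"
  unfolding admissible_def by (metis abs_ge_zero indicator_simps(1) mult.right_neutral order_trans)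

text \<open>Outside the ball \<open>That r\<close> is the identity, so an observable vanishing there
  still vanishes there after composition. Hence a single dominating function serves all
  times.\<close>

lemma admissible_comp:
  assumes \<theta>: "admissible B \<theta>" and r: "r \<in> I"
  shows "\<bar>\<theta> (That r x) * f x\<bar> \<le> B * \<bar>indicator KB x * f x\<bar>"
proof (cases "x \<in> KB")
  case True
  have B: "B \<ge> 0" using admissible_nonneg[OF \<theta> True] .
  have "\<bar>\<theta> (That r x)\<bar> \<le> B * indicator KB (That r x)" using \<theta> by (simp add: admissible_def)
  also have "\<dots> \<le> B" using B by (auto simp: indicator_def)
  finally show ?thesis using True by (simp add: abs_mult mult_right_mono)
next
  case False
  have "\<bar>\<theta> (That r x)\<bar> \<le> B * indicator KB x"
    using \<theta> That_out[OF r False] unfolding admissible_def by metis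
  then have "\<theta> (That r x) = 0" using False by simp
  then show ?thesis using False by simp
qed

lemma admissible_measurable:
  "admissible B \<theta> \<Longrightarrow> r \<in> I \<Longrightarrow> (\<lambda>x. \<theta> (That r x)) \<in> borel_measurable lebesgue"
  using measurable_compose[OF That_meas] by (auto simp: admissible_def)

lemma admissible_eq:
  assumes \<theta>: "admissible B \<theta>" and r: "r \<in> I"
  shows "\<theta> (That r x) * f x = \<theta> (That r x) * (indicator KB x * f x)"
  using admissible_comp[OF assms, of x f] by (cases "x \<in> KB") auto

lemma admissible_integrable:
  assumes \<theta>: "admissible B \<theta>" and r: "r \<in> I" and f: "integrable lebesgue (\<lambda>x. indicator KB x * f x)"
  shows "integrable lebesgue (\<lambda>x. \<theta> (That r x) * f x)"
proof (rule Bochner_Integration.integrable_bound)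
  show "integrable lebesgue (\<lambda>x. B * \<bar>indicator KB x * f x\<bar>)" using f by simp
  show "(\<lambda>x. \<theta> (That r x) * f x) \<in> borel_measurable lebesgue"
    unfolding admissible_eq[OF \<theta> r, of _ f]
    using admissible_measurable[OF \<theta> r] borel_measurable_integrable[OF f] by (rule borel_measurable_times)
  show "AE x in lebesgue. norm (\<theta> (That r x) * f x) \<le> norm (B * \<bar>indicator KB x * f x\<bar>)"
    using admissible_comp[OF \<theta> r, of _ f] by (intro AE_I2) (auto intro: order_trans abs_ge_self)
qed

lemma V_bound:
  assumes \<theta>: "admissible B \<theta>" and r: "r \<in> I"
  shows "\<bar>V \<theta> r\<bar> \<le> B * w r"
proof -
  have "norm (V \<theta> r) \<le> (LINT x|lebesgue. B * \<bar>indicator KB x * H r x\<bar>)"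
    unfolding V_def
    using admissible_integrable[OF \<theta> r H_sect'] H_sect' admissible_comp[OF \<theta> r, of _ "H r"]
    by (intro LINT_norm_bound_integral) auto
  then show ?thesis by (simp add: w_def)
qed

lemma observable_lim:
  assumes \<theta>: "\<And>n. admissible B (\<theta> n)" and r: "r \<in> I" and lim: "\<And>x. (\<lambda>n. \<theta> n x) \<longlonglongrightarrow> \<theta>' x"
    and f: "integrable lebesgue (\<lambda>x. indicator KB x * f x)"
  shows "(\<lambda>n. LINT x|lebesgue. \<theta> n (That r x) * f x) \<longlonglongrightarrow> (LINT x|lebesgue. \<theta>' (That r x) * f x)"
proof (rule integral_dominated_convergence[where w="\<lambda>x. B * \<bar>indicator KB x * f x\<bar>"])
  show m: "(\<lambda>x. \<theta> n (That r x) * f x) \<in> borel_measurable lebesgue" for n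
    using admissible_integrable[OF \<theta> r f] by (rule borel_measurable_integrable)
  show "(\<lambda>x. \<theta>' (That r x) * f x) \<in> borel_measurable lebesgue"
    by (rule borel_measurable_LIMSEQ_real[OF _ m]) (rule tendsto_mult[OF lim tendsto_const])
  show "integrable lebesgue (\<lambda>x. B * \<bar>indicator KB x * f x\<bar>)" using f by simp
  show "AE x in lebesgue. (\<lambda>n. \<theta> n (That r x) * f x) \<longlonglongrightarrow> \<theta>' (That r x) * f x"
    by (intro AE_I2 tendsto_intros lim)
  show "AE x in lebesgue. norm (\<theta> n (That r x) * f x) \<le> B * \<bar>indicator KB x * f x\<bar>" for n
    using admissible_comp[OF \<theta> r, where f=f] by (intro AE_I2) auto
qed

lemma Q_lim:
  assumes \<theta>: "\<And>n. admissible B (\<theta> n)" and lim: "\<And>x. (\<lambda>n. \<theta> n x) \<longlonglongrightarrow> \<theta>' x"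
    and Q: "\<And>n. Q (\<theta> n)"
  shows "Q \<theta>'"
proof -
  have wi: "set_integrable lborel I (\<lambda>r. B * w r)" using w_integrable by simp
  have Vl: "(\<lambda>n. V (\<theta> n) r) \<longlonglongrightarrow> V \<theta>' r" if "r \<in> I" for r
    unfolding V_def by (rule observable_lim[OF \<theta> that lim H_sect'])
  have mV: "(\<lambda>r. indicator I r * V (\<theta> n) r) \<in> borel_measurable borel" for n using Q by (simp add: Q_def)
  note dom = interval_integral_dominated[OF sI tI mV wi V_bound[OF \<theta>] Vl]
  have "(\<lambda>n. LINT x|lebesgue. \<theta> n x * g (s, x)) \<longlonglongrightarrow> (LINT x|lebesgue. \<theta>' x * g (s, x))"
  proof -
    \<comment> \<open>The identity flow is itself an instance of the locale, so the term at time
      \<open>s\<close> converges by the same lemma.\<close>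
    interpret id: transport_limit T0 T1 s t c R "\<lambda>r x. x" H g
      by unfold_locales (use sI tI H_meas H_sect H_int g_cont in \<open>auto intro: measurable_completion\<close>)
    have "id.admissible = admissible" by (simp add: fun_eq_iff id.admissible_def admissible_def)
    then show ?thesis using id.observable_lim[of B \<theta> s \<theta>' "\<lambda>x. g (s, x)"] \<theta> sI lim g_sect by simp
  qed
  from tendsto_add[OF this dom(2)]
  have "(\<lambda>n. LINT x|lebesgue. \<theta> n (That t x) * g (t, x)) \<longlonglongrightarrow> (LINT x|lebesgue. \<theta>' x * g (s, x)) + (LBINT r=s..t. V \<theta>' r)"
    using Q by (simp add: Q_def)
  moreover have "(\<lambda>n. LINT x|lebesgue. \<theta> n (That t x) * g (t, x)) \<longlonglongrightarrow> (LINT x|lebesgue. \<theta>' (That t x) * g (t, x))"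
    by (rule observable_lim[OF \<theta> tI lim g_sect])
  ultimately show ?thesis unfolding Q_def using dom(1) LIMSEQ_unique by blast
qed

lemma V_interval_integrable:
  assumes \<theta>: "admissible B \<theta>" and m: "(\<lambda>r. indicator I r * V \<theta> r) \<in> borel_measurable borel"
  shows "set_integrable lborel I (V \<theta>)"
  unfolding set_integrable_def
proof (rule Bochner_Integration.integrable_bound)
  have "set_integrable lborel I (\<lambda>r. B * w r)" using w_integrable by simp
  then show "integrable lborel (\<lambda>r. indicator I r *\<^sub>R (B * w r))" by (simp add: set_integrable_def)
  show "AE r in lborel. norm (indicat_real I r *\<^sub>R V \<theta> r) \<le> norm (indicat_real I r *\<^sub>R (B * w r))"
    using V_bound[OF \<theta>] by (intro AE_I2) (auto simp: indicator_def intro: order_trans abs_ge_self)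
qed (use m in simp)

text \<open>Used with \<open>a = -1\<close> for complements and \<open>a = 1\<close> for disjoint
  unions.\<close>

lemma Q_add_scaled:
  assumes \<theta>1: "admissible B1 \<theta>1" "Q \<theta>1" and \<theta>2: "admissible B2 \<theta>2" "Q \<theta>2"
  shows "Q (\<lambda>x. \<theta>1 x + a * \<theta>2 x)"
proof -
  have m: "(\<lambda>r. indicator I r * V \<theta>1 r) \<in> borel_measurable borel" "(\<lambda>r. indicator I r * V \<theta>2 r) \<in> borel_measurable borel"
    using \<theta>1 \<theta>2 by (auto simp: Q_def)
  have Veq: "V (\<lambda>x. \<theta>1 x + a * \<theta>2 x) r = V \<theta>1 r + a * V \<theta>2 r" if "r \<in> I" for r
    unfolding V_def using admissible_integrable[OF \<theta>1(1) that H_sect'] admissible_integrable[OF \<theta>2(1) that H_sect']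
    by (simp add: distrib_right mult.assoc)
  have "(\<lambda>r. indicator I r * V (\<lambda>x. \<theta>1 x + a * \<theta>2 x) r) = (\<lambda>r. indicator I r * V \<theta>1 r + a * (indicator I r * V \<theta>2 r))"
    using Veq by (auto simp: fun_eq_iff indicator_def)
  then have m3: "(\<lambda>r. indicator I r * V (\<lambda>x. \<theta>1 x + a * \<theta>2 x) r) \<in> borel_measurable borel" using m by simp
  have i: "interval_lebesgue_integrable lborel s t (V \<theta>1)" "interval_lebesgue_integrable lborel s t (V \<theta>2)"
    using interval_integrable_subset[OF sI tI] V_interval_integrable[OF \<theta>1(1) m(1)] V_interval_integrable[OF \<theta>2(1) m(2)] by auto
  have "(LBINT r=s..t. V (\<lambda>x. \<theta>1 x + a * \<theta>2 x) r) = (LBINT r=s..t. V \<theta>1 r + a * V \<theta>2 r)"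
    using sI tI by (intro interval_integral_cong) (auto simp: einterval_iff Veq min_def max_def split: if_splits)
  also have "\<dots> = (LBINT r=s..t. V \<theta>1 r) + a * (LBINT r=s..t. V \<theta>2 r)"
    using i by simp
  finally have L: "(LBINT r=s..t. V (\<lambda>x. \<theta>1 x + a * \<theta>2 x) r) = (LBINT r=s..t. V \<theta>1 r) + a * (LBINT r=s..t. V \<theta>2 r)" .
  have G1: "(LINT x|lebesgue. (\<theta>1 (That t x) + a * \<theta>2 (That t x)) * g (t, x)) = (LINT x|lebesgue. \<theta>1 (That t x) * g (t, x)) + a * (LINT x|lebesgue. \<theta>2 (That t x) * g (t, x))"
    using admissible_integrable[OF \<theta>1(1) tI g_sect] admissible_integrable[OF \<theta>2(1) tI g_sect]
    by (simp add: distrib_right mult.assoc)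
  have G2: "(LINT x|lebesgue. (\<theta>1 x + a * \<theta>2 x) * g (s, x)) = (LINT x|lebesgue. \<theta>1 x * g (s, x)) + a * (LINT x|lebesgue. \<theta>2 x * g (s, x))"
  proof -
    interpret id: transport_limit T0 T1 s t c R "\<lambda>r x. x" H g
      by unfold_locales (use sI tI H_meas H_sect H_int g_cont in \<open>auto intro: measurable_completion\<close>)
    have "id.admissible = admissible" by (simp add: fun_eq_iff id.admissible_def admissible_def)
    then show ?thesis using id.admissible_integrable[of B1 \<theta>1 s "\<lambda>x. g (s, x)"] id.admissible_integrable[of B2 \<theta>2 s "\<lambda>x. g (s, x)"] \<theta>1(1) \<theta>2(1) sI g_sect
      by (simp add: distrib_right mult.assoc)
  qed
  show ?thesis using m3 L G1 G2 \<theta>1(2) \<theta>2(2) unfolding Q_def by (simp add: distrib_left)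
qed

lemma admissible_indicator: "B \<in> sets borel \<Longrightarrow> admissible 1 (indicator (B \<inter> KB))"
  unfolding admissible_def by (intro conjI borel_measurable_indicator allI) (auto simp: indicator_def)

text \<open>Open sets form an intersection-stable generator and are reached by Lipschitz functions;
  linearity and bounded limits give the Dynkin steps. Intersecting with the ball keeps every
  indicator admissible, and complements become differences inside the ball.\<close>

lemma Q_borel:
  assumes lip: "\<And>\<phi> \<Lambda>. (\<And>x y. \<bar>\<phi> x - \<phi> y\<bar> \<le> \<Lambda> * norm (x - y)) \<Longrightarrow> (\<And>x. x \<notin> KB \<Longrightarrow> \<phi> x = 0) \<Longrightarrow> Q \<phi>"
    and B: "B \<in> sets borel"
  shows "Q (indicator (B \<inter> KB))"
proof -
  have open_case: "Q (indicator (U \<inter> KB))" if U: "open U" for U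
  proof (rule Q_lim)
    define W where "W = U \<inter> KB"
    have W: "open W" "W \<noteq> UNIV" "W \<subseteq> KB"
      using U bounded_subset[OF bounded_ball, of W c R] not_bounded_UNIV by (auto simp: W_def)
    show "(\<lambda>n. lip_approx W n x) \<longlonglongrightarrow> indicator (U \<inter> KB) x" for x
      using lip_approx_tendsto[OF W(1,2)] by (simp add: W_def)
    show "admissible 1 (lip_approx W n)" for n
      unfolding admissible_def
    proof (intro conjI allI)
      show "lip_approx W n \<in> borel_measurable borel" by (rule borel_measurable_continuous_onI[OF continuous_lip_approx])
      fix x
      have "indicator W x \<le> (indicator KB x :: real)" using W(3) by (auto simp: indicator_def)
      then show "\<bar>lip_approx W n x\<bar> \<le> 1 * indicator KB x"
        using lip_approx_range(1)[of W n x] lip_approx_le_indicator[of W n x] by linarith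
    qed
    show "Q (lip_approx W n)" for n
      by (rule lip[where \<Lambda>="real n"]) (use lip_approx_lipschitz[of W n] W(3) in \<open>auto simp: dist_norm intro!: lip_approx_outside\<close>)
  qed
  have Bs: "B \<in> sigma_sets UNIV {U. open U}" using B by (simp add: borel_def)
  have stable: "Int_stable {U :: (real^3) set. open U}" by (auto intro: Int_stableI)
  have pow: "{U :: (real^3) set. open U} \<subseteq> Pow UNIV" by simp
  from stable pow Bs show ?thesis
  proof (induction rule: sigma_sets_induct_disjoint)
    case (basic A)
    then show ?case using open_case by simp
  next
    case empty
    show ?case by (rule open_case) simp
  next
    case (compl A)
    have A: "A \<in> sets borel" using compl by (simp add: borel_def)
    have "Q (\<lambda>x. indicator (UNIV \<inter> KB) x + (-1) * indicator (A \<inter> KB) x)"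
      by (rule Q_add_scaled[OF admissible_indicator open_case admissible_indicator[OF A] compl.IH]) auto
    moreover have "(\<lambda>x. indicator (UNIV \<inter> KB) x + (-1) * indicator (A \<inter> KB) x) = (indicator ((UNIV - A) \<inter> KB) :: _ \<Rightarrow> real)"
      by (auto simp: fun_eq_iff indicator_def)
    ultimately show ?case by simp
  next
    case (union A)
    have A: "A i \<in> sets borel" for i using union.hyps by (auto simp: borel_def)
    have dj: "disjoint_family A" using union.hyps by simp
    have Qn: "Q (indicator ((\<Union>i<n. A i) \<inter> KB))" for n :: nat
    proof (induction n)
      case 0
      have "Q (indicator ({} \<inter> KB))" by (rule open_case) simp
      then show ?case by (simp only: lessThan_0 UN_empty)
    next
      case (Suc n)
      have U: "(\<Union>i<n. A i) \<in> sets borel" using A by auto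
      have "Q (\<lambda>x. indicator ((\<Union>i<n. A i) \<inter> KB) x + 1 * indicator (A n \<inter> KB) x)"
        by (rule Q_add_scaled[OF admissible_indicator[OF U] Suc admissible_indicator[OF A] union.IH])
      moreover have "(\<lambda>x. indicator ((\<Union>i<n. A i) \<inter> KB) x + 1 * indicator (A n \<inter> KB) x) = (indicator ((\<Union>i<Suc n. A i) \<inter> KB) :: _ \<Rightarrow> real)"
      proof
        fix x
        have "A i \<inter> A n = {}" if "i < n" for i
          using dj that by (auto simp: disjoint_family_on_def)
        then have dis: "x \<in> A n \<Longrightarrow> x \<notin> (\<Union>i<n. A i)" by blast
        have eq: "(\<Union>i<Suc n. A i) = (\<Union>i<n. A i) \<union> A n" by (auto simp: lessThan_Suc)
        show "indicator ((\<Union>i<n. A i) \<inter> KB) x + 1 * indicator (A n \<inter> KB) x = (indicator ((\<Union>i<Suc n. A i) \<inter> KB) x :: real)"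
          unfolding eq using dis by (auto simp: indicator_def simp del: UN_iff)
      qed
      ultimately show ?case by simp
    qed
    show ?case
    proof (rule Q_lim[OF _ _ Qn])
      show "admissible 1 (indicator ((\<Union>i<n. A i) \<inter> KB))" for n
        by (rule admissible_indicator) (use A in auto)
      fix x
      show "(\<lambda>n. indicator ((\<Union>i<n. A i) \<inter> KB) x :: real) \<longlonglongrightarrow> indicator (\<Union> (range A) \<inter> KB) x"
      proof (cases "x \<in> \<Union> (range A) \<inter> KB")
        case True
        then obtain i where i: "x \<in> A i" "x \<in> KB" by auto
        have "\<forall>\<^sub>F n in sequentially. (indicator ((\<Union>i<n. A i) \<inter> KB) x :: real) = indicator (\<Union> (range A) \<inter> KB) x"
          using eventually_gt_at_top[of i] by eventually_elim (use i in \<open>auto simp: indicator_def\<close>)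
        then show ?thesis by (rule tendsto_eventually)
      next
        case False
        then have "indicator ((\<Union>i<n. A i) \<inter> KB) x = (0 :: real)" for n by (auto simp: indicator_def)
        then show ?thesis using False by simp
      qed
    qed
  qed
qed

text \<open>The two limits are decoupled by \<open>G k\<close>, which has the approximating flow but
  the limit density \<open>H\<close>. Replacing \<open>Hk\<close> by \<open>H\<close> costs at most
  the bound of \<open>\<phi>\<close> times an L1 distance in space-time; afterwards only the flow
  varies against a fixed integrable function.\<close>

lemma Q_lipschitz_limit:
  fixes T :: "nat \<Rightarrow> real \<Rightarrow> real^3 \<Rightarrow> real^3"
  assumes \<phi>_lip: "\<And>x y. \<bar>\<phi> x - \<phi> y\<bar> \<le> \<Lambda> * norm (x - y)" and \<phi>_supp: "\<And>x. x \<notin> KB \<Longrightarrow> \<phi> x = 0"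
    and T_cont: "\<And>k r. r \<in> I \<Longrightarrow> continuous_on UNIV (T k r)"
    and T_lim: "\<And>r. r \<in> I \<Longrightarrow> subseq_AE_lim lebesgue (\<lambda>k. T k r) (That r)"
    and T_out: "\<And>k r x. r \<in> I \<Longrightarrow> x \<notin> KB \<Longrightarrow> T k r x = x"
    and uT: "\<And>k. continuous_on (I \<times> UNIV) (\<lambda>(r, x). \<phi> (T k r x))"
    and Hk_cont: "\<And>k. continuous_on (I \<times> UNIV) (\<lambda>(r, x). Hk k r x)"
    and Fk_cont: "\<And>k. continuous_on I (\<lambda>r. LINT x|lborel. \<phi> (T k r x) * Hk k r x)"
    and ident: "\<And>k. (LINT x|lborel. \<phi> (T k t x) * g (t, x)) = (LINT x|lborel. \<phi> x * g (s, x)) +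
         (LBINT r=s..t. (LINT x|lborel. \<phi> (T k r x) * Hk k r x))"
    and Hk_L1: "(\<lambda>k. \<integral>\<^sup>+z. ennreal \<bar>Hk k (fst z) (snd z) - H (fst z) (snd z)\<bar> * indicator (I \<times> KB) z \<partial>lborel) \<longlonglongrightarrow> 0"
  shows "Q \<phi>"
proof -
  have c\<phi>: "continuous_on UNIV \<phi>"
    by (rule lipschitz_on_continuous_on[where L="\<bar>\<Lambda>\<bar>"])
       (auto simp: lipschitz_on_def dist_norm intro!: order_trans[OF \<phi>_lip] mult_right_mono)
  obtain B where B: "B \<ge> 0" "\<And>x. norm (\<phi> x) \<le> B"
  proof (rule bounded_compact_support[OF c\<phi>, of "norm c + \<bar>R\<bar>"])
    fix z :: "real^3" assume "norm c + \<bar>R\<bar> \<le> norm z"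
    then have "z \<notin> ball c R" using norm_triangle_ineq2[of z c] by (auto simp: dist_norm norm_minus_commute)
    then show "\<phi> z = 0" by (rule \<phi>_supp)
  qed auto
  have \<phi>m[measurable]: "\<phi> \<in> borel_measurable borel" using c\<phi> by (rule borel_measurable_continuous_onI)
  have ad: "admissible B \<phi>"
    unfolding admissible_def using B \<phi>_supp by (auto simp: indicator_def)
  have Tm: "T k r \<in> borel_measurable borel" if "r \<in> I" for k r
    using T_cont[OF that] by (rule borel_measurable_continuous_onI)
  have Tml: "T k r \<in> borel_measurable lebesgue" if "r \<in> I" for k r
    using Tm[OF that] by (simp add: measurable_completion)
  have \<phi>T0: "\<phi> (T k r x) = 0" if "r \<in> I" "x \<notin> KB" for k r x
    using T_out[OF that] \<phi>_supp[OF that(2)] by simp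
  have \<phi>T: "\<phi> (T k r x) * y = \<phi> (T k r x) * (indicator KB x * y)" if "r \<in> I" for k r x y
    using \<phi>T0[OF that, of x k] by (cases "x \<in> KB") (auto simp del: mem_ball)
  have HM: "H r \<in> borel_measurable borel" for r
    using measurable_compose[OF _ H_meas, of "\<lambda>x. (r, x)" borel] by simp
  define G where "G k r = (LINT x|lborel. \<phi> (T k r x) * H r x)" for k r
  define F where "F k r = (LINT x|lborel. \<phi> (T k r x) * Hk k r x)" for k r
  have Geq: "G k r = (LINT x|lebesgue. \<phi> (T k r x) * (indicator KB x * H r x))" if r: "r \<in> I" for k r
  proof -
    have "(\<lambda>x. \<phi> (T k r x) * H r x) \<in> borel_measurable lborel"
      using measurable_compose[OF Tm[OF r] \<phi>m] HM[of r] by simp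
    from integral_completion[OF this] show ?thesis unfolding G_def by (simp add: \<phi>T[OF r, of k _ "H r _"])
  qed
  have Gbound: "\<bar>G k r\<bar> \<le> B * w r" if r: "r \<in> I" for k r
  proof -
    have "norm (G k r) \<le> (LINT x|lebesgue. B * \<bar>indicator KB x * H r x\<bar>)"
      unfolding Geq[OF r]
    proof (rule LINT_norm_bound_integral)
      show "integrable lebesgue (\<lambda>x. \<phi> (T k r x) * (indicator KB x * H r x))"
        by (rule integrable_bounded_mult_right[OF H_sect' measurable_compose[OF Tml[OF r] \<phi>m]]) (use B(2) in simp)
      show "integrable lebesgue (\<lambda>x. B * \<bar>indicator KB x * H r x\<bar>)"
        by (intro integrable_mult_right integrable_abs H_sect')
    qed (use B in \<open>auto simp: abs_mult intro: mult_right_mono\<close>)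
    then show ?thesis by (simp add: w_def)
  qed
  have Glim: "(\<lambda>k. G k r) \<longlonglongrightarrow> V \<phi> r" if r: "r \<in> I" for r
  proof -
    have "(\<lambda>k. LINT x|lebesgue. \<phi> (T k r x) * (indicator KB x * H r x)) \<longlonglongrightarrow> (LINT x|lebesgue. \<phi> (That r x) * (indicator KB x * H r x))"
      by (rule limit_observable[OF T_lim[OF r] Tml[OF r] That_meas[OF r] c\<phi> _ H_sect']) (use B in simp)
    then show ?thesis unfolding Geq[OF r] V_def by (simp add: admissible_eq[OF ad r, of _ "H r"])
  qed
  have uTm: "(\<lambda>z. indicator (I \<times> UNIV) z *\<^sub>R (case z of (r, x) \<Rightarrow> \<phi> (T k r x))) \<in> borel_measurable borel" for k
    by (rule borel_measurable_continuous_on_indicator[OF borel_closed[OF closed_Times] uT]) auto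
  have Hkm: "(\<lambda>z. indicator (I \<times> UNIV) z *\<^sub>R (case z of (r, x) \<Rightarrow> Hk k r x)) \<in> borel_measurable borel" for k
    by (rule borel_measurable_continuous_on_indicator[OF borel_closed[OF closed_Times] Hk_cont]) auto
  \<comment> \<open>Here Fubini is available, because \<open>\<phi>\<close> along the approximating
    flow is jointly continuous. This is the origin of the measurability in \<open>Q\<close>.\<close>
  have Gm: "(\<lambda>r. indicator I r * G k r) \<in> borel_measurable borel" for k
  proof -
    have "(\<lambda>z. (indicator (I \<times> UNIV) z *\<^sub>R (case z of (r, x) \<Rightarrow> \<phi> (T k r x))) * H (fst z) (snd z)) \<in> borel_measurable (lborel \<Otimes>\<^sub>M lborel)"
      unfolding lborel_prod using uTm H_meas by simp
    then have "(\<lambda>r. LINT x|lborel. (indicator (I \<times> UNIV) (r, x) *\<^sub>R \<phi> (T k r x)) * H r x) \<in> borel_measurable lborel"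
      by (intro lborel.borel_measurable_lebesgue_integral) (simp add: case_prod_unfold)
    moreover have "(LINT x|lborel. (indicator (I \<times> UNIV) (r, x) *\<^sub>R \<phi> (T k r x)) * H r x) = indicator I r * G k r" for r
      by (cases "r \<in> I") (simp_all add: G_def)
    ultimately show ?thesis by simp
  qed
  have wi: "set_integrable lborel I (\<lambda>r. B * w r)" using w_integrable by simp
  note dom = interval_integral_dominated[OF sI tI Gm wi Gbound Glim]
  define \<delta> where "\<delta> k = (\<integral>\<^sup>+z. ennreal \<bar>Hk k (fst z) (snd z) - H (fst z) (snd z)\<bar> * indicator (I \<times> KB) z \<partial>lborel)" for k
  \<comment> \<open>Finiteness is needed because \<open>enn2real\<close> sends infinity to 0; it
    holds for large \<open>k\<close>, as \<open>\<delta>\<close> tends to 0.\<close>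
  have diff: "\<bar>(LBINT r=s..t. F k r) - (LBINT r=s..t. G k r)\<bar> \<le> B * enn2real (\<delta> k)" if fin: "\<delta> k < top" for k
  proof -
    have iF: "interval_lebesgue_integrable lborel s t (F k)"
      using borel_integrable_atLeastAtMost'[OF Fk_cont[of k]]
      by (intro interval_integrable_subset[OF sI tI]) (simp add: F_def[abs_def])
    have sG: "set_integrable lborel I (G k)"
      unfolding set_integrable_def
    proof (rule Bochner_Integration.integrable_bound)
      show "integrable lborel (\<lambda>r. indicator I r *\<^sub>R (B * w r))" using wi by (simp add: set_integrable_def)
      show "AE r in lborel. norm (indicat_real I r *\<^sub>R G k r) \<le> norm (indicat_real I r *\<^sub>R (B * w r))"
        using order_trans[OF Gbound abs_ge_self] by (intro AE_I2) (auto simp: indicator_def)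
    qed (use Gm in simp)
    have iG: "interval_lebesgue_integrable lborel s t (G k)"
      using interval_integrable_subset[OF sI tI sG] .
    have eq: "(LBINT r=s..t. F k r) - (LBINT r=s..t. G k r) = (LBINT r=s..t. F k r - G k r)"
      using iF iG by simp
    have dm: "(\<lambda>z. ennreal \<bar>Hk k (fst z) (snd z) - H (fst z) (snd z)\<bar> * indicator (I \<times> KB) z) \<in> borel_measurable (lborel \<Otimes>\<^sub>M lborel)"
    proof -
      have "(\<lambda>z. ennreal \<bar>indicator (I \<times> UNIV) z *\<^sub>R (case z of (r, x) \<Rightarrow> Hk k r x) - H (fst z) (snd z)\<bar> * indicator (I \<times> KB) z) \<in> borel_measurable borel"
        using Hkm[of k] H_meas by (intro borel_measurable_times_ennreal measurable_compose[OF _ measurable_ennreal] borel_measurable_abs borel_measurable_diff borel_measurable_indicator) (auto intro!: borel_Times)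
      moreover have "(\<lambda>z. ennreal \<bar>indicator (I \<times> UNIV) z *\<^sub>R (case z of (r, x) \<Rightarrow> Hk k r x) - H (fst z) (snd z)\<bar> * indicator (I \<times> KB) z)
         = (\<lambda>z. ennreal \<bar>Hk k (fst z) (snd z) - H (fst z) (snd z)\<bar> * indicator (I \<times> KB) z)"
        by (auto simp: fun_eq_iff indicator_def)
      ultimately show ?thesis unfolding lborel_prod by simp
    qed
    have "\<bar>LBINT r=s..t. F k r - G k r\<bar> \<le> B * enn2real (\<delta> k)"
    proof (rule interval_integral_nn_bound[OF sI tI])
      have "(\<integral>\<^sup>+r. ennreal \<bar>F k r - G k r\<bar> * indicator I r \<partial>lborel) \<le> (\<integral>\<^sup>+r. ennreal B * (\<integral>\<^sup>+x. ennreal \<bar>Hk k r x - H r x\<bar> * indicator (I \<times> KB) (r, x) \<partial>lborel) \<partial>lborel)"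
      proof (rule nn_integral_mono)
        fix r
        show "ennreal \<bar>F k r - G k r\<bar> * indicator I r \<le> ennreal B * (\<integral>\<^sup>+x. ennreal \<bar>Hk k r x - H r x\<bar> * indicator (I \<times> KB) (r, x) \<partial>lborel)"
        proof (cases "r \<in> I")
          case True
          have HkM: "Hk k r \<in> borel_measurable borel"
          proof -
            have "continuous_on UNIV (\<lambda>x::real^3. (r, x))" by (intro continuous_intros)
            from continuous_on_compose2[OF Hk_cont[of k] this] True
            have "continuous_on UNIV (Hk k r)" by (auto simp: image_subset_iff)
            then show ?thesis by (rule borel_measurable_continuous_onI)
          qed
          have i1: "integrable lborel (\<lambda>x. \<phi> (T k r x) * Hk k r x)"
          proof (rule integrable_continuous_compact_support[where c=c and R=R])
            have "continuous_on UNIV (\<lambda>x::real^3. (r, x))" by (intro continuous_intros)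
            from continuous_on_compose2[OF Hk_cont[of k] this] True
            have "continuous_on UNIV (Hk k r)" by (auto simp: image_subset_iff)
            then show "continuous_on UNIV (\<lambda>x. \<phi> (T k r x) * Hk k r x)"
              by (intro continuous_intros continuous_on_compose2[OF c\<phi> T_cont[OF True]]) auto
          qed (use \<phi>T0[OF True] in simp)
          have i2: "integrable lborel (\<lambda>x. \<phi> (T k r x) * H r x)"
          proof -
            have "integrable lborel (\<lambda>x. \<phi> (T k r x) * (indicator KB x * H r x))"
              by (rule integrable_bounded_mult_right[OF H_sect]) (use measurable_compose[OF Tm[OF True] \<phi>m] B(2) in auto)
            then show ?thesis by (simp add: \<phi>T[OF True, of k _ "H r _", symmetric])
          qed
          have "ennreal \<bar>F k r - G k r\<bar> = ennreal (norm (LINT x|lborel. \<phi> (T k r x) * (Hk k r x - H r x)))"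
            unfolding F_def G_def using i1 i2 by (simp add: right_diff_distrib)
          also have "\<dots> \<le> (\<integral>\<^sup>+x. ennreal (norm (\<phi> (T k r x) * (Hk k r x - H r x))) \<partial>lborel)"
            using i1 i2 by (intro integral_norm_bound_ennreal) (simp add: right_diff_distrib)
          also have "\<dots> \<le> (\<integral>\<^sup>+x. ennreal B * (ennreal \<bar>Hk k r x - H r x\<bar> * indicator (I \<times> KB) (r, x)) \<partial>lborel)"
          proof (rule nn_integral_mono)
            fix x
            show "ennreal (norm (\<phi> (T k r x) * (Hk k r x - H r x))) \<le> ennreal B * (ennreal \<bar>Hk k r x - H r x\<bar> * indicator (I \<times> KB) (r, x))"
            proof (cases "x \<in> KB")
              case xB: True
              have "ennreal (norm (\<phi> (T k r x) * (Hk k r x - H r x))) \<le> ennreal (B * \<bar>Hk k r x - H r x\<bar>)"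
                using B by (intro ennreal_leI) (auto simp: abs_mult intro: mult_right_mono)
              also have "\<dots> = ennreal B * ennreal \<bar>Hk k r x - H r x\<bar>" using B by (intro ennreal_mult) auto
              finally show ?thesis using True xB by simp
            next
              case False
              then show ?thesis using \<phi>T0[OF True False] by simp
            qed
          qed
          also have "\<dots> = ennreal B * (\<integral>\<^sup>+x. ennreal \<bar>Hk k r x - H r x\<bar> * indicator (I \<times> KB) (r, x) \<partial>lborel)"
            using HkM HM[of r] by (intro nn_integral_cmult) simp
          finally show ?thesis using True by simp
        qed simp
      qed
      also have "\<dots> = ennreal B * (\<integral>\<^sup>+r. (\<integral>\<^sup>+x. ennreal \<bar>Hk k r x - H r x\<bar> * indicator (I \<times> KB) (r, x) \<partial>lborel) \<partial>lborel)"
        using lborel.borel_measurable_nn_integral_fst[OF dm] by (intro nn_integral_cmult) simp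
      also have "(\<integral>\<^sup>+r. (\<integral>\<^sup>+x. ennreal \<bar>Hk k r x - H r x\<bar> * indicator (I \<times> KB) (r, x) \<partial>lborel) \<partial>lborel) = \<delta> k"
        using lborel.nn_integral_fst[OF dm] unfolding \<delta>_def lborel_prod by simp
      also have "ennreal B * \<delta> k = ennreal (B * enn2real (\<delta> k))"
        using fin B by (simp add: ennreal_mult less_top)
      finally show "(\<integral>\<^sup>+r. ennreal \<bar>F k r - G k r\<bar> * indicator I r \<partial>lborel) \<le> ennreal (B * enn2real (\<delta> k))" .
    qed (use B in simp)
    then show ?thesis using eq by simp
  qed
  have \<delta>0: "\<delta> \<longlonglongrightarrow> 0" using Hk_L1 by (simp add: \<delta>_def[abs_def])
  have ev: "\<forall>\<^sub>F k in sequentially. \<delta> k < top" using \<delta>0 by (rule order_tendstoD) simp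
  have e2r: "(\<lambda>k. enn2real (\<delta> k)) \<longlonglongrightarrow> 0"
    by (rule tendsto_enn2real) (use \<delta>0 in auto)
  have "(\<lambda>k. (LBINT r=s..t. F k r) - (LBINT r=s..t. G k r)) \<longlonglongrightarrow> 0"
  proof (rule Lim_null_comparison)
    show "\<forall>\<^sub>F k in sequentially. norm ((LBINT r=s..t. F k r) - (LBINT r=s..t. G k r)) \<le> B * enn2real (\<delta> k)"
      using ev by eventually_elim (use diff in simp)
    show "(\<lambda>k. B * enn2real (\<delta> k)) \<longlonglongrightarrow> 0" using tendsto_mult_left[OF e2r, of B] by simp
  qed
  from tendsto_add[OF this dom(2)] have Flim: "(\<lambda>k. LBINT r=s..t. F k r) \<longlonglongrightarrow> (LBINT r=s..t. V \<phi> r)" by simp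
  have gM: "(\<lambda>x. g (r, x)) \<in> borel_measurable borel" for r
    by (rule borel_measurable_continuous_onI, rule continuous_on_compose2[OF g_cont]) (auto intro: continuous_intros)
  have L: "(\<lambda>k. LINT x|lborel. \<phi> (T k t x) * g (t, x)) \<longlonglongrightarrow> (LINT x|lebesgue. \<phi> (That t x) * g (t, x))"
  proof -
    have "(\<lambda>k. LINT x|lebesgue. \<phi> (T k t x) * (indicator KB x * g (t, x))) \<longlonglongrightarrow> (LINT x|lebesgue. \<phi> (That t x) * (indicator KB x * g (t, x)))"
      by (rule limit_observable[OF T_lim[OF tI] Tml[OF tI] That_meas[OF tI] c\<phi> _ g_sect]) (use B in simp)
    moreover have "(LINT x|lebesgue. \<phi> (T k t x) * (indicator KB x * g (t, x))) = (LINT x|lborel. \<phi> (T k t x) * g (t, x))" for k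
    proof -
      have "(\<lambda>x. \<phi> (T k t x) * g (t, x)) \<in> borel_measurable lborel"
        using measurable_compose[OF Tm[OF tI] \<phi>m] gM[of t] by simp
      from integral_completion[OF this] show ?thesis by (simp add: \<phi>T[OF tI, of k _ "g (t, _)", symmetric])
    qed
    ultimately show ?thesis by (simp add: admissible_eq[OF ad tI, of _ "\<lambda>x. g (t, x)"])
  qed
  have "(\<lambda>k. (LINT x|lborel. \<phi> x * g (s, x)) + (LBINT r=s..t. F k r)) \<longlonglongrightarrow> (LINT x|lborel. \<phi> x * g (s, x)) + (LBINT r=s..t. V \<phi> r)"
    by (intro tendsto_intros Flim)
  then have "(\<lambda>k. LINT x|lborel. \<phi> (T k t x) * g (t, x)) \<longlonglongrightarrow> (LINT x|lborel. \<phi> x * g (s, x)) + (LBINT r=s..t. V \<phi> r)"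
    using ident by (simp add: F_def)
  from LIMSEQ_unique[OF L this]
  have "(LINT x|lebesgue. \<phi> (That t x) * g (t, x)) = (LINT x|lborel. \<phi> x * g (s, x)) + (LBINT r=s..t. V \<phi> r)" .
  moreover have "(LINT x|lebesgue. \<phi> x * g (s, x)) = (LINT x|lborel. \<phi> x * g (s, x))"
    using gM[of s] by (intro integral_completion) simp
  ultimately show ?thesis unfolding Q_def using dom(1) by simp
qed

end

subsection \<open>Almost everywhere equality in complete measure spaces\<close>

lemma (in complete_measure) borel_measurable_cong_AE:
  fixes f g :: "'a \<Rightarrow> 'b::topological_space"
  assumes f: "f \<in> borel_measurable M" and eq: "AE x in M. f x = g x"
  shows "g \<in> borel_measurable M"
proof (rule measurableI)
  fix A :: "'b set" assume A: "A \<in> sets borel"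
  show "g -` A \<inter> space M \<in> sets M"
  proof (rule in_sets_AE)
    show "AE x in M. x \<in> f -` A \<inter> space M \<longleftrightarrow> x \<in> g -` A \<inter> space M"
      using eq by eventually_elim auto
    show "f -` A \<inter> space M \<in> sets M" using f A by (rule measurable_sets)
  qed auto
qed simp

lemma (in complete_measure) borel_measurable_cong_AE_iff:
  fixes f g :: "'a \<Rightarrow> 'b::topological_space"
  assumes "AE x in M. f x = g x"
  shows "f \<in> borel_measurable M \<longleftrightarrow> g \<in> borel_measurable M"
proof -
  have "AE x in M. g x = f x" using assms by eventually_elim simp
  then show ?thesis using borel_measurable_cong_AE assms by blast
qed

lemma (in complete_measure) integrable_cong_AE':
  fixes f g :: "'a \<Rightarrow> 'b::{banach, second_countable_topology}"
  assumes "AE x in M. f x = g x"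
  shows "integrable M f \<longleftrightarrow> integrable M g"
proof (cases "f \<in> borel_measurable M")
  case True
  then show ?thesis using integrable_cong_AE[OF True _ assms] borel_measurable_cong_AE_iff[OF assms] by blast
next
  case False
  then show ?thesis using borel_measurable_cong_AE_iff[OF assms] borel_measurable_integrable by blast
qed

text \<open>By completeness either both functions are measurable or neither is, and in the latter
  case both integrals are 0 by convention. So functions known only almost everywhere can be
  exchanged freely.\<close>

lemma (in complete_measure) integral_cong_AE':
  fixes f g :: "'a \<Rightarrow> 'b::{banach, second_countable_topology}"
  assumes "AE x in M. f x = g x"
  shows "integral\<^sup>L M f = integral\<^sup>L M g"
proof (cases "f \<in> borel_measurable M")
  case True
  then show ?thesis using integral_cong_AE[OF True _ assms] borel_measurable_cong_AE_iff[OF assms] by blast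
next
  case False
  then have "\<not> integrable M f" "\<not> integrable M g"
    using borel_measurable_cong_AE_iff[OF assms] borel_measurable_integrable by blast+
  then show ?thesis by (simp add: not_integrable_integral_eq)
qed

text \<open>The product of the completed measures need not be complete, so the passage to sections
  goes through \<open>lborel\<close>.\<close>

lemma AE_lebesgue_pair:
  fixes P :: "'a::euclidean_space \<times> 'b::euclidean_space \<Rightarrow> bool"
  assumes "AE z in lebesgue. P z"
  shows "AE r in lborel. AE x in lborel. P (r, x)"
proof -
  have "AE z in lborel. P z" using assms by (simp only: AE_completion_iff)
  then have "AE z in lborel \<Otimes>\<^sub>M lborel. P z" by (simp only: lborel_prod)
  from lborel_pair.AE_pair[OF this] show ?thesis .
qed

text \<open>A representative is made to vanish at the null set of times at which its section
  fails to be integrable; this makes all its sections integrable.\<close>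

lemma borel_representative:
  fixes F :: "real \<times> 'b::euclidean_space \<Rightarrow> real"
  assumes Om: "open Om" and F: "\<And>a b. a < b \<Longrightarrow> set_integrable lebesgue ({a..b} \<times> Om) F"
  shows "\<exists>F'. F' \<in> borel_measurable borel \<and> (\<forall>z. snd z \<notin> Om \<longrightarrow> F' z = 0) \<and>
    (AE z in lebesgue. snd z \<in> Om \<longrightarrow> F z = F' z) \<and> (\<forall>r. integrable lborel (\<lambda>x. F' (r, x))) \<and>
    (\<forall>a b. integrable lborel (\<lambda>z. indicator ({a..b} \<times> UNIV) z * F' z))"
proof -
  define F1 where "F1 z = indicator (UNIV \<times> Om) z * F z" for z
  have "F1 \<in> borel_measurable lebesgue"
  proof (rule borel_measurable_LIMSEQ_real)
    fix n :: nat
    have "set_integrable lebesgue ({- real (Suc n)..real (Suc n)} \<times> Om) F" by (rule F) simp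
    then show "(\<lambda>z. indicator ({- real (Suc n)..real (Suc n)} \<times> Om) z *\<^sub>R F z) \<in> borel_measurable lebesgue"
      unfolding set_integrable_def by (rule borel_measurable_integrable)
  next
    fix z :: "real \<times> 'b"
    obtain N where N: "real N \<ge> \<bar>fst z\<bar>" using real_arch_simple by blast
    have "\<forall>\<^sub>F n in sequentially. indicator ({- real (Suc n)..real (Suc n)} \<times> Om) z *\<^sub>R F z = F1 z"
      using eventually_ge_at_top[of N]
    proof eventually_elim
      case (elim n)
      then have "fst z \<in> {- real (Suc n)..real (Suc n)}" using N by (auto simp: abs_le_iff)
      then show ?case by (cases z) (simp add: F1_def indicator_times)
    qed
    then show "(\<lambda>n. indicator ({- real (Suc n)..real (Suc n)} \<times> Om) z *\<^sub>R F z) \<longlonglongrightarrow> F1 z"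
      by (rule tendsto_eventually)
  qed
  then obtain F2 where F2: "F2 \<in> borel_measurable lborel" "AE z in lborel. F1 z = F2 z"
    using completion_ex_borel_measurable_real by blast
  have Ob: "UNIV \<times> Om \<in> sets (borel :: (real \<times> 'b) measure)" using Om by (intro borel_open open_Times) auto
  define F3 where "F3 z = indicator (UNIV \<times> Om) z * F2 z" for z
  have F3m[measurable]: "F3 \<in> borel_measurable borel"
    unfolding F3_def[abs_def] using F2(1) Ob by simp
  have F13: "AE z in lborel. F1 z = F3 z"
    using F2(2)
  proof eventually_elim
    case (elim z)
    then show ?case by (cases "z \<in> UNIV \<times> Om") (auto simp: F3_def F1_def)
  qed
  have F3int: "integrable lborel (\<lambda>z. indicator ({a..b} \<times> UNIV) z * F3 z)" for a b
  proof -
    \<comment> \<open>The hypothesis speaks of nondegenerate intervals; the window is enlarged to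
      one and cut back afterwards.\<close>
    define b' where "b' = max b (a + 1)"
    have "integrable lebesgue (\<lambda>z. indicator ({a..b'} \<times> Om) z *\<^sub>R F z)"
      using F[of a b'] by (simp add: set_integrable_def b'_def)
    moreover have "AE z in lebesgue. indicator ({a..b'} \<times> Om) z *\<^sub>R F z = indicator ({a..b'} \<times> UNIV) z * F3 z"
      using AE_completion[OF F13]
    proof eventually_elim
      case (elim z)
      have "indicator ({a..b'} \<times> Om) z *\<^sub>R F z = indicator ({a..b'} \<times> UNIV) z * F1 z"
        by (cases z) (simp add: F1_def indicator_times)
      then show ?case using elim by simp
    qed
    ultimately have "integrable lebesgue (\<lambda>z. indicator ({a..b'} \<times> UNIV) z * F3 z)"
      by (rule completion.integrable_cong_AE'[THEN iffD1, rotated])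
    moreover have "(\<lambda>z. indicator ({a..b'} \<times> UNIV) z * F3 z) \<in> borel_measurable lborel"
    proof -
      have "{a..b'} \<times> (UNIV :: 'b set) \<in> sets borel" by (intro borel_closed closed_Times) auto
      then show ?thesis using F3m by simp
    qed
    ultimately have i: "integrable lborel (\<lambda>z. indicator ({a..b'} \<times> UNIV) z * F3 z)"
      by (simp add: integrable_completion)
    have "integrable lborel (\<lambda>z. indicator ({a..b} \<times> UNIV) z *\<^sub>R (indicator ({a..b'} \<times> UNIV) z * F3 z))"
      by (rule integrable_mult_indicator[OF _ i]) (auto intro!: borel_closed closed_Times)
    moreover have "(\<lambda>z. indicator ({a..b} \<times> UNIV) z *\<^sub>R (indicator ({a..b'} \<times> UNIV) z * F3 z)) = (\<lambda>z. indicator ({a..b} \<times> UNIV) z * F3 z)"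
      by (auto simp: fun_eq_iff indicator_def b'_def)
    ultimately show ?thesis by simp
  qed
  define h where "h r = (\<integral>\<^sup>+x. ennreal \<bar>F3 (r, x)\<bar> \<partial>lborel)" for r
  have F3p: "(\<lambda>z. ennreal \<bar>F3 z\<bar>) \<in> borel_measurable (lborel \<Otimes>\<^sub>M lborel)" unfolding lborel_prod by simp
  have hm[measurable]: "h \<in> borel_measurable borel"
    using lborel.borel_measurable_nn_integral_fst[OF F3p] by (simp add: h_def[abs_def])
  \<comment> \<open>The times whose section is integrable: a Borel set, and of full measure by
    Fubini on each bounded window.\<close>
  define G where "G = {r. h r < top}"
  have Gm: "G \<in> sets borel" unfolding G_def by measurable
  have GAE: "AE r in lborel. r \<in> G"
  proof -
    have "AE r in lborel. r \<in> {- real n..real n} \<longrightarrow> r \<in> G" for n :: nat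
    proof -
      have "integrable (lborel \<Otimes>\<^sub>M lborel) (\<lambda>z. indicator ({- real n..real n} \<times> UNIV) z * F3 z)"
        unfolding lborel_prod by (rule F3int)
      from lborel_pair.AE_integrable_fst'[OF this]
      show ?thesis
      proof eventually_elim
        case (elim r)
        show ?case
        proof
          assume r: "r \<in> {- real n..real n}"
          then have "integrable lborel (\<lambda>x. F3 (r, x))" using elim by (simp add: indicator_times)
          then show "r \<in> G" by (auto simp: G_def h_def integrable_iff_bounded)
        qed
      qed
    qed
    then have "AE r in lborel. \<forall>n::nat. r \<in> {- real n..real n} \<longrightarrow> r \<in> G"
      unfolding AE_all_countable by blast
    then show ?thesis
    proof eventually_elim
      case (elim r)
      obtain n where "real n \<ge> \<bar>r\<bar>" using real_arch_simple by blast
      then show ?case using elim[rule_format, of n] by (auto simp: abs_le_iff)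
    qed
  qed
  have Gp: "G \<times> UNIV \<in> sets (borel :: (real \<times> 'b) measure)"
    using Gm by (intro borel_Times) auto
  define F' where "F' z = indicator (G \<times> UNIV) z * F3 z" for z
  have F'm: "F' \<in> borel_measurable borel" unfolding F'_def[abs_def] using Gp by simp
  have "AE z in lborel \<Otimes>\<^sub>M (lborel :: 'b measure). fst z \<in> G"
  proof (rule lborel_pair.AE_pair_measure)
    show "{z \<in> space (lborel \<Otimes>\<^sub>M (lborel :: 'b measure)). fst z \<in> G} \<in> sets (lborel \<Otimes>\<^sub>M lborel)"
      using Gm by measurable
    show "AE r in lborel. AE x in (lborel :: 'b measure). fst (r, x) \<in> G" using GAE by eventually_elim simp
  qed
  then have "AE z in lborel. fst (z :: real \<times> 'b) \<in> G" by (simp only: lborel_prod)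
  with F13 have "AE z in lborel. snd z \<in> Om \<longrightarrow> F z = F' z"
  proof eventually_elim
    case (elim z)
    then show ?case by (cases z) (auto simp: F'_def F1_def indicator_def)
  qed
  moreover have "integrable lborel (\<lambda>x. F' (r, x))" for r
  proof (cases "r \<in> G")
    case True
    then have "integrable lborel (\<lambda>x. F3 (r, x))"
      by (simp add: integrable_iff_bounded G_def h_def)
    then show ?thesis using True by (simp add: F'_def)
  qed (simp add: F'_def)
  moreover have "integrable lborel (\<lambda>z. indicator ({a..b} \<times> UNIV) z * F' z)" for a b
  proof -
    have "integrable lborel (\<lambda>z. indicator (G \<times> UNIV) z *\<^sub>R (indicator ({a..b} \<times> UNIV) z * F3 z))"
      by (rule integrable_mult_indicator[OF _ F3int]) (use Gp in simp)
    then show ?thesis by (simp add: F'_def mult_ac)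
  qed
  ultimately show ?thesis
    using F'm by (intro exI[of _ F']) (auto simp: AE_completion_iff F'_def F3_def)
qed

subsection \<open>A measurable majorant for the essential supremum of the sections\<close>

text \<open>\<open>max 0 E\<close> because the essential supremum over a null set is \<open>-\<infinity>\<close>.\<close>

lemma esssup_majorant:
  fixes D :: "real \<times> 'b::euclidean_space \<Rightarrow> real"
  assumes D[measurable]: "D \<in> borel_measurable borel"
  shows "\<exists>m. m \<in> borel_measurable borel \<and> (\<forall>r. AE x in lborel. ennreal \<bar>D (r, x)\<bar> \<le> m r) \<and>
    (\<forall>r (E::ereal). (AE x in lborel. ereal \<bar>D (r, x)\<bar> \<le> max 0 E) \<longrightarrow> m r \<le> e2ennreal E)"
proof -
  define S where "S a = {r. emeasure lborel {x. \<bar>D (r, x)\<bar> > a} \<noteq> 0}" for a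
  define A where "A = (\<rat> \<inter> {0..} :: real set)"
  have A: "countable A" "A \<noteq> {}" unfolding A_def using countable_rat by (auto simp: countable_Int1)
  \<comment> \<open>The essential supremum as a supremum of the levels exceeded on a set of positive
    measure. Restricting to rational levels makes it a countable supremum of Borel functions of
    \<open>r\<close>.\<close>
  define m where "m r = (SUP a\<in>A. ennreal a * indicator (S a) r)" for r
  have Dp: "D \<in> borel_measurable (borel \<Otimes>\<^sub>M borel)" by (simp add: borel_prod)
  have S: "S a \<in> sets borel" for a
  proof -
    have "{z. \<bar>D z\<bar> > a} \<in> sets (lborel \<Otimes>\<^sub>M lborel)" unfolding lborel_prod by simp
    from lborel.measurable_emeasure_Pair[OF this]
    have "(\<lambda>r. emeasure lborel (Pair r -` {z. \<bar>D z\<bar> > a})) \<in> borel_measurable borel" by simp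
    then show ?thesis unfolding S_def by (simp add: vimage_def)
  qed
  have [measurable]: "m \<in> borel_measurable borel"
    unfolding m_def using S by (intro borel_measurable_SUP A) simp
  have sect[measurable]: "(\<lambda>x. D (r, x)) \<in> borel_measurable borel" for r by measurable
  have m1: "AE x in lborel. ennreal \<bar>D (r, x)\<bar> \<le> m r" for r
  proof -
    have "AE x in lborel. \<forall>a\<in>A. r \<notin> S a \<longrightarrow> \<bar>D (r, x)\<bar> \<le> a"
    proof (subst AE_ball_countable[OF A(1)], intro ballI)
      fix a assume "a \<in> A"
      show "AE x in lborel. r \<notin> S a \<longrightarrow> \<bar>D (r, x)\<bar> \<le> a"
      proof (cases "r \<in> S a")
        case False
        then have "emeasure lborel {x. \<bar>D (r, x)\<bar> > a} = 0" by (simp add: S_def)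
        then have "AE x in lborel. \<bar>D (r, x)\<bar> \<le> a"
          by (intro AE_I[where N="{x. \<bar>D (r, x)\<bar> > a}"]) auto
        then show ?thesis by simp
      qed simp
    qed
    then show ?thesis
    proof eventually_elim
      case (elim x)
      show ?case
      proof (rule ccontr)
        assume "\<not> ennreal \<bar>D (r, x)\<bar> \<le> m r"
        then have lt: "m r < ennreal \<bar>D (r, x)\<bar>" by simp
        then obtain \<mu> where \<mu>: "m r = ennreal \<mu>" "\<mu> \<ge> 0" by (cases "m r") auto
        then have "\<mu> < \<bar>D (r, x)\<bar>" using lt by (simp add: ennreal_less_iff)
        then obtain a where a: "a \<in> \<rat>" "\<mu> < a" "a < \<bar>D (r, x)\<bar>" using Rats_dense_in_real by blast
        then have aA: "a \<in> A" using \<mu>(2) by (simp add: A_def)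
        have "r \<notin> S a"
        proof
          assume "r \<in> S a"
          then have "ennreal a \<le> m r" unfolding m_def by (intro SUP_upper2[OF aA]) simp
          then show False using \<mu> a(2) by (simp add: not_less[symmetric] ennreal_less_iff)
        qed
        then show False using elim aA a(3) by fastforce
      qed
    qed
  qed
  have m2: "m r \<le> e2ennreal E" if E: "AE x in lborel. ereal \<bar>D (r, x)\<bar> \<le> max 0 E" for r E
    unfolding m_def
  proof (rule SUP_least)
    fix a assume a: "a \<in> A"
    show "ennreal a * indicator (S a) r \<le> e2ennreal E"
    proof (cases "r \<in> S a")
      case True
      have "ereal a \<le> max 0 E"
      proof (rule ccontr)
        assume "\<not> ereal a \<le> max 0 E"
        then have lt: "max 0 E < ereal a" by (simp only: not_le)
        from E have "AE x in lborel. \<not> \<bar>D (r, x)\<bar> > a"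
        proof eventually_elim
          case (elim x)
          from le_less_trans[OF this lt] show ?case by simp
        qed
        then have "emeasure lborel {x. \<bar>D (r, x)\<bar> > a} = 0"
          by (subst (asm) AE_iff_measurable[OF _ refl]) auto
        then show False using True by (simp add: S_def)
      qed
      then have "e2ennreal (ereal a) \<le> e2ennreal (max 0 E)" by (rule e2ennreal_mono)
      moreover have "e2ennreal (max 0 E) = e2ennreal E"
        by (simp add: e2ennreal_def)
      ultimately show ?thesis using True a by (simp add: A_def)
    qed simp
  qed
  show ?thesis
    by (rule exI[of _ m], intro conjI allI impI m1) (simp, rule m2)
qed

subsection \<open>Mollified velocity fields\<close>

lemma sum_axis_nth: "(\<Sum>i\<in>UNIV. a i *\<^sub>R axis i (1::real)) $ (j::3) = a j"
proof -
  have "(\<Sum>i\<in>UNIV. a i *\<^sub>R axis i (1::real)) $ j = (\<Sum>i\<in>UNIV. if j = i then a i else 0)"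
    unfolding sum_component by (intro sum.cong) (auto simp: axis_def)
  then show ?thesis by simp
qed

lemma norm_sum_axis_le: "norm (\<Sum>i\<in>UNIV. a i *\<^sub>R axis (i::3) (1::real)) \<le> (\<Sum>i\<in>UNIV. \<bar>a i\<bar>)"
  by (rule order_trans[OF norm_sum]) simp

locale flow_setup =
  fixes Om :: "(real^3) set" and v :: "real \<Rightarrow> real^3 \<Rightarrow> real^3" and Dv :: "real \<Rightarrow> real^3 \<Rightarrow> real^3^3"
    and c :: "real^3" and R :: real and \<epsilon> :: "nat \<Rightarrow> real"
    and Xk :: "nat \<Rightarrow> real \<Rightarrow> real \<Rightarrow> real^3 \<Rightarrow> real^3" and X :: "real \<Rightarrow> real \<Rightarrow> real^3 \<Rightarrow> real^3"
  assumes Om_open: "open Om" and Om_bdd: "bounded Om"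
    and Om_meas: "emeasure lebesgue Om = emeasure lebesgue (closure Om)"
    and v_zero: "\<And>r x. x \<notin> Om \<Longrightarrow> v r x = 0"
    and v_L1: "\<And>T0 T1 i. T0 < T1 \<Longrightarrow> set_integrable lebesgue ({T0..T1} \<times> Om) (\<lambda>(r, x). v r x $ i)"
    and Dv_L1: "\<And>T0 T1 i j. T0 < T1 \<Longrightarrow> set_integrable lebesgue ({T0..T1} \<times> Om) (\<lambda>(r, x). Dv r x $ i $ j)"
    and v_W011_0: "\<And>i. AE r in lborel. W011_0 Om (\<lambda>x. v r x $ i) (\<lambda>j x. Dv r x $ i $ j)"
    and div_Linf: "\<And>T0 T1. T0 < T1 \<Longrightarrow>
        (\<integral>\<^sup>+ r. e2ennreal (esssup (restrict_space lebesgue Om) (\<lambda>x. ereal \<bar>wdiv Dv r x\<bar>))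
           * indicator {T0..T1} r \<partial>lborel) < \<infinity>"
    and K_sup: "closure Om \<subseteq> ball c R"
    and eps_pos: "\<And>k. \<epsilon> k > 0" and eps_dec: "decseq \<epsilon>" and eps_lim: "\<epsilon> \<longlonglongrightarrow> 0"
    and eps_small: "\<And>x. x \<in> closure Om \<Longrightarrow> cball x (\<epsilon> 0) \<subseteq> ball c R"
    and Xk_init: "\<And>k r \<xi>. Xk k r r \<xi> = \<xi>"
    and Xk_ode: "\<And>k r r' \<xi>. ((\<lambda>q. Xk k q r \<xi>) has_vector_derivative
         mollify (\<epsilon> k) (\<lambda>(q, y). v q y) (r', Xk k r' r \<xi>)) (at r')"
    and X_range: "\<And>r q x. x \<in> Om \<Longrightarrow> X r q x \<in> closure Om"
    and X_meas': "\<And>r q. set_borel_measurable lebesgue Om (X r q)"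
    and X_lim: "\<And>r q. (\<lambda>k. LINT x:Om|lebesgue. (norm (Xk k r q x - X r q x))\<^sup>2) \<longlonglongrightarrow> 0"
begin

definition is_rep :: "(real \<times> (real^3) \<Rightarrow> real) \<Rightarrow> (real \<times> (real^3) \<Rightarrow> real) \<Rightarrow> bool" where
  "is_rep F F' \<longleftrightarrow> F' \<in> borel_measurable borel \<and> (\<forall>z. snd z \<notin> Om \<longrightarrow> F' z = 0) \<and>
    (AE z in lebesgue. snd z \<in> Om \<longrightarrow> F z = F' z) \<and> (\<forall>r. integrable lborel (\<lambda>x. F' (r, x))) \<and>
    (\<forall>a b. integrable lborel (\<lambda>z. indicator ({a..b} \<times> UNIV) z * F' z))"

text \<open>A Borel representative chosen once: the components of \<open>v\<close> are only Lebesgue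
  measurable, while sections and product measures are handled over \<open>lborel\<close>.\<close>

definition V :: "3 \<Rightarrow> real \<times> (real^3) \<Rightarrow> real" where
  "V i = (SOME F'. is_rep (\<lambda>(r, x). v r x $ i) F')"

definition D :: "real \<times> (real^3) \<Rightarrow> real" where
  "D = (SOME F'. is_rep (\<lambda>(r, x). wdiv Dv r x) F')"

lemma is_rep_V: "is_rep (\<lambda>(r, x). v r x $ i) (V i)"
  unfolding V_def by (rule someI_ex[of "is_rep (\<lambda>(r, x). v r x $ i)"]) (rule borel_representative[OF Om_open v_L1, folded is_rep_def])

lemma is_rep_D: "is_rep (\<lambda>(r, x). wdiv Dv r x) D"
proof -
  have sint: "set_integrable lebesgue ({a..b} \<times> Om) (\<lambda>(r, x). wdiv Dv r x)" if "a < b" for a b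
  proof -
    have "integrable lebesgue (\<lambda>z. \<Sum>j\<in>UNIV. indicator ({a..b} \<times> Om) z *\<^sub>R (case z of (r, x) \<Rightarrow> Dv r x $ j $ j))"
      using Dv_L1[OF that] by (intro Bochner_Integration.integrable_sum) (simp add: set_integrable_def)
    then show ?thesis
      by (simp add: set_integrable_def wdiv_def case_prod_unfold sum_distrib_left)
  qed
  show ?thesis
    unfolding D_def by (rule someI_ex[of "is_rep (\<lambda>(r, x). wdiv Dv r x)"]) (rule borel_representative[OF Om_open sint, folded is_rep_def])
qed

lemma is_repD:
  assumes "is_rep F F'"
  shows "F' \<in> borel_measurable borel" "snd z \<notin> Om \<Longrightarrow> F' z = 0" "AE z in lebesgue. snd z \<in> Om \<longrightarrow> F z = F' z"
    "integrable lborel (\<lambda>x. F' (r, x))" "integrable lborel (\<lambda>z. indicator ({a..b} \<times> UNIV) z * F' z)"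
  using assms[unfolded is_rep_def, THEN conjunct1]
    assms[unfolded is_rep_def, THEN conjunct2, THEN conjunct1, rule_format, of z]
    assms[unfolded is_rep_def, THEN conjunct2, THEN conjunct2, THEN conjunct1]
    assms[unfolded is_rep_def, THEN conjunct2, THEN conjunct2, THEN conjunct2, THEN conjunct1, rule_format, of r]
    assms[unfolded is_rep_def, THEN conjunct2, THEN conjunct2, THEN conjunct2, THEN conjunct2, rule_format, of a b]
  by simp_all

lemma V_meas[measurable]: "V i \<in> borel_measurable borel" and V_zero: "snd z \<notin> Om \<Longrightarrow> V i z = 0"
  and V_AE: "AE z in lebesgue. snd z \<in> Om \<longrightarrow> v (fst z) (snd z) $ i = V i z"
  and V_sect: "integrable lborel (\<lambda>x. V i (r, x))"
  and V_int: "integrable lborel (\<lambda>z. indicator ({a..b} \<times> UNIV) z * V i z)"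
  using is_repD[OF is_rep_V[of i]] by (simp_all add: case_prod_unfold)

lemma D_meas[measurable]: "D \<in> borel_measurable borel" and D_zero: "snd z \<notin> Om \<Longrightarrow> D z = 0"
  and D_AE: "AE z in lebesgue. snd z \<in> Om \<longrightarrow> wdiv Dv (fst z) (snd z) = D z"
  and D_sect: "integrable lborel (\<lambda>x. D (r, x))"
  and D_int: "integrable lborel (\<lambda>z. indicator ({a..b} \<times> UNIV) z * D z)"
  using is_repD[OF is_rep_D] by (simp_all add: case_prod_unfold)

text \<open>Measurability in time of the essential supremum is not among the hypotheses. A Borel
  \<open>m\<close> lying below it for almost every time still inherits the finite integral, and it
  still dominates \<open>D\<close> on almost all of each section.\<close>

lemma majorant_ex:
  "\<exists>m. m \<in> borel_measurable borel \<and> (\<forall>r. AE x in lborel. ennreal \<bar>D (r, x)\<bar> \<le> m r) \<and>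
     (\<forall>a b. a < b \<longrightarrow> (\<integral>\<^sup>+ r. m r * indicator {a..b} r \<partial>lborel) < \<infinity>)"
proof -
  obtain m where m: "m \<in> borel_measurable borel" "\<And>r. AE x in lborel. ennreal \<bar>D (r, x)\<bar> \<le> m r"
    "\<And>r (E::ereal). (AE x in lborel. ereal \<bar>D (r, x)\<bar> \<le> max 0 E) \<Longrightarrow> m r \<le> e2ennreal E"
    using esssup_majorant[OF D_meas] by blast
  have "AE r in lborel. m r \<le> e2ennreal (esssup (restrict_space lebesgue Om) (\<lambda>x. ereal \<bar>wdiv Dv r x\<bar>))"
    using AE_lebesgue_pair[OF D_AE]
  proof eventually_elim
    case (elim r)
    let ?E = "esssup (restrict_space lebesgue Om) (\<lambda>x. ereal \<bar>wdiv Dv r x\<bar>)"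
    have "AE x in lebesgue. x \<in> Om \<longrightarrow> ereal \<bar>wdiv Dv r x\<bar> \<le> ?E"
      using esssup_AE[of "\<lambda>x. ereal \<bar>wdiv Dv r x\<bar>" "restrict_space lebesgue Om"] Om_open
      by (subst (asm) AE_restrict_space_iff) auto
    then have "AE x in lborel. x \<in> Om \<longrightarrow> ereal \<bar>wdiv Dv r x\<bar> \<le> ?E" by (simp only: AE_completion_iff)
    with elim have "AE x in lborel. ereal \<bar>D (r, x)\<bar> \<le> max 0 ?E"
    proof eventually_elim
      case (elim x)
      show ?case
      proof (cases "x \<in> Om")
        case True
        then show ?thesis using elim by (simp add: le_max_iff_disj)
      next
        case False
        then show ?thesis using D_zero[of "(r, x)"] by (simp add: zero_ereal_def[symmetric])
      qed
    qed
    then show ?case by (rule m(3))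
  qed
  then have "(\<integral>\<^sup>+ r. m r * indicator {a..b} r \<partial>lborel) \<le> (\<integral>\<^sup>+ r. e2ennreal (esssup (restrict_space lebesgue Om) (\<lambda>x. ereal \<bar>wdiv Dv r x\<bar>))
           * indicator {a..b} r \<partial>lborel)" for a b
    by (intro nn_integral_mono_AE) (auto elim!: eventually_mono intro!: mult_right_mono)
  from le_less_trans[OF this div_Linf] show ?thesis
    using m(1,2) by (intro exI[of _ m] conjI allI impI) blast+
qed

definition m :: "real \<Rightarrow> ennreal" where
  "m = (SOME m. m \<in> borel_measurable borel \<and> (\<forall>r. AE x in lborel. ennreal \<bar>D (r, x)\<bar> \<le> m r) \<and>
     (\<forall>a b. a < b \<longrightarrow> (\<integral>\<^sup>+ r. m r * indicator {a..b} r \<partial>lborel) < \<infinity>))"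

lemma m_meas[measurable]: "m \<in> borel_measurable borel"
  and m_bound: "AE x in lborel. ennreal \<bar>D (r, x)\<bar> \<le> m r"
  and m_int: "a < b \<Longrightarrow> (\<integral>\<^sup>+ r. m r * indicator {a..b} r \<partial>lborel) < \<infinity>"
  using someI_ex[OF majorant_ex] unfolding m_def[symmetric] by simp_all

abbreviation "\<kappa> k \<equiv> eta_kernel (\<epsilon> k)"
abbreviation "\<kappa>' k \<equiv> eta_kernel' (\<epsilon> k)"

lemma kern: "C1_kernel (\<kappa> k) (\<kappa>' k) (\<epsilon> k)"
  by (rule eta_kernel_C1[OF eps_pos])

lemma eps_le: "\<epsilon> k \<le> \<epsilon> 0"
  using eps_dec by (simp add: decseq_def)

lemma \<kappa>_nonneg: "0 \<le> \<kappa> k z"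
  by (rule eta_kernel_nonneg[OF eps_pos])

lemma \<kappa>_meas[measurable]: "\<kappa> k \<in> borel_measurable borel"
  by (rule borel_measurable_continuous_onI[OF C1_kernel.cont[OF kern]])

lemma \<kappa>_nonzeroD:
  assumes "\<kappa> k (z - w) \<noteq> 0"
  shows "\<bar>fst z - fst w\<bar> < \<epsilon> k" "norm (snd z - snd w) < \<epsilon> k"
proof -
  have "norm (z - w) < \<epsilon> k" using C1_kernel.supp[OF kern, of k "z - w"] assms by force
  then show "\<bar>fst z - fst w\<bar> < \<epsilon> k" "norm (snd z - snd w) < \<epsilon> k"
    using norm_fst_le[of "fst (z - w)" "snd (z - w)"] norm_snd_le[of "snd (z - w)" "fst (z - w)"]
    unfolding prod.collapse by auto
qed

lemma Om_measurable: "Om \<in> sets lebesgue" "Om \<in> sets borel"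
  using Om_open by auto

text \<open>Equal measures give a null difference because \<open>Om\<close> is bounded, hence of
  finite measure.\<close>

lemma closure_Om_null: "closure Om - Om \<in> null_sets lebesgue"
proof -
  have fin: "emeasure lebesgue Om \<noteq> \<infinity>"
    using emeasure_bounded_finite[OF Om_bdd] Om_measurable by simp
  have "emeasure lebesgue (closure Om - Om) = emeasure lebesgue (closure Om) - emeasure lebesgue Om"
    using fin Om_measurable(1) by (intro emeasure_Diff) (auto simp: closure_subset simp del: emeasure_completion)
  also have "\<dots> = 0" unfolding Om_meas[symmetric] using fin by (simp del: emeasure_completion)
  finally show ?thesis using Om_measurable by (intro null_setsI) (auto simp del: emeasure_completion)
qed

definition That :: "real \<Rightarrow> real \<Rightarrow> real^3 \<Rightarrow> real^3" where
  "That r q x = (if x \<in> Om then X r q x else x)"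

lemma That_measurable: "That r q \<in> borel_measurable lebesgue"
proof -
  have "That r q = (\<lambda>x. indicator Om x *\<^sub>R X r q x + indicator (- Om) x *\<^sub>R x)"
    by (auto simp: That_def fun_eq_iff indicator_def)
  moreover have "(\<lambda>x. indicator Om x *\<^sub>R X r q x) \<in> borel_measurable lebesgue"
    using X_meas'[of r q] by (simp add: set_borel_measurable_def)
  moreover have "(\<lambda>x. indicator (- Om) x *\<^sub>R x :: real^3) \<in> borel_measurable lebesgue"
    by (rule measurable_completion, intro borel_measurable_scaleR borel_measurable_indicator)
       (use Om_open in \<open>auto\<close>)
  ultimately show ?thesis by (simp only:) (rule borel_measurable_add)
qed

lemma That_mem_ball: "x \<in> ball c R \<Longrightarrow> That r q x \<in> ball c R"
  using X_range[of x r q] K_sup by (auto simp: That_def)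

end

section \<open>Mollified velocity fields on a time window\<close>

locale flow_interval = flow_setup +
  fixes T0 T1 :: real
  assumes T01: "T0 < T1"
begin

abbreviation "I \<equiv> {T0..T1}"

text \<open>The window widened by the largest mollification radius: at times in \<open>I\<close> no
  kernel sees beyond it.\<close>

definition J :: "real set" where "J = {T0 - \<epsilon> 0..T1 + \<epsilon> 0}"

text \<open>Truncation in time makes the field integrable over all of space-time, as
  \<open>conv\<close> needs. It is invisible to mollification at times in \<open>I\<close>, and its
  jumps in time are harmless since only spatial derivatives of the field are moved off the
  kernel.\<close>

definition VJ :: "3 \<Rightarrow> real \<times> (real^3) \<Rightarrow> real" where "VJ i z = indicator (J \<times> UNIV) z * V i z"

definition DJ :: "real \<times> (real^3) \<Rightarrow> real" where "DJ z = indicator (J \<times> UNIV) z * D z"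

lemma VJ_integrable: "integrable lborel (VJ i)"
  unfolding VJ_def[abs_def] J_def by (rule V_int)

lemma DJ_integrable: "integrable lborel DJ"
  unfolding DJ_def[abs_def] J_def by (rule D_int)

lemma VJ_meas[measurable]: "VJ i \<in> borel_measurable borel" and DJ_meas[measurable]: "DJ \<in> borel_measurable borel"
  using borel_measurable_integrable[OF VJ_integrable] borel_measurable_integrable[OF DJ_integrable] by auto

definition bk :: "nat \<Rightarrow> real \<Rightarrow> real^3 \<Rightarrow> real^3" where
  "bk k r x = (\<Sum>i\<in>UNIV. conv (\<kappa> k) (VJ i) (r, x) *\<^sub>R axis i 1)"

definition Dbk :: "nat \<Rightarrow> real \<Rightarrow> real^3 \<Rightarrow> real^3 \<Rightarrow> real^3" where
  "Dbk k r x h = (\<Sum>i\<in>UNIV. conv (\<lambda>w. \<kappa>' k w \<bullet> (0, h)) (VJ i) (r, x) *\<^sub>R axis i 1)"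

lemma conv_\<kappa>_integrable:
  assumes F: "integrable lborel F"
  shows "integrable lborel (\<lambda>w. \<kappa> k (z - w) * F w)"
proof -
  obtain B where "\<And>z. \<bar>\<kappa> k z\<bar> \<le> B" using C1_kernel.bounded[OF kern] by blast
  from conv_bounded_integrable[OF F C1_kernel.cont[OF kern] this] show ?thesis .
qed

lemma conv_\<kappa>'_integrable:
  assumes F: "integrable lborel F"
  shows "integrable lborel (\<lambda>w. (\<kappa>' k (z - w) \<bullet> h) * F w)"
proof -
  obtain B where "\<And>z. \<bar>\<kappa>' k z \<bullet> h\<bar> \<le> B" using C1_kernel.bounded'_dir[OF kern] by blast
  from conv_bounded_integrable[OF F C1_kernel.cont'_dir[OF kern] this] show ?thesis .
qed

text \<open>The kernel vanishes for time differences of \<open>\<epsilon> k\<close> or more, so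
  truncation to \<open>J\<close> changes nothing at times in \<open>I\<close>; \<open>v\<close> and
  \<open>V\<close> differ inside \<open>Om\<close> on a null set only, and both vanish
  outside.\<close>

lemma mollify_eq:
  assumes r: "r \<in> I"
  shows "mollify (\<epsilon> k) (\<lambda>(q, y). v q y) (r, x) = bk k r x"
proof -
  let ?g = "\<lambda>w. \<Sum>i\<in>UNIV. (\<kappa> k ((r, x) - w) * VJ i w) *\<^sub>R axis i (1::real)"
  have "AE w in lebesgue. \<forall>i\<in>UNIV. snd w \<in> Om \<longrightarrow> v (fst w) (snd w) $ i = V i w"
    using V_AE by (intro AE_finite_allI) auto
  then have eq: "AE w in lebesgue. ((1 / \<epsilon> k ^ 4) * eta ((1 / \<epsilon> k) *\<^sub>R ((r, x) - w))) *\<^sub>R (case w of (q, y) \<Rightarrow> v q y) = ?g w"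
  proof eventually_elim
    case (elim w)
    have vV: "v (fst w) (snd w) = (\<Sum>i\<in>UNIV. V i w *\<^sub>R axis i 1)"
    proof (subst vec_eq_iff, intro allI)
      fix i
      show "v (fst w) (snd w) $ i = (\<Sum>i\<in>UNIV. V i w *\<^sub>R axis i 1) $ i"
        unfolding sum_axis_nth using elim v_zero[of "snd w" "fst w"] V_zero[of w i]
        by (cases "snd w \<in> Om") auto
    qed
    have k: "\<kappa> k ((r, x) - w) * V i w = \<kappa> k ((r, x) - w) * VJ i w" for i
    proof (cases "\<kappa> k ((r, x) - w) = 0")
      case False
      from \<kappa>_nonzeroD(1)[OF this] have "fst w \<in> J" using r eps_le[of k] by (auto simp: J_def)
      then have "w \<in> J \<times> UNIV" by (cases w) auto
      then show ?thesis by (simp add: VJ_def)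
    qed simp
    have "((1 / \<epsilon> k ^ 4) * eta ((1 / \<epsilon> k) *\<^sub>R ((r, x) - w))) *\<^sub>R (case w of (q, y) \<Rightarrow> v q y)
       = \<kappa> k ((r, x) - w) *\<^sub>R v (fst w) (snd w)" by (simp add: eta_kernel_def case_prod_unfold)
    also have "\<dots> = (\<Sum>i\<in>UNIV. (\<kappa> k ((r, x) - w) * V i w) *\<^sub>R axis i 1)" unfolding vV by (simp add: scaleR_sum_right)
    also have "\<dots> = ?g w" unfolding k ..
    finally show ?case .
  qed
  have ig: "integrable lborel (\<lambda>w. (\<kappa> k ((r, x) - w) * VJ i w) *\<^sub>R axis i (1::real))" for i
    by (intro integrable_scaleR_left conv_\<kappa>_integrable VJ_integrable)
  have "mollify (\<epsilon> k) (\<lambda>(q, y). v q y) (r, x) = (LINT w|lebesgue. ?g w)"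
    unfolding mollify_def by (rule completion.integral_cong_AE'[OF eq])
  also have "\<dots> = (LINT w|lborel. ?g w)"
    using borel_measurable_integrable[OF Bochner_Integration.integrable_sum[OF ig]] by (intro integral_completion) simp
  also have "\<dots> = (\<Sum>i\<in>UNIV. LINT w|lborel. (\<kappa> k ((r, x) - w) * VJ i w) *\<^sub>R axis i (1::real))"
    by (rule Bochner_Integration.integral_sum[OF ig])
  also have "\<dots> = bk k r x"
    unfolding bk_def conv_def using conv_\<kappa>_integrable[OF VJ_integrable]
    by (intro sum.cong refl integral_scaleR_left) simp
  finally show ?thesis .
qed

lemma bk_zero:
  assumes "\<And>w. snd w \<in> Om \<Longrightarrow> \<kappa> k ((r, x) - w) = 0"
  shows "bk k r x = 0"
proof -
  have z: "\<kappa> k ((r, x) - w) * VJ i w = 0" for w i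
    using assms[of w] V_zero[of w i] by (cases "snd w \<in> Om") (auto simp: VJ_def)
  show ?thesis unfolding bk_def conv_def z by simp
qed

text \<open>For almost every time \<open>q\<close> one integrates by parts in space against the
  shifted kernel. This kernel need not vanish on the boundary of \<open>Om\<close>, which is why the
  sections have to lie in the closure of the test functions. Fubini then reassembles the
  sections.\<close>

lemma divergence_conv:
  "(\<Sum>j\<in>UNIV. conv (\<lambda>w. \<kappa>' k w \<bullet> (0, axis j 1)) (VJ j) z) = conv (\<kappa> k) DJ z"
proof -
  define F where "F j w = (\<kappa>' k (z - w) \<bullet> (0, axis j 1)) * VJ j w" for j w
  define G where "G w = \<kappa> k (z - w) * DJ w" for w
  have iF: "integrable (lborel \<Otimes>\<^sub>M lborel) (F j)" for j
    unfolding lborel_prod F_def[abs_def] by (rule conv_\<kappa>'_integrable[OF VJ_integrable])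
  have iG: "integrable (lborel \<Otimes>\<^sub>M lborel) G"
    unfolding lborel_prod G_def[abs_def] by (rule conv_\<kappa>_integrable[OF DJ_integrable])
  have "AE q in lborel. \<forall>j\<in>UNIV. AE y in lborel. y \<in> Om \<longrightarrow> v q y $ j = V j (q, y)"
    using AE_lebesgue_pair[OF V_AE] by (intro AE_finite_allI) auto
  moreover have "AE q in lborel. \<forall>j\<in>UNIV. W011_0 Om (\<lambda>x. v q x $ j) (\<lambda>i x. Dv q x $ j $ i)"
    using v_W011_0 by (intro AE_finite_allI) auto
  moreover note AE_lebesgue_pair[OF D_AE]
  ultimately have "AE q in lborel. (\<Sum>j\<in>UNIV. LINT y|lborel. F j (q, y)) = (LINT y|lborel. G (q, y))"
  proof eventually_elim
    case (elim q)
    show ?case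
    proof (cases "q \<in> J")
      case False
      then show ?thesis by (simp add: F_def G_def VJ_def DJ_def indicator_times)
    next
      case True
      define \<psi> where "\<psi> y = \<kappa> k (z - (q, y))" for y
      \<comment> \<open>The sign is due to \<open>y\<close> entering the kernel through
        \<open>z - (q, y)\<close>; it cancels the sign of the integration by parts.\<close>
      define \<psi>' where "\<psi>' y h = - (\<kappa>' k (z - (q, y)) \<bullet> (0, h))" for y h
      obtain B where B: "\<And>z. \<bar>\<kappa> k z\<bar> \<le> B" using C1_kernel.bounded[OF kern] by blast
      have d\<psi>: "(\<psi> has_derivative \<psi>' y) (at y)" for y
      proof -
        have "(\<psi> has_derivative (\<lambda>h. \<kappa>' k (z - (q, y)) \<bullet> (- (0, h)))) (at y)"
          unfolding \<psi>_def[abs_def]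
          by (rule has_derivative_compose[OF _ C1_kernel.deriv[OF kern]]) (auto intro!: derivative_eq_intros)
        then show ?thesis by (rule has_derivative_eq_rhs) (auto simp: \<psi>'_def fun_eq_iff inner_minus_right[symmetric] simp del: inner_minus_right)
      qed
      have c\<psi>: "continuous_on UNIV \<psi>"
        using has_derivative_continuous[OF d\<psi>] by (auto intro: continuous_at_imp_continuous_on)
      have c\<psi>': "continuous_on UNIV (\<lambda>y. \<psi>' y h)" for h
        unfolding \<psi>'_def by (intro continuous_intros continuous_on_compose2[OF C1_kernel.cont'[OF kern]]) auto
      have \<psi>m: "\<psi> \<in> borel_measurable borel" "(\<lambda>y. \<psi>' y h) \<in> borel_measurable borel" for h
        using borel_measurable_continuous_onI[OF c\<psi>] borel_measurable_continuous_onI[OF c\<psi>'] by auto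
      have A: "(LINT y|lborel. F j (q, y)) = (LINT y:Om|lebesgue. Dv q y $ j $ j * \<psi> y)" for j
      proof -
        have vj: "AE y in lebesgue. y \<in> Om \<longrightarrow> v q y $ j = V j (q, y)" using elim(1) by (intro AE_completion) auto
        have W: "W011_0 Om (\<lambda>x. v q x $ j) (\<lambda>i x. Dv q x $ j $ i)" using elim(2) by auto
        obtain B' where B': "\<And>w. \<bar>\<kappa>' k w \<bullet> (0, axis j 1)\<bar> \<le> B'" using C1_kernel.bounded'_dir[OF kern] by blast
        have Fm: "(\<lambda>y. F j (q, y)) \<in> borel_measurable lborel"
        proof -
          have "(\<lambda>y. F j (q, y)) = (\<lambda>y. - \<psi>' y (axis j 1) * VJ j (q, y))" by (simp add: F_def \<psi>'_def)
          then show ?thesis using \<psi>m(2)[of "axis j 1"] by simp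
        qed
        have "(LINT y|lborel. F j (q, y)) = (LINT y|lebesgue. F j (q, y))"
          using integral_completion[OF Fm] by simp
        also have "\<dots> = (LINT y|lebesgue. - (indicator Om y *\<^sub>R (v q y $ j * \<psi>' y (axis j 1))))"
        proof (rule completion.integral_cong_AE')
          show "AE y in lebesgue. F j (q, y) = - (indicator Om y *\<^sub>R (v q y $ j * \<psi>' y (axis j 1)))"
            using vj
          proof eventually_elim
            case (elim y)
            then show ?case using True V_zero[of "(q, y)" j]
              by (cases "y \<in> Om") (auto simp: F_def VJ_def \<psi>'_def indicator_times)
          qed
        qed
        also have "\<dots> = - (LINT y:Om|lebesgue. v q y $ j * \<psi>' y (axis j 1))"
          unfolding set_lebesgue_integral_def by (rule Bochner_Integration.integral_minus)
        also have "\<dots> = (LINT y:Om|lebesgue. Dv q y $ j $ j * \<psi> y)"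
          using W011_0_integration_by_parts[OF W Om_open d\<psi> c\<psi>', where B=B and B'=B'] B B' by (simp add: \<psi>_def \<psi>'_def)
        finally show ?thesis .
      qed
      have iD: "set_integrable lebesgue Om (\<lambda>y. Dv q y $ j $ j * \<psi> y)" for j
      proof -
        have "set_integrable lebesgue Om (\<lambda>y. Dv q y $ j $ j)" using elim(2) by (auto simp: W011_0_def)
        from integrable_bounded_mult_right[OF this[unfolded set_integrable_def] measurable_completion, of \<psi> B] \<psi>m(1) B
        show ?thesis by (simp add: set_integrable_def \<psi>_def mult_ac)
      qed
      have "(\<Sum>j\<in>UNIV. LINT y|lborel. F j (q, y)) = (LINT y|lebesgue. (\<Sum>j\<in>UNIV. indicator Om y *\<^sub>R (Dv q y $ j $ j * \<psi> y)))"
        unfolding A set_lebesgue_integral_def using iD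
        by (intro Bochner_Integration.integral_sum[symmetric]) (simp add: set_integrable_def)
      also have "\<dots> = (LINT y|lebesgue. G (q, y))"
      proof (rule completion.integral_cong_AE')
        show "AE y in lebesgue. (\<Sum>j\<in>UNIV. indicator Om y *\<^sub>R (Dv q y $ j $ j * \<psi> y)) = G (q, y)"
          using AE_completion[OF elim(3)]
        proof eventually_elim
          case (elim y)
          have "(\<Sum>j\<in>UNIV. indicator Om y *\<^sub>R (Dv q y $ j $ j * \<psi> y)) = indicator Om y * (wdiv Dv q y * \<psi> y)"
            by (simp add: wdiv_def sum_distrib_left sum_distrib_right)
          then show ?case using elim True D_zero[of "(q, y)"]
            by (cases "y \<in> Om") (auto simp: G_def DJ_def \<psi>_def indicator_times)
        qed
      qed
      also have "\<dots> = (LINT y|lborel. G (q, y))"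
      proof (rule integral_completion)
        have "(\<lambda>y. G (q, y)) = (\<lambda>y. \<psi> y * DJ (q, y))" by (simp add: G_def \<psi>_def)
        then show "(\<lambda>y. G (q, y)) \<in> borel_measurable lborel" using \<psi>m(1) by simp
      qed
      finally show ?thesis .
    qed
  qed
  note ae = this
  have "(\<Sum>j\<in>UNIV. conv (\<lambda>w. \<kappa>' k w \<bullet> (0, axis j 1)) (VJ j) z) = (\<Sum>j\<in>UNIV. LINT q|lborel. LINT y|lborel. F j (q, y))"
    using lborel_pair.integral_fst'[OF iF] unfolding conv_def F_def[abs_def] lborel_prod by simp
  also have "\<dots> = (LINT q|lborel. (\<Sum>j\<in>UNIV. LINT y|lborel. F j (q, y)))"
    using lborel_pair.integrable_fst'[OF iF] by (intro Bochner_Integration.integral_sum[symmetric]) auto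
  also have "\<dots> = (LINT q|lborel. LINT y|lborel. G (q, y))"
    using ae lborel_pair.integrable_fst'[OF iF] lborel_pair.integrable_fst'[OF iG]
    by (intro integral_cong_AE borel_measurable_sum) (auto dest: borel_measurable_integrable)
  also have "\<dots> = conv (\<kappa> k) DJ z"
    using lborel_pair.integral_fst'[OF iG] unfolding conv_def G_def[abs_def] lborel_prod by simp
  finally show ?thesis .
qed

end

lemma uniformly_continuous_on_sum:
  fixes f :: "'i \<Rightarrow> 'a::metric_space \<Rightarrow> 'b::real_normed_vector"
  assumes "\<And>i. i \<in> A \<Longrightarrow> uniformly_continuous_on S (f i)"
  shows "uniformly_continuous_on S (\<lambda>x. \<Sum>i\<in>A. f i x)"
  using assms
  by (induction A rule: infinite_finite_induct) (auto intro: uniformly_continuous_on_add uniformly_continuous_on_const)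

context flow_interval
begin

lemma conv_VJ_uc: "uniformly_continuous_on UNIV (conv (\<kappa> k) (VJ i))"
proof -
  obtain B where "\<And>z. \<bar>\<kappa> k z\<bar> \<le> B" using C1_kernel.bounded[OF kern] by blast
  from uniformly_continuous_conv[OF VJ_integrable C1_kernel.uc[OF kern] this] show ?thesis .
qed

lemma conv_VJ'_cont: "continuous_on UNIV (conv (\<lambda>w. \<kappa>' k w \<bullet> h) (VJ i))"
proof -
  obtain B where "\<And>z. \<bar>\<kappa>' k z \<bullet> h\<bar> \<le> B" using C1_kernel.bounded'_dir[OF kern] by blast
  from uniformly_continuous_imp_continuous[OF uniformly_continuous_conv[OF VJ_integrable C1_kernel.uc'_dir[OF kern] this]]
  show ?thesis .
qed

lemma Dbk_diagonal: "(\<Sum>j\<in>UNIV. Dbk k r x (axis j 1) $ j) = conv (\<kappa> k) DJ (r, x)"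
  unfolding Dbk_def sum_axis_nth by (rule divergence_conv)

text \<open>The constants are sup bounds of the kernel and its gradient times L1 norms of the field.
  They depend on \<open>k\<close>, and uniformity in \<open>k\<close> is sought only for the
  compression.\<close>

lemma smooth_flow_k:
  obtains L M where "smooth_flow (bk k) (Dbk k) T0 T1 L M c R (Xk k)"
proof -
  obtain B where B: "B \<ge> 0" "\<And>z. \<bar>\<kappa> k z\<bar> \<le> B" using C1_kernel.bounded[OF kern] by blast
  obtain B' where B': "B' \<ge> 0" "\<And>z. norm (\<kappa>' k z) \<le> B'" using C1_kernel.bounded'[OF kern] by blast
  define n where "n i = (LINT w|lborel. \<bar>VJ i w\<bar>)" for i
  have n: "n i \<ge> 0" for i unfolding n_def by simp
  define L where "L = (\<Sum>i\<in>UNIV. B' * n i)"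
  define M where "M = (\<Sum>i\<in>UNIV. B * n i)"
  have "smooth_flow (bk k) (Dbk k) T0 T1 L M c R (Xk k)"
  proof
    fix r x
    have "((\<lambda>x. conv (\<kappa> k) (VJ i) (r, x)) has_derivative (\<lambda>h. conv (\<lambda>w. \<kappa>' k w \<bullet> (0, h)) (VJ i) (r, x))) (at x)" for i
      by (rule has_derivative_compose[OF _ C1_kernel.conv_has_derivative[OF kern VJ_integrable]]) (auto intro!: derivative_eq_intros)
    then show "(bk k r has_derivative Dbk k r x) (at x)"
      unfolding bk_def[abs_def] Dbk_def[abs_def] by (intro has_derivative_sum has_derivative_scaleR_left)
    fix h
    have "norm (Dbk k r x h) \<le> (\<Sum>i\<in>UNIV. \<bar>conv (\<lambda>w. \<kappa>' k w \<bullet> (0, h)) (VJ i) (r, x)\<bar>)"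
      unfolding Dbk_def by (rule norm_sum_axis_le)
    also have "\<dots> \<le> (\<Sum>i\<in>UNIV. (B' * norm h) * n i)"
      unfolding n_def
    proof (intro sum_mono conv_bound VJ_integrable C1_kernel.cont'_dir[OF kern])
      fix z
      have "\<bar>\<kappa>' k z \<bullet> (0, h)\<bar> \<le> norm (\<kappa>' k z) * norm (0::real, h)" by (rule Cauchy_Schwarz_ineq2)
      also have "\<dots> \<le> B' * norm h" using B' by (simp add: norm_Pair mult_right_mono)
      finally show "\<bar>\<kappa>' k z \<bullet> (0, h)\<bar> \<le> B' * norm h" .
    qed
    also have "\<dots> = L * norm h" unfolding L_def sum_distrib_right by (simp add: mult_ac)
    finally show "norm (Dbk k r x h) \<le> L * norm h" .
    show "continuous_on UNIV (\<lambda>x. Dbk k r x h)"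
      unfolding Dbk_def by (intro continuous_intros continuous_on_compose2[OF conv_VJ'_cont]) auto
  next
    show "L \<ge> 0" unfolding L_def using B' n by (intro sum_nonneg mult_nonneg_nonneg) auto
  next
    fix r x
    have "norm (bk k r x) \<le> (\<Sum>i\<in>UNIV. \<bar>conv (\<kappa> k) (VJ i) (r, x)\<bar>)"
      unfolding bk_def by (rule norm_sum_axis_le)
    also have "\<dots> \<le> M" unfolding M_def n_def
      by (intro sum_mono conv_bound VJ_integrable C1_kernel.cont[OF kern] B)
    finally show "norm (bk k r x) \<le> M" .
  next
    have "uniformly_continuous_on UNIV (\<lambda>z. \<Sum>i\<in>UNIV. conv (\<kappa> k) (VJ i) z *\<^sub>R axis i (1::real))"
      by (intro uniformly_continuous_on_sum bounded_linear.uniformly_continuous_on[OF bounded_linear_scaleR_left] conv_VJ_uc)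
    then have "uniformly_continuous_on UNIV (\<lambda>(r, x). bk k r x)"
      by (simp add: bk_def case_prod_unfold)
    then show "uniformly_continuous_on ({T0..T1} \<times> UNIV) (\<lambda>(r, x). bk k r x)"
      unfolding uniformly_continuous_on_def by (meson UNIV_I)
  next
    have "continuous_on UNIV (conv (\<kappa> k) DJ)"
    proof -
      from uniformly_continuous_imp_continuous[OF uniformly_continuous_conv[OF DJ_integrable C1_kernel.uc[OF kern] B(2)]]
      show ?thesis .
    qed
    then have "continuous_on ({T0..T1} \<times> UNIV) (conv (\<kappa> k) DJ)" by (rule continuous_on_subset) simp
    then show "continuous_on ({T0..T1} \<times> UNIV) (\<lambda>(r, x). \<Sum>j\<in>UNIV. Dbk k r x (axis j 1) $ j)"
      unfolding Dbk_diagonal by simp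
  next
    fix r x assume x: "x \<notin> ball c R"
    show "bk k r x = 0"
    proof (rule bk_zero, rule ccontr)
      fix w assume w: "snd w \<in> Om" "\<kappa> k ((r, x) - w) \<noteq> 0"
      from \<kappa>_nonzeroD(2)[OF w(2)] eps_le[of k] have "x \<in> cball (snd w) (\<epsilon> 0)"
        by (simp add: dist_norm norm_minus_commute)
      then show False using eps_small[of "snd w"] w(1) closure_subset x by blast
    qed
  next
    show "Xk k r r x = x" for r x by (rule Xk_init)
  next
    fix q r x assume q: "q \<in> {T0..T1}"
    show "((\<lambda>q. Xk k q r x) has_vector_derivative bk k q (Xk k q r x)) (at q)"
      using Xk_ode[of k r x q] mollify_eq[OF q, of k "Xk k q r x"] by simp
  qed
  then show ?thesis by (rule that)
qed

section \<open>Uniform compression of the approximating flows and their limit\<close>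

definition C0 :: real where "C0 = enn2real (\<integral>\<^sup>+q. m q * indicator J q \<partial>lborel)"

lemma C0: "(\<integral>\<^sup>+q. m q * indicator J q \<partial>lborel) = ennreal C0" "C0 \<ge> 0"
proof -
  have "T0 - \<epsilon> 0 < T1 + \<epsilon> 0" using T01 eps_pos[of 0] by linarith
  from m_int[OF this] show "(\<integral>\<^sup>+q. m q * indicator J q \<partial>lborel) = ennreal C0"
    unfolding C0_def J_def by (simp add: less_top)
qed (simp add: C0_def)

text \<open>The time marginal of the mollifier, again of mass 1.\<close>

definition \<rho> :: "nat \<Rightarrow> real \<Rightarrow> ennreal" where
  "\<rho> k \<tau> = (\<integral>\<^sup>+y. ennreal (\<kappa> k (\<tau>, y)) \<partial>lborel)"

lemma \<rho>_meas[measurable]: "\<rho> k \<in> borel_measurable borel"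
proof -
  have "(\<lambda>z. ennreal (\<kappa> k z)) \<in> borel_measurable (lborel \<Otimes>\<^sub>M lborel)" unfolding lborel_prod by simp
  from lborel.borel_measurable_nn_integral_fst[OF this] show ?thesis by (simp add: \<rho>_def[abs_def])
qed

lemma \<rho>_integral: "(\<integral>\<^sup>+\<tau>. \<rho> k \<tau> \<partial>lborel) = 1"
proof -
  have "(\<lambda>z. ennreal (\<kappa> k z)) \<in> borel_measurable (lborel \<Otimes>\<^sub>M lborel)" unfolding lborel_prod by simp
  from lborel.nn_integral_fst[OF this] show ?thesis
    using eta_kernel_nn_integral[OF eps_pos[of k]] unfolding \<rho>_def lborel_prod by simp
qed

text \<open>The majorant \<open>m\<close>, truncated to \<open>J\<close> and mollified in time only.
  As the marginal has mass 1, its integral is \<open>C0\<close> for every \<open>k\<close>; this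
  makes the Gronwall constant uniform.\<close>

definition mk :: "nat \<Rightarrow> real \<Rightarrow> ennreal" where
  "mk k r = (\<integral>\<^sup>+q. (m q * indicator J q) * \<rho> k (r - q) \<partial>lborel)"

lemma J_meas[measurable]: "J \<in> sets borel" by (simp add: J_def)

lemma mk_integral: "(\<integral>\<^sup>+r. mk k r \<partial>lborel) = ennreal C0"
proof -
  have "(\<integral>\<^sup>+r. mk k r \<partial>lborel) = (\<integral>\<^sup>+q. (\<integral>\<^sup>+r. (m q * indicator J q) * \<rho> k (r - q) \<partial>lborel) \<partial>lborel)"
    unfolding mk_def by (rule lborel_pair.Fubini') measurable
  also have "\<dots> = (\<integral>\<^sup>+q. (m q * indicator J q) * (\<integral>\<^sup>+r. \<rho> k (r - q) \<partial>lborel) \<partial>lborel)"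
    by (intro nn_integral_cong nn_integral_cmult) measurable
  also have "\<dots> = (\<integral>\<^sup>+q. m q * indicator J q \<partial>lborel)"
  proof (intro nn_integral_cong)
    fix q
    have "(\<integral>\<^sup>+r. \<rho> k (r - q) \<partial>lborel) = 1"
      using nn_integral_lborel_translation[OF \<rho>_meas[of k], of "-q"] \<rho>_integral by simp
    then show "(m q * indicator J q) * (\<integral>\<^sup>+r. \<rho> k (r - q) \<partial>lborel) = m q * indicator J q" by simp
  qed
  finally show ?thesis using C0 by simp
qed

text \<open>At fixed time \<open>q\<close> the divergence is at most \<open>m q\<close> for almost
  every \<open>y\<close>, so the spatial integral of the kernel leaves just its time
  marginal.\<close>

lemma conv_DJ_bound: "ennreal \<bar>conv (\<kappa> k) DJ (r, x)\<bar> \<le> mk k r"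
proof -
  let ?f = "\<lambda>w. ennreal (\<kappa> k ((r, x) - w)) * ennreal \<bar>DJ w\<bar>"
  have fm: "?f \<in> borel_measurable (lborel \<Otimes>\<^sub>M lborel)" unfolding lborel_prod by simp
  have "ennreal \<bar>conv (\<kappa> k) DJ (r, x)\<bar> \<le> (\<integral>\<^sup>+w. ennreal (norm (\<kappa> k ((r, x) - w) * DJ w)) \<partial>lborel)"
    unfolding conv_def real_norm_def[symmetric]
    by (rule integral_norm_bound_ennreal[OF conv_\<kappa>_integrable[OF DJ_integrable]])
  also have "\<dots> = (\<integral>\<^sup>+w. ?f w \<partial>lborel)"
    using \<kappa>_nonneg by (intro nn_integral_cong) (simp add: abs_mult ennreal_mult)
  also have "\<dots> = (\<integral>\<^sup>+q. (\<integral>\<^sup>+y. ?f (q, y) \<partial>lborel) \<partial>lborel)"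
    using lborel.nn_integral_fst[OF fm] unfolding lborel_prod by simp
  also have "\<dots> \<le> (\<integral>\<^sup>+q. (m q * indicator J q) * \<rho> k (r - q) \<partial>lborel)"
  proof (rule nn_integral_mono)
    fix q
    have km: "(\<lambda>y. ennreal (\<kappa> k (r - q, x - y))) \<in> borel_measurable borel" by measurable
    have "(\<integral>\<^sup>+y. ?f (q, y) \<partial>lborel) \<le> (\<integral>\<^sup>+y. ennreal (\<kappa> k (r - q, x - y)) * (m q * indicator J q) \<partial>lborel)"
    proof (rule nn_integral_mono_AE)
      show "AE y in lborel. ?f (q, y) \<le> ennreal (\<kappa> k (r - q, x - y)) * (m q * indicator J q)"
        using m_bound[of q]
        by eventually_elim (auto simp: DJ_def indicator_times indicator_def intro!: mult_left_mono)
    qed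
    also have "\<dots> = (\<integral>\<^sup>+y. ennreal (\<kappa> k (r - q, x - y)) \<partial>lborel) * (m q * indicator J q)"
      using km by (intro nn_integral_multc) simp
    also have "(\<integral>\<^sup>+y. ennreal (\<kappa> k (r - q, x - y)) \<partial>lborel) = \<rho> k (r - q)"
      unfolding \<rho>_def by (rule nn_integral_lborel_reflection[of "\<lambda>y. ennreal (\<kappa> k (r - q, y))" x]) measurable
    finally show "(\<integral>\<^sup>+y. ?f (q, y) \<partial>lborel) \<le> (m q * indicator J q) * \<rho> k (r - q)" by (simp add: mult.commute)
  qed
  finally show ?thesis unfolding mk_def .
qed

text \<open>The exponential is the Gronwall factor inside the ball; the 1 accounts for the region
  outside, where the flow is at rest.\<close>

abbreviation "CC \<equiv> exp C0 + 1"

lemma compressing_Xk: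
  assumes r: "r \<in> I" and q: "q \<in> I"
  shows "compressing CC (Xk k r q)"
proof -
  obtain L M where "smooth_flow (bk k) (Dbk k) T0 T1 L M c R (Xk k)" using smooth_flow_k by blast
  then interpret S: smooth_flow "bk k" "Dbk k" T0 T1 L M c R "Xk k" .
  show ?thesis
  proof (rule compressingI_lipschitz[OF S.flow_continuous[OF r q]])
    show "Xk k r q x \<in> ball c R \<longleftrightarrow> x \<in> ball c R" for x by (rule S.flow_mem_ball_iff[OF r q])
    show "x \<notin> ball c R \<Longrightarrow> Xk k r q x = x" for x by (rule S.flow_outside[OF _ r q])
    fix \<phi> \<Lambda> assume \<phi>: "\<And>x y. \<bar>\<phi> x - \<phi> y\<bar> \<le> \<Lambda> * norm (x - y)" "\<And>x. x \<notin> ball c R \<Longrightarrow> \<phi> x = 0" "\<And>x. 0 \<le> \<phi> x"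
    show "(LINT x|lborel. \<phi> (Xk k r q x)) \<le> exp C0 * (LINT x|lborel. \<phi> x)"
    proof (rule S.compressibility[OF \<phi> r q _ _ C0(2)])
      show "ennreal \<bar>S.divb r x\<bar> \<le> mk k r" for r x
        unfolding S.divb_def Dbk_diagonal by (rule conv_DJ_bound)
      have "(\<integral>\<^sup>+r. mk k r * indicator {T0..T1} r \<partial>lborel) \<le> (\<integral>\<^sup>+r. mk k r \<partial>lborel)"
        by (intro nn_integral_mono) (auto simp: indicator_def)
      then show "(\<integral>\<^sup>+r. mk k r * indicator {T0..T1} r \<partial>lborel) \<le> ennreal C0" by (simp add: mk_integral)
    qed
  qed simp
qed

lemma Xk_eventually_stationary:
  assumes x: "x \<notin> closure Om" and r: "r \<in> I" and q: "q \<in> I"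
  shows "\<forall>\<^sub>F k in sequentially. Xk k r q x = x"
proof -
  obtain d where d: "d > 0" "\<And>y. y \<in> Om \<Longrightarrow> d \<le> dist x y"
  proof -
    have "open (- closure Om)" by (intro open_Compl closed_closure)
    then obtain d where d: "d > 0" "ball x d \<subseteq> - closure Om" using x openE by blast
    have "d \<le> dist x y" if "y \<in> Om" for y using d(2) that closure_subset by (force simp: not_less[symmetric])
    then show ?thesis using that d(1) by blast
  qed
  have "\<forall>\<^sub>F k in sequentially. \<epsilon> k < d" using eps_lim d(1) by (rule order_tendstoD)
  then show ?thesis
  proof eventually_elim
    case (elim k)
    obtain L M where "smooth_flow (bk k) (Dbk k) T0 T1 L M c R (Xk k)" using smooth_flow_k by blast
    then interpret S: smooth_flow "bk k" "Dbk k" T0 T1 L M c R "Xk k" .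
    have "bk k \<tau> x = 0" for \<tau>
    proof (rule bk_zero, rule ccontr)
      fix w assume w: "snd w \<in> Om" "\<kappa> k ((\<tau>, x) - w) \<noteq> 0"
      from \<kappa>_nonzeroD(2)[OF w(2)] have "dist x (snd w) < \<epsilon> k" by (simp add: dist_norm)
      then show False using d(2)[OF w(1)] elim by linarith
    qed
    then show ?case by (intro S.flow_stationary r q)
  qed
qed

lemma Xk_measurable: "r \<in> I \<Longrightarrow> q \<in> I \<Longrightarrow> Xk k r q \<in> borel_measurable lebesgue"
  using compressing_borel_measurable[OF compressing_Xk] .

lemma Xk_mem_ball: "r \<in> I \<Longrightarrow> q \<in> I \<Longrightarrow> x \<in> ball c R \<Longrightarrow> Xk k r q x \<in> ball c R"
proof -
  assume *: "r \<in> I" "q \<in> I" "x \<in> ball c R"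
  obtain L M where "smooth_flow (bk k) (Dbk k) T0 T1 L M c R (Xk k)" using smooth_flow_k by blast
  then interpret S: smooth_flow "bk k" "Dbk k" T0 T1 L M c R "Xk k" .
  show ?thesis using S.flow_mem_ball_iff[OF *(1,2)] *(3) by blast
qed

text \<open>On \<open>Om\<close> the convergence comes from the L2 limit along a subsequence. Off
  the closure of \<open>Om\<close> the approximating flow is eventually at rest, which is the value
  of \<open>That\<close>. The remaining boundary points form a null set.\<close>

lemma Xk_subseq_AE_lim:
  assumes r: "r \<in> I" and q: "q \<in> I"
  shows "subseq_AE_lim lebesgue (\<lambda>k. Xk k r q) (That r q)"
  unfolding subseq_AE_lim_def
proof (intro allI impI)
  fix \<sigma> :: "nat \<Rightarrow> nat" assume \<sigma>: "strict_mono \<sigma>"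
  define u where "u n x = indicator Om x *\<^sub>R (norm (Xk (\<sigma> n) r q x - X r q x))\<^sup>2" for n x
  have um: "u n \<in> borel_measurable lebesgue" for n
  proof -
    have "u n = (\<lambda>x. indicator Om x *\<^sub>R (norm (Xk (\<sigma> n) r q x - That r q x))\<^sup>2)"
      by (auto simp: fun_eq_iff u_def That_def indicator_def)
    then show ?thesis using Xk_measurable[OF r q, of "\<sigma> n"] That_measurable[of r q] Om_measurable(1) by simp
  qed
  \<comment> \<open>Both maps stay in the ball, hence the bound \<open>2 * R\<close>. Integrability
    is essential: without it the vanishing integrals in \<open>X_lim\<close> could merely be the
    default value 0.\<close>
  have ui: "integrable lebesgue (u n)" for n
  proof (rule Bochner_Integration.integrable_bound[OF _ um])
    have "emeasure lebesgue Om < \<infinity>"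
      using emeasure_bounded_finite[OF Om_bdd] Om_measurable by (simp add: less_top)
    then show "integrable lebesgue (\<lambda>x. (2 * R)\<^sup>2 * indicator Om x)"
      using Om_measurable(1) by (intro integrable_mult_right integrable_real_indicator)
    have bd: "norm (Xk (\<sigma> n) r q x - X r q x) \<le> 2 * R" if "x \<in> Om" for x
    proof -
      have "x \<in> ball c R" using that K_sup closure_subset by blast
      then have "Xk (\<sigma> n) r q x \<in> ball c R" "X r q x \<in> ball c R"
        using Xk_mem_ball[OF r q] X_range[OF that, of r q] K_sup by blast+
      then show ?thesis using dist_triangle2[of "Xk (\<sigma> n) r q x" "X r q x" c] by (simp add: dist_norm[symmetric] dist_commute)
    qed
    show "AE x in lebesgue. norm (u n x) \<le> norm ((2 * R)\<^sup>2 * indicator Om x)"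
    proof (rule AE_I2)
      fix x
      show "norm (u n x) \<le> norm ((2 * R)\<^sup>2 * indicator Om x)"
        using power_mono[OF bd[of x], of 2] by (cases "x \<in> Om") (auto simp: u_def)
    qed
  qed
  have "(\<lambda>n. LINT x|lebesgue. norm (u n x)) \<longlonglongrightarrow> 0"
  proof -
    have "(LINT x|lebesgue. norm (u n x)) = (LINT x:Om|lebesgue. (norm (Xk (\<sigma> n) r q x - X r q x))\<^sup>2)" for n
      unfolding set_lebesgue_integral_def u_def by (intro Bochner_Integration.integral_cong) (auto simp: indicator_def)
    then show ?thesis using LIMSEQ_subseq_LIMSEQ[OF X_lim[of r q] \<sigma>] by (simp add: o_def)
  qed
  from tendsto_L1_AE_subseq[OF ui this] obtain \<tau> where \<tau>: "strict_mono \<tau>" "AE x in lebesgue. (\<lambda>n. u (\<tau> n) x) \<longlonglongrightarrow> 0"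
    by blast
  have "AE x in lebesgue. x \<notin> closure Om - Om" by (rule AE_not_in[OF closure_Om_null])
  with \<tau>(2) have "AE x in lebesgue. (\<lambda>n. Xk (\<sigma> (\<tau> n)) r q x) \<longlonglongrightarrow> That r q x"
  proof eventually_elim
    case (elim x)
    show ?case
    proof (cases "x \<in> Om")
      case True
      then have "(\<lambda>n. (norm (Xk (\<sigma> (\<tau> n)) r q x - X r q x))\<^sup>2) \<longlonglongrightarrow> 0" using elim(1) by (simp add: u_def)
      then have "(\<lambda>n. sqrt ((norm (Xk (\<sigma> (\<tau> n)) r q x - X r q x))\<^sup>2)) \<longlonglongrightarrow> sqrt 0" by (rule tendsto_real_sqrt)
      then show ?thesis using True by (simp add: That_def LIM_zero_iff tendsto_norm_zero_iff)
    next
      case False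
      then have x: "x \<notin> closure Om" using elim(2) by blast
      have "\<forall>\<^sub>F n in sequentially. Xk (\<sigma> (\<tau> n)) r q x = x"
        using eventually_subseq[OF \<sigma> eventually_subseq[OF \<tau>(1)]] Xk_eventually_stationary[OF x r q]
          strict_mono_compose[OF \<sigma> \<tau>(1)] eventually_subseq[of "\<sigma> \<circ> \<tau>" "\<lambda>k. Xk k r q x = x"] strict_mono_o[OF \<sigma> \<tau>(1)]
        by simp
      then show ?thesis using False by (simp add: That_def tendsto_eventually)
    qed
  qed
  then show "\<exists>\<tau> :: nat \<Rightarrow> nat. strict_mono \<tau> \<and> (AE x in lebesgue. (\<lambda>n. Xk (\<sigma> (\<tau> n)) r q x) \<longlonglongrightarrow> That r q x)"
    using \<tau>(1) by blast
qed

lemma compressing_That: "r \<in> I \<Longrightarrow> q \<in> I \<Longrightarrow> compressing CC (That r q)"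
  by (rule compressing_limit[OF compressing_Xk Xk_subseq_AE_lim That_measurable]) (auto intro: add_nonneg_nonneg)

lemma That_inverse:
  assumes r: "r \<in> I" and q: "q \<in> I"
  shows "AE x in lebesgue. x \<in> ball c R \<longrightarrow> That q r (That r q x) = x"
proof (rule limit_flow_inverse[where T="\<lambda>k. Xk k r q" and S="\<lambda>k. Xk k q r" and T'="That r q" and S'="That q r" and C=CC])
  fix k x
  obtain L M where "smooth_flow (bk k) (Dbk k) T0 T1 L M c R (Xk k)" using smooth_flow_k by blast
  then interpret S: smooth_flow "bk k" "Dbk k" T0 T1 L M c R "Xk k" .
  show "Xk k q r (Xk k r q x) = x" by (rule S.flow_inverse[OF r q])
qed (use r q in \<open>auto intro!: compressing_Xk compressing_That Xk_subseq_AE_lim Xk_measurable That_measurable Xk_mem_ball That_mem_ball add_nonneg_nonneg simp del: mem_ball\<close>)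

end

subsection \<open>The transport identity for the limit flow\<close>

lemma integrable_continuous_mult:
  fixes q f :: "'a::euclidean_space \<Rightarrow> real"
  assumes q: "continuous_on UNIV q" and C: "compact C" "S \<subseteq> C" and S: "S \<in> sets borel" "S \<subseteq> S'"
    and f: "integrable lborel (\<lambda>z. indicator S' z * f z)"
  shows "integrable lborel (\<lambda>z. indicator S z * (q z * f z))"
proof -
  have qm: "q \<in> borel_measurable borel" using q by (rule borel_measurable_continuous_onI)
  have "compact (q ` C)" by (intro compact_continuous_image continuous_on_subset[OF q] C) auto
  then obtain B where B: "\<And>z. z \<in> C \<Longrightarrow> \<bar>q z\<bar> \<le> B"
    using compact_imp_bounded bounded_iff by (metis imageI real_norm_def)
  have "integrable lborel (\<lambda>z. (indicator S z * q z) * (indicator S' z * f z))"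
  proof (rule integrable_bounded_mult_right[OF f])
    show "(\<lambda>z. indicator S z * q z) \<in> borel_measurable lborel" using qm S by simp
    show "\<bar>indicator S z * q z\<bar> \<le> \<bar>B\<bar>" for z
      using B[of z] C(2) by (cases "z \<in> S") auto
  qed
  moreover have "(\<lambda>z. (indicator S z * q z) * (indicator S' z * f z)) = (\<lambda>z. indicator S z * (q z * f z))"
    using S(2) by (auto simp: fun_eq_iff indicator_def)
  ultimately show ?thesis by simp
qed

text \<open>The time integrals of the theorem are over \<open>lebesgue\<close>, and their integrands
  agree with Borel ones only almost everywhere; completeness makes that sufficient.\<close>

lemma interval_integral_lebesgue_cong_AE:
  fixes F F' :: "real \<Rightarrow> real"
  assumes s: "s \<in> {T0..T1}" and t: "t \<in> {T0..T1}" and F: "set_integrable lborel {T0..T1} F"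
    and eq: "AE r in lborel. F r = F' r"
  shows "interval_lebesgue_integrable lebesgue (ereal s) (ereal t) F'"
    and "interval_lebesgue_integral lebesgue (ereal s) (ereal t) F' = (LBINT r=s..t. F r)"
proof -
  have *: "set_integrable lebesgue A F'" "(LINT r:A|lebesgue. F' r) = (LINT r:A|lborel. F r)"
    if A: "A \<in> sets borel" "A \<subseteq> {T0..T1}" for A
  proof -
    have i: "integrable lborel (\<lambda>r. indicator A r *\<^sub>R F r)"
      using set_integrable_subset[OF F, of A] A by (simp add: set_integrable_def)
    have il: "integrable lebesgue (\<lambda>r. indicator A r *\<^sub>R F r)"
      using i borel_measurable_integrable[OF i] by (simp add: integrable_completion)
    have ae: "AE r in lebesgue. indicator A r *\<^sub>R F r = indicator A r *\<^sub>R F' r"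
      using AE_completion[OF eq] by eventually_elim simp
    show "set_integrable lebesgue A F'"
      unfolding set_integrable_def using completion.integrable_cong_AE'[THEN iffD1, OF ae il] .
    show "(LINT r:A|lebesgue. F' r) = (LINT r:A|lborel. F r)"
      unfolding set_lebesgue_integral_def completion.integral_cong_AE'[OF ae, symmetric]
      by (rule integral_completion[OF borel_measurable_integrable[OF i]])
  qed
  have sub: "einterval (ereal s) (ereal t) \<subseteq> {T0..T1}" "einterval (ereal t) (ereal s) \<subseteq> {T0..T1}"
    using s t by (auto simp: einterval_iff)
  show "interval_lebesgue_integrable lebesgue (ereal s) (ereal t) F'"
    unfolding interval_lebesgue_integrable_def using *(1) sub by simp
  show "interval_lebesgue_integral lebesgue (ereal s) (ereal t) F' = (LBINT r=s..t. F r)"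
    unfolding interval_lebesgue_integral_def using *(2) sub by simp
qed

context flow_setup
begin

text \<open>The density with Borel representatives in place of \<open>v\<close> and its divergence.
  The limit is carried out with \<open>Hb\<close>, whereas \<open>Hs\<close> is the expression of
  the theorem; on \<open>Om\<close> they agree almost everywhere.\<close>

definition Hb :: "(real \<times> (real^3) \<Rightarrow> real) \<Rightarrow> real \<Rightarrow> real^3 \<Rightarrow> real" where
  "Hb g r x = dt g (r, x) + (\<Sum>j\<in>UNIV. dx j g (r, x) * V j (r, x)) + g (r, x) * D (r, x)"

definition Hs :: "(real \<times> (real^3) \<Rightarrow> real) \<Rightarrow> real \<Rightarrow> real^3 \<Rightarrow> real" where
  "Hs g r x = dt g (r, x) + (\<Sum>j\<in>UNIV. dx j g (r, x) * v r x $ j) + g (r, x) * wdiv Dv r x"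

lemma Hb_AE: "AE r in lborel. AE x in lborel. x \<in> Om \<longrightarrow> Hs g r x = Hb g r x"
proof -
  have "AE q in lborel. \<forall>j\<in>UNIV. AE y in lborel. y \<in> Om \<longrightarrow> v q y $ j = V j (q, y)"
    using AE_lebesgue_pair[OF V_AE] by (intro AE_finite_allI) auto
  with AE_lebesgue_pair[OF D_AE] show ?thesis
  proof eventually_elim
    case (elim q)
    have "AE y in lborel. \<forall>j\<in>UNIV. y \<in> Om \<longrightarrow> v q y $ j = V j (q, y)"
      using elim(2) by (intro AE_finite_allI) auto
    with elim(1) show ?case
      by eventually_elim (auto simp: Hs_def Hb_def)
  qed
qed

lemma conv_tendsto_L1:
  fixes F :: "real \<times> (real^3) \<Rightarrow> real"
  assumes F: "integrable lborel F"
  shows "(\<lambda>k. \<integral>\<^sup>+z. ennreal \<bar>conv (\<kappa> k) F z - F z\<bar> \<partial>lborel) \<longlonglongrightarrow> 0"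
proof (rule order_tendstoI)
  fix a :: ennreal assume a: "0 < a"
  obtain e :: real where e: "e > 0" "ennreal e < a"
  proof (cases a)
    case (real r)
    then have "r > 0" using a by simp
    then show ?thesis using that[of "r / 2"] real by (simp add: ennreal_lessI)
  next
    case top
    then show ?thesis using that[of 1] by simp
  qed
  obtain d where d: "d > 0" "\<And>h. norm h < d \<Longrightarrow> (\<integral>\<^sup>+z. ennreal \<bar>F (z - h) - F z\<bar> \<partial>lborel) \<le> ennreal e"
    using L1_continuous_translation[OF F e(1)] by blast
  have "\<forall>\<^sub>F k in sequentially. \<epsilon> k < d" using eps_lim d(1) by (rule order_tendstoD)
  then show "\<forall>\<^sub>F k in sequentially. (\<integral>\<^sup>+z. ennreal \<bar>conv (\<kappa> k) F z - F z\<bar> \<partial>lborel) < a"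
  proof eventually_elim
    case (elim k)
    obtain B where B: "\<And>z. \<bar>\<kappa> k z\<bar> \<le> B" using C1_kernel.bounded[OF kern] by blast
    have "(\<integral>\<^sup>+z. ennreal \<bar>conv (\<kappa> k) F z - F z\<bar> \<partial>lborel) \<le> ennreal e"
      by (rule conv_L1_approx[OF F C1_kernel.cont[OF kern] B \<kappa>_nonneg eta_kernel_nn_integral[OF eps_pos], where d="\<epsilon> k"])
         (use C1_kernel.supp[OF kern] d(2) elim in auto)
    then show ?case using e(2) by (rule le_less_trans)
  qed
qed simp

end

context flow_interval
begin

lemma transport_limit_Hb:
  assumes g: "Ck 1 g" and s: "s \<in> I" and t: "t \<in> I"
  shows "transport_limit T0 T1 s t c R (That s) (Hb g) g"
proof
  have m: "g \<in> borel_measurable borel" "dt g \<in> borel_measurable borel" "dx j g \<in> borel_measurable borel" for j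
    using C1_continuous[OF g] C1_continuous_partials[OF g] by (auto intro: borel_measurable_continuous_onI)
  show "s \<in> {T0..T1}" "t \<in> {T0..T1}" by fact+
  show "That s r \<in> borel_measurable lebesgue" for r by (rule That_measurable)
  show "That s r x = x" if "x \<notin> ball c R" for r x
  proof -
    have "x \<notin> Om" using that K_sup closure_subset by blast
    then show ?thesis by (simp add: That_def)
  qed
  show "(\<lambda>z. Hb g (fst z) (snd z)) \<in> borel_measurable borel"
    unfolding Hb_def using m by simp
  show "continuous_on UNIV g" by (rule C1_continuous[OF g])
  show "integrable lborel (\<lambda>x. indicator (ball c R) x * Hb g r x)" for r
  proof -
    have cr: "continuous_on UNIV (\<lambda>x. f (r, x))" if "continuous_on UNIV f" for f :: "real \<times> (real^3) \<Rightarrow> real"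
      by (rule continuous_on_compose2[OF that]) (auto intro: continuous_intros)
    have P: "integrable lborel (\<lambda>x. indicator (ball c R) x * (q (r, x) * f x))"
      if "continuous_on UNIV q" "integrable lborel f" for q :: "real \<times> (real^3) \<Rightarrow> real" and f
      by (rule integrable_continuous_mult[where C="cball c R" and S'=UNIV, OF cr[OF that(1)]]) (use that(2) in auto)
    have 1: "integrable lborel (\<lambda>x. indicator (ball c R) x * (dt g (r, x) * 1))"
      by (rule integrable_continuous_mult[where C="cball c R" and S'="ball c R", OF cr[OF C1_continuous_partials(1)[OF g]]])
         (use emeasure_bounded_finite[OF bounded_ball, of c R] in \<open>auto simp: less_top\<close>)
    have eq: "(\<lambda>x. indicator (ball c R) x * Hb g r x) = (\<lambda>x. indicator (ball c R) x * (dt g (r, x) * 1)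
        + (\<Sum>j\<in>UNIV. indicator (ball c R) x * (dx j g (r, x) * V j (r, x))) + indicator (ball c R) x * (g (r, x) * D (r, x)))"
      by (simp add: fun_eq_iff Hb_def distrib_left sum_distrib_left)
    show ?thesis
      unfolding eq
      by (intro Bochner_Integration.integrable_add Bochner_Integration.integrable_sum 1
          P[OF C1_continuous_partials(2)[OF g] V_sect] P[OF C1_continuous[OF g] D_sect])
  qed
  show "integrable lborel (\<lambda>z. indicator ({T0..T1} \<times> ball c R) z * Hb g (fst z) (snd z))"
  proof -
    let ?S = "{T0..T1} \<times> ball c R"
    have S: "?S \<in> sets borel" by (intro borel_Times) auto
    have cp: "compact ({T0..T1} \<times> cball c R)" by (intro compact_Times) auto
    have P: "integrable lborel (\<lambda>z. indicator ?S z * (q z * f z))"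
      if "continuous_on UNIV q" "integrable lborel (\<lambda>z. indicator ({T0..T1} \<times> UNIV) z * f z)" for q f :: "real \<times> (real^3) \<Rightarrow> real"
      by (rule integrable_continuous_mult[OF that(1) cp _ S _ that(2)]) auto
    have 1: "integrable lborel (\<lambda>z. indicator ?S z * (dt g z * 1))"
    proof (rule integrable_continuous_mult[OF C1_continuous_partials(1)[OF g] cp _ S order_refl])
      have "emeasure lborel ?S < \<infinity>"
        by (rule emeasure_bounded_finite) (intro bounded_Times bounded_ball bounded_closed_interval)
      then show "integrable lborel (\<lambda>z. indicator ?S z * (1::real))"
        unfolding mult_1_right using S by (intro integrable_real_indicator) auto
    qed auto
    have eq: "(\<lambda>z. indicator ?S z * Hb g (fst z) (snd z)) = (\<lambda>z. indicator ?S z * (dt g z * 1)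
        + (\<Sum>j\<in>UNIV. indicator ?S z * (dx j g z * V j z)) + indicator ?S z * (g z * D z))"
      by (simp add: fun_eq_iff Hb_def distrib_left sum_distrib_left)
    show ?thesis
      unfolding eq
      by (intro Bochner_Integration.integrable_add Bochner_Integration.integrable_sum 1
          P[OF C1_continuous_partials(2)[OF g] V_int] P[OF C1_continuous[OF g] D_int])
  qed
qed

text \<open>The time derivative of \<open>g\<close> cancels in the difference. What remains are
  coefficients bounded on the compact window times convolution errors, and those tend to 0 in
  L1.\<close>

lemma Hk_L1:
  assumes g: "Ck 1 g"
  defines "Hk \<equiv> \<lambda>k r x. dt g (r, x) + (\<Sum>j\<in>UNIV. dx j g (r, x) * bk k r x $ j) + g (r, x) * conv (\<kappa> k) DJ (r, x)"
  shows "(\<lambda>k. \<integral>\<^sup>+z. ennreal \<bar>Hk k (fst z) (snd z) - Hb g (fst z) (snd z)\<bar> * indicator (I \<times> ball c R) z \<partial>lborel) \<longlonglongrightarrow> 0"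
proof -
  have cp: "compact (I \<times> cball c R)" by (intro compact_Times) auto
  define N where "N z = \<bar>g z\<bar> + (\<Sum>j\<in>UNIV. \<bar>dx j g z\<bar>)" for z
  have "continuous_on UNIV N"
    unfolding N_def[abs_def] by (intro continuous_intros C1_continuous[OF g] C1_continuous_partials[OF g])
  then have "compact (N ` (I \<times> cball c R))" by (intro compact_continuous_image cp) (auto intro: continuous_on_subset)
  then obtain G0 where G0: "\<And>z. z \<in> I \<times> cball c R \<Longrightarrow> \<bar>N z\<bar> \<le> G0"
    using compact_imp_bounded bounded_iff by (metis imageI real_norm_def)
  define G where "G = \<bar>G0\<bar>"
  have G: "G \<ge> 0" "\<bar>g z\<bar> \<le> G" "\<bar>dx j g z\<bar> \<le> G" if "z \<in> I \<times> cball c R" for z j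
  proof -
    have *: "\<bar>dx j g z\<bar> \<le> (\<Sum>j\<in>UNIV. \<bar>dx j g z\<bar>)" by (rule member_le_sum) auto
    have "0 \<le> (\<Sum>j\<in>UNIV. \<bar>dx j g z\<bar>)" by (rule sum_nonneg) simp
    with * G0[OF that] show "G \<ge> 0" "\<bar>g z\<bar> \<le> G" "\<bar>dx j g z\<bar> \<le> G" by (auto simp: N_def G_def)
  qed
  have G0': "G \<ge> 0" by (simp add: G_def)
  define a where "a k j = (\<integral>\<^sup>+z. ennreal \<bar>conv (\<kappa> k) (VJ j) z - VJ j z\<bar> \<partial>lborel)" for k j
  define d where "d k = (\<integral>\<^sup>+z. ennreal \<bar>conv (\<kappa> k) DJ z - DJ z\<bar> \<partial>lborel)" for k
  have le: "(\<integral>\<^sup>+z. ennreal \<bar>Hk k (fst z) (snd z) - Hb g (fst z) (snd z)\<bar> * indicator (I \<times> ball c R) z \<partial>lborel)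
      \<le> (\<Sum>j\<in>UNIV. ennreal G * a k j) + ennreal G * d k" for k
  proof -
    have cV: "conv (\<kappa> k) (VJ j) \<in> borel_measurable borel" for j
      using uniformly_continuous_imp_continuous[OF conv_VJ_uc] by (rule borel_measurable_continuous_onI)
    obtain B where B: "\<And>z. \<bar>\<kappa> k z\<bar> \<le> B" using C1_kernel.bounded[OF kern] by blast
    have cD: "conv (\<kappa> k) DJ \<in> borel_measurable borel"
      using uniformly_continuous_imp_continuous[OF uniformly_continuous_conv[OF DJ_integrable C1_kernel.uc[OF kern] B]]
      by (rule borel_measurable_continuous_onI)
    have "(\<integral>\<^sup>+z. ennreal \<bar>Hk k (fst z) (snd z) - Hb g (fst z) (snd z)\<bar> * indicator (I \<times> ball c R) z \<partial>lborel)
      \<le> (\<integral>\<^sup>+z. (\<Sum>j\<in>UNIV. ennreal G * ennreal \<bar>conv (\<kappa> k) (VJ j) z - VJ j z\<bar>) + ennreal G * ennreal \<bar>conv (\<kappa> k) DJ z - DJ z\<bar> \<partial>lborel)"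
    proof (rule nn_integral_mono)
      fix z
      show "ennreal \<bar>Hk k (fst z) (snd z) - Hb g (fst z) (snd z)\<bar> * indicator (I \<times> ball c R) z
        \<le> (\<Sum>j\<in>UNIV. ennreal G * ennreal \<bar>conv (\<kappa> k) (VJ j) z - VJ j z\<bar>) + ennreal G * ennreal \<bar>conv (\<kappa> k) DJ z - DJ z\<bar>"
      proof (cases "z \<in> I \<times> ball c R")
        case True
        then have zC: "z \<in> I \<times> cball c R" by auto
        \<comment> \<open>At times in the window \<open>VJ\<close> and \<open>DJ\<close> coincide
          with \<open>V\<close> and \<open>D\<close>.\<close>
        have zJ: "z \<in> J \<times> UNIV" using True eps_pos[of 0] by (auto simp: J_def)
        have bkj: "bk k (fst z) (snd z) $ j = conv (\<kappa> k) (VJ j) z" for j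
          unfolding bk_def sum_axis_nth by simp
        have eq: "Hk k (fst z) (snd z) - Hb g (fst z) (snd z)
          = (\<Sum>j\<in>UNIV. dx j g z * (conv (\<kappa> k) (VJ j) z - VJ j z)) + g z * (conv (\<kappa> k) DJ z - DJ z)"
          using zJ by (simp add: Hk_def Hb_def bkj VJ_def DJ_def right_diff_distrib sum_subtractf)
        have "\<bar>Hk k (fst z) (snd z) - Hb g (fst z) (snd z)\<bar> \<le> (\<Sum>j\<in>UNIV. \<bar>dx j g z\<bar> * \<bar>conv (\<kappa> k) (VJ j) z - VJ j z\<bar>) + \<bar>g z\<bar> * \<bar>conv (\<kappa> k) DJ z - DJ z\<bar>"
          unfolding eq abs_mult[symmetric] by (rule order_trans[OF abs_triangle_ineq add_right_mono]) (rule sum_abs)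
        also have "\<dots> \<le> (\<Sum>j\<in>UNIV. G * \<bar>conv (\<kappa> k) (VJ j) z - VJ j z\<bar>) + G * \<bar>conv (\<kappa> k) DJ z - DJ z\<bar>"
          using G[OF zC] by (intro add_mono sum_mono mult_right_mono) auto
        finally have "ennreal \<bar>Hk k (fst z) (snd z) - Hb g (fst z) (snd z)\<bar>
          \<le> ennreal ((\<Sum>j\<in>UNIV. G * \<bar>conv (\<kappa> k) (VJ j) z - VJ j z\<bar>) + G * \<bar>conv (\<kappa> k) DJ z - DJ z\<bar>)"
          by (rule ennreal_leI)
        also have "\<dots> = (\<Sum>j\<in>UNIV. ennreal (G * \<bar>conv (\<kappa> k) (VJ j) z - VJ j z\<bar>)) + ennreal (G * \<bar>conv (\<kappa> k) DJ z - DJ z\<bar>)"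
          using G0' by (subst ennreal_plus) (auto simp: sum_nonneg sum_ennreal)
        also have "\<dots> = (\<Sum>j\<in>UNIV. ennreal G * ennreal \<bar>conv (\<kappa> k) (VJ j) z - VJ j z\<bar>) + ennreal G * ennreal \<bar>conv (\<kappa> k) DJ z - DJ z\<bar>"
          using G0' by (simp add: ennreal_mult)
        finally show ?thesis using True by simp
      qed simp
    qed
    also have "\<dots> = (\<Sum>j\<in>UNIV. ennreal G * a k j) + ennreal G * d k"
      unfolding a_def d_def using cV cD by (simp add: nn_integral_add nn_integral_sum nn_integral_cmult)
    finally show ?thesis .
  qed
  have "(\<lambda>k. (\<Sum>j\<in>UNIV. ennreal G * a k j) + ennreal G * d k) \<longlonglongrightarrow> (\<Sum>j\<in>(UNIV::3 set). ennreal G * 0) + ennreal G * 0"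
    unfolding a_def d_def
    by (intro tendsto_add tendsto_sum ennreal_tendsto_cmult conv_tendsto_L1 VJ_integrable DJ_integrable) (simp_all add: less_top[symmetric])
  then have "(\<lambda>k. (\<Sum>j\<in>UNIV. ennreal G * a k j) + ennreal G * d k) \<longlonglongrightarrow> 0" by simp
  then show ?thesis
    by (rule tendsto_sandwich[OF _ _ tendsto_const, rotated 2]) (use le in auto)
qed

lemma transport_preimage:
  assumes g: "Ck 1 g" and s: "s \<in> I" and t: "t \<in> I" and A: "A \<in> sets borel" "A \<subseteq> Om"
  shows "set_integrable lborel I (\<lambda>r. LINT x|lebesgue. indicator A (That s r x) * Hb g r x)"
    and "(LINT x|lebesgue. indicator A (That s t x) * g (t, x)) = (LINT x|lebesgue. indicator A x * g (s, x))
       + (LBINT r=s..t. (LINT x|lebesgue. indicator A (That s r x) * Hb g r x))"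
proof -
  interpret L: transport_limit T0 T1 s t c R "That s" "Hb g" g
    by (rule transport_limit_Hb[OF g s t])
  have "L.Q (indicator (A \<inter> ball c R))"
  proof (rule L.Q_borel[OF _ A(1)])
    fix \<phi> :: "real^3 \<Rightarrow> real" and \<Lambda>
    assume \<phi>: "\<And>x y. \<bar>\<phi> x - \<phi> y\<bar> \<le> \<Lambda> * norm (x - y)" "\<And>x. x \<notin> ball c R \<Longrightarrow> \<phi> x = 0"
    define Hk where "Hk k r x = dt g (r, x) + (\<Sum>j\<in>UNIV. dx j g (r, x) * bk k r x $ j) + g (r, x) * conv (\<kappa> k) DJ (r, x)" for k r x
    have *: "continuous_on UNIV (Xk k s r) \<and> (x \<notin> ball c R \<longrightarrow> Xk k s r x = x)" if "r \<in> I" for k r x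
    proof -
      obtain L M where "smooth_flow (bk k) (Dbk k) T0 T1 L M c R (Xk k)" using smooth_flow_k by blast
      then interpret S: smooth_flow "bk k" "Dbk k" T0 T1 L M c R "Xk k" .
      show ?thesis using S.flow_continuous[OF s that] S.flow_outside[OF _ s that] by blast
    qed
    have **: "continuous_on (I \<times> UNIV) (\<lambda>(r, x). \<phi> (Xk k s r x)) \<and> continuous_on (I \<times> UNIV) (\<lambda>(r, x). Hk k r x)
       \<and> continuous_on I (\<lambda>r. LINT x|lborel. \<phi> (Xk k s r x) * Hk k r x) \<and>
       (LINT x|lborel. \<phi> (Xk k s t x) * g (t, x)) = (LINT x|lborel. \<phi> x * g (s, x)) +
         (LBINT r=s..t. (LINT x|lborel. \<phi> (Xk k s r x) * Hk k r x))" for k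
    proof -
      obtain L M where "smooth_flow (bk k) (Dbk k) T0 T1 L M c R (Xk k)" using smooth_flow_k by blast
      then interpret S: smooth_flow "bk k" "Dbk k" T0 T1 L M c R "Xk k" .
      have HkS: "Hk k = (\<lambda>r x. dt g (r, x) + (\<Sum>j\<in>UNIV. dx j g (r, x) * bk k r x $ j) + g (r, x) * S.divb r x)"
        by (simp add: fun_eq_iff Hk_def S.divb_def Dbk_diagonal)
      have Hc: "continuous_on (I \<times> UNIV) (\<lambda>(r, x). Hk k r x)"
        unfolding HkS by (rule S.transport_rhs_continuous[OF g])
      \<comment> \<open>The constant density 1 extracts the joint continuity of the observable
        itself from the lemma on products.\<close>
      have one: "continuous_on (I \<times> UNIV) (\<lambda>(r::real, x::real^3). 1::real)"
        by (rule continuous_on_eq[OF continuous_on_const[of _ 1]]) auto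
      from S.transport_integrand_continuous(1)[OF \<phi> s one] have 1: "continuous_on (I \<times> UNIV) (\<lambda>(r, x). \<phi> (Xk k s r x))" by simp
      show ?thesis
        using 1 Hc S.transport_integrand_continuous(2)[OF \<phi> s Hc] S.transport[OF \<phi> g s t] unfolding HkS by blast
    qed
    show "L.Q \<phi>"
    proof (rule L.Q_lipschitz_limit[OF \<phi>, where T="\<lambda>k r. Xk k s r" and Hk=Hk])
      show "(\<lambda>k. \<integral>\<^sup>+z. ennreal \<bar>Hk k (fst z) (snd z) - Hb g (fst z) (snd z)\<bar> * indicator (I \<times> ball c R) z \<partial>lborel) \<longlonglongrightarrow> 0"
        unfolding Hk_def by (rule Hk_L1[OF g])
      show "subseq_AE_lim lebesgue (\<lambda>k. Xk k s r) (That s r)" if "r \<in> I" for r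
        by (rule Xk_subseq_AE_lim[OF s that])
    qed (use * ** in blast)+
  qed
  moreover have "A \<inter> ball c R = A" using A(2) K_sup closure_subset by blast
  ultimately have Q: "L.Q (indicator A)" by simp
  have ad: "L.admissible 1 (indicator A)"
    using L.admissible_indicator[OF A(1)] \<open>A \<inter> ball c R = A\<close> by simp
  show "set_integrable lborel I (\<lambda>r. LINT x|lebesgue. indicator A (That s r x) * Hb g r x)"
    using L.V_interval_integrable[OF ad] Q unfolding L.Q_def L.V_def[abs_def] by blast
  show "(LINT x|lebesgue. indicator A (That s t x) * g (t, x)) = (LINT x|lebesgue. indicator A x * g (s, x))
       + (LBINT r=s..t. (LINT x|lebesgue. indicator A (That s r x) * Hb g r x))"
    using Q unfolding L.Q_def L.V_def by blast
qed

end

section \<open>From the limit identity to preimages and images under the flow map\<close>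

context flow_setup
begin

text \<open>The margin 1 keeps the window nondegenerate when \<open>s = t\<close>.\<close>

lemma flow_interval_enclosing: "flow_interval Om v Dv c R \<epsilon> Xk X (min s t - 1) (max s t + 1)"
  by unfold_locales (simp add: min_def max_def)

lemma reynolds_preimage:
  fixes s t :: real
  assumes g: "Ck 1 g" and A: "A \<in> sets borel" "A \<subseteq> Om"
  defines "F \<equiv> \<lambda>r. LINT x:{y \<in> Om. X s r y \<in> A}|lebesgue. Hs g r x"
  shows "interval_lebesgue_integrable lebesgue (ereal s) (ereal t) F"
    and "(LINT x:{y \<in> Om. X s t y \<in> A}|lebesgue. g (t, x)) = (LINT x:A|lebesgue. g (s, x))
      + interval_lebesgue_integral lebesgue (ereal s) (ereal t) F"
proof -
  interpret W: flow_interval Om v Dv c R \<epsilon> Xk X "min s t - 1" "max s t + 1"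
    by (rule flow_interval_enclosing)
  have s: "s \<in> W.I" and t: "t \<in> W.I" by auto
  \<comment> \<open>Points outside \<open>Om\<close> are fixed by \<open>That\<close>, and
    \<open>A\<close> lies in \<open>Om\<close>, so the extension adds no point to the
    preimage.\<close>
  have ind: "indicator A (That s r x) = (indicator {y \<in> Om. X s r y \<in> A} x :: real)" for r x
    using A(2) by (auto simp: That_def indicator_def)
  have "AE r in lborel. (LINT x|lebesgue. indicator A (That s r x) * Hb g r x) = F r"
    using Hb_AE[of g]
  proof eventually_elim
    case (elim r)
    show ?case
      unfolding F_def set_lebesgue_integral_def ind
    proof (rule completion.integral_cong_AE')
      show "AE x in lebesgue. indicator {y \<in> Om. X s r y \<in> A} x * Hb g r x = indicat_real {y \<in> Om. X s r y \<in> A} x *\<^sub>R Hs g r x"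
        using AE_completion[OF elim] by eventually_elim (auto simp: indicator_def)
    qed
  qed
  note cong = interval_integral_lebesgue_cong_AE[OF s t W.transport_preimage(1)[OF g s t A] this]
  show "interval_lebesgue_integrable lebesgue (ereal s) (ereal t) F" by (rule cong(1))
  show "(LINT x:{y \<in> Om. X s t y \<in> A}|lebesgue. g (t, x)) = (LINT x:A|lebesgue. g (s, x))
      + interval_lebesgue_integral lebesgue (ereal s) (ereal t) F"
    using W.transport_preimage(2)[OF g s t A] unfolding cong(2) set_lebesgue_integral_def
    by (simp add: ind)
qed

text \<open>A point of \<open>A - N\<close> returns to itself under \<open>X t r\<close> by the
  choice of \<open>N\<close>, so its image lies in the preimage once boundary points are discarded.
  Conversely almost every \<open>y\<close> in \<open>Om\<close> is the image of
  \<open>X t r y\<close>, and bounded compression ensures that this point avoids \<open>N\<close>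
  for almost every \<open>y\<close>.\<close>

lemma image_AE_eq_preimage:
  assumes A: "A \<subseteq> Om" and N: "N \<in> null_sets lebesgue"
    and inv: "(A - N) \<inter> {x \<in> Om. X t r (X r t x) \<noteq> x} = {}"
  shows "AE x in lebesgue. x \<in> X r t ` (A - N) \<longleftrightarrow> x \<in> {y \<in> Om. X t r y \<in> A}"
proof -
  interpret W: flow_interval Om v Dv c R \<epsilon> Xk X "min r t - 1" "max r t + 1"
    by (rule flow_interval_enclosing)
  have r: "r \<in> W.I" and t: "t \<in> W.I" by auto
  have "AE x in lebesgue. x \<notin> N" using N by (rule AE_not_in)
  \<comment> \<open>This is where compression is indispensable: the preimage of the null set
    \<open>N\<close> is null.\<close>
  then have "AE x in lebesgue. That t r x \<notin> N" by (rule compressing_AE[OF W.compressing_That[OF t r]])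
  moreover have "AE x in lebesgue. x \<notin> closure Om - Om" by (rule AE_not_in[OF closure_Om_null])
  moreover note W.That_inverse[OF t r]
  ultimately show ?thesis
  proof eventually_elim
    case (elim y)
    show ?case
    proof
      assume "y \<in> X r t ` (A - N)"
      then obtain x where x: "x \<in> A" "x \<notin> N" "y = X r t x" by blast
      have xO: "x \<in> Om" using x(1) A by blast
      then have "X t r y = x" using inv x by blast
      \<comment> \<open>\<open>X_range\<close> places \<open>y\<close> in the closure of
        \<open>Om\<close> only; the boundary has been discarded as a null set.\<close>
      moreover have "y \<in> Om" using X_range[OF xO, of r t] x(3) elim(2) by blast
      ultimately show "y \<in> {y \<in> Om. X t r y \<in> A}" using x(1) by blast
    next
      assume y: "y \<in> {y \<in> Om. X t r y \<in> A}"
      then have yO: "y \<in> Om" and yA: "X t r y \<in> A" by auto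
      have "y \<in> ball c R" using yO K_sup closure_subset by blast
      then have "That r t (That t r y) = y" using elim(3) by blast
      then have "X r t (X t r y) = y" using yO yA A by (auto simp: That_def)
      moreover have "X t r y \<notin> N" using elim(1) yO by (simp add: That_def)
      ultimately show "y \<in> X r t ` (A - N)" using yA by (metis DiffI imageI)
    qed
  qed
qed

lemma set_integral_image_eq_preimage:
  fixes f :: "real^3 \<Rightarrow> real"
  assumes "A \<subseteq> Om" "N \<in> null_sets lebesgue" "(A - N) \<inter> {x \<in> Om. X t r (X r t x) \<noteq> x} = {}"
  shows "(LINT x:(X r t ` (A - N))|lebesgue. f x) = (LINT x:{y \<in> Om. X t r y \<in> A}|lebesgue. f x)"
  unfolding set_lebesgue_integral_def
proof (rule completion.integral_cong_AE')
  show "AE x in lebesgue. indicat_real (X r t ` (A - N)) x *\<^sub>R f x = indicat_real {y \<in> Om. X t r y \<in> A} x *\<^sub>R f x"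
    using image_AE_eq_preimage[OF assms]
  proof eventually_elim
    case (elim x)
    then show ?case by (simp only: indicator_def)
  qed
qed

end

lemma measure_eq_set_integral_one: "measure lebesgue S = (LINT x:S|lebesgue. (1::real))" for S :: "'a::euclidean_space set"
  by (simp add: set_lebesgue_integral_def)

theorem theorem1p2:
  fixes Om :: "(real^3) set"
    and v :: "real \<Rightarrow> real^3 \<Rightarrow> real^3"
    and Dv :: "real \<Rightarrow> real^3 \<Rightarrow> real^3^3"
    and K :: "(real^3) set" and c :: "real^3" and R :: real
    and \<epsilon> :: "nat \<Rightarrow> real"
    and Xk :: "nat \<Rightarrow> real \<Rightarrow> real \<Rightarrow> real^3 \<Rightarrow> real^3"
    and X :: "real \<Rightarrow> real \<Rightarrow> real^3 \<Rightarrow> real^3"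
    and A :: "(real^3) set"
    and N :: "real \<Rightarrow> real \<Rightarrow> (real^3) set"
    and g :: "real \<times> (real^3) \<Rightarrow> real"
    and s t :: real
  assumes Om_open: "open Om" and Om_bdd: "bounded Om" and Om_conn: "connected Om"
    and Om_meas: "emeasure lebesgue Om = emeasure lebesgue (closure Om)"
    \<comment> \<open>v is extended by 0 outside R x Om\<close>
    and v_zero: "\<And>r x. x \<notin> Om \<Longrightarrow> v r x = 0"
    and v_L1: "\<And>T0 T1 i. T0 < T1 \<Longrightarrow>
        set_integrable lebesgue ({T0..T1} \<times> Om) (\<lambda>(r, x). v r x $ i)"
    and Dv_L1: "\<And>T0 T1 i j. T0 < T1 \<Longrightarrow>
        set_integrable lebesgue ({T0..T1} \<times> Om) (\<lambda>(r, x). Dv r x $ i $ j)"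
    and Dv_weak: "\<And>\<phi> i j. test_fun \<phi> (UNIV \<times> Om) \<Longrightarrow>
        (LINT z|lebesgue. (case z of (r, x) \<Rightarrow> v r x $ i) * dx j \<phi> z)
          = - (LINT z|lebesgue. (case z of (r, x) \<Rightarrow> Dv r x $ i $ j) * \<phi> z)"
    and v_W011_0: "\<And>i. AE r in lborel. W011_0 Om (\<lambda>x. v r x $ i) (\<lambda>j x. Dv r x $ i $ j)"
    and div_Linf: "\<And>T0 T1. T0 < T1 \<Longrightarrow>
        (\<integral>\<^sup>+ r. e2ennreal (esssup (restrict_space lebesgue Om) (\<lambda>x. ereal \<bar>wdiv Dv r x\<bar>))
           * indicator {T0..T1} r \<partial>lborel) < \<infinity>"
    \<comment> \<open>approximating flows\<close>
    and K_ball: "K = ball c R" and K_sup: "closure Om \<subseteq> K"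
    and eps_pos: "\<And>k. \<epsilon> k > 0" and eps_dec: "decseq \<epsilon>" and eps_lim: "\<epsilon> \<longlonglongrightarrow> 0"
    and eps_small: "\<And>x. x \<in> closure Om \<Longrightarrow> cball x (\<epsilon> 0) \<subseteq> K"
    and Xk_init: "\<And>k r \<xi>. Xk k r r \<xi> = \<xi>"
    and Xk_ode: "\<And>k r r' \<xi>. ((\<lambda>q. Xk k q r \<xi>) has_vector_derivative
         mollify (\<epsilon> k) (\<lambda>(q, y). v q y) (r', Xk k r' r \<xi>)) (at r')"
    \<comment> \<open>the flow map X\<close>
    and X_range: "\<And>r q x. x \<in> Om \<Longrightarrow> X r q x \<in> closure Om"
    and X_meas: "\<And>q. set_borel_measurable lebesgue (UNIV \<times> Om) (\<lambda>(r, x). X r q x)"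
    and X_meas': "\<And>r q. set_borel_measurable lebesgue Om (X r q)"
    and X_lim: "\<And>r q. (\<lambda>k. LINT x:Om|lebesgue. (norm (Xk k r q x - X r q x))\<^sup>2) \<longlonglongrightarrow> 0"
    \<comment> \<open>the Borel set A and the regular co-moving volume\<close>
    and A_sub: "A \<subseteq> Om" and A_borel: "A \<in> sets borel"
    and N_null: "\<And>r q. N r q \<in> null_sets lebesgue"
    and N_meas: "\<And>r q. X r q ` (A - N r q) \<in> sets lebesgue"
    and N_E: "\<And>r q. (A - N r q) \<inter> {x \<in> Om. X q r (X r q x) \<noteq> x} = {}"
    \<comment> \<open>the test function g\<close>
    and g_C1: "Ck 1 g"
  shows
    "(let H = (\<lambda>r x. dt g (r, x) + (\<Sum>j\<in>UNIV. dx j g (r, x) * (v r x $ j))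
                     + g (r, x) * wdiv Dv r x);
          F1 = (\<lambda>r. LINT x:(X r t ` (A - N r t))|lebesgue. H r x);
          F2 = (\<lambda>r. LINT x:{y \<in> Om. X s r y \<in> A}|lebesgue. H r x);
          G1 = (\<lambda>r. LINT x:(X r t ` (A - N r t))|lebesgue. wdiv Dv r x);
          G2 = (\<lambda>r. LINT x:{y \<in> Om. X s r y \<in> A}|lebesgue. wdiv Dv r x)
      in interval_lebesgue_integrable lebesgue (ereal t) (ereal s) F1
       \<and> (LINT x:(X s t ` (A - N s t))|lebesgue. g (s, x))
           = (LINT x:A|lebesgue. g (t, x)) + interval_lebesgue_integral lebesgue (ereal t) (ereal s) F1
       \<and> interval_lebesgue_integrable lebesgue (ereal s) (ereal t) F2
       \<and> (LINT x:{y \<in> Om. X s t y \<in> A}|lebesgue. g (t, x))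
           = (LINT x:A|lebesgue. g (s, x)) + interval_lebesgue_integral lebesgue (ereal s) (ereal t) F2
       \<and> interval_lebesgue_integrable lebesgue (ereal t) (ereal s) G1
       \<and> measure lebesgue (X s t ` (A - N s t))
           = measure lebesgue A + interval_lebesgue_integral lebesgue (ereal t) (ereal s) G1
       \<and> interval_lebesgue_integrable lebesgue (ereal s) (ereal t) G2
       \<and> measure lebesgue {y \<in> Om. X s t y \<in> A}
           = measure lebesgue A + interval_lebesgue_integral lebesgue (ereal s) (ereal t) G2)"
proof -
  have flow: "flow_setup Om v Dv c R \<epsilon> Xk X"
    by unfold_locales
       (use Om_open Om_bdd Om_meas v_zero v_L1 Dv_L1 v_W011_0 div_Linf K_sup eps_pos eps_dec eps_lim
          eps_small Xk_init Xk_ode X_range X_meas' X_lim in \<open>simp_all add: K_ball del: mem_ball\<close>)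
  interpret flow_setup Om v Dv c R \<epsilon> Xk X by (rule flow)
  have Hs_eq: "Hs g = (\<lambda>r x. dt g (r, x) + (\<Sum>j\<in>UNIV. dx j g (r, x) * (v r x $ j)) + g (r, x) * wdiv Dv r x)"
    by (simp add: fun_eq_iff Hs_def)
  \<comment> \<open>The two volume formulas are the case \<open>g = 1\<close>, where the density
    reduces to the divergence.\<close>
  have Hs_one: "Hs (\<lambda>z. 1) = (\<lambda>r x. wdiv Dv r x)"
    by (simp add: fun_eq_iff Hs_def dt_one dx_one)
  have image: "(LINT x:(X r q ` (A - N r q))|lebesgue. f x) = (LINT x:{y \<in> Om. X q r y \<in> A}|lebesgue. f x)"
    for r q and f :: "real^3 \<Rightarrow> real"
    by (rule set_integral_image_eq_preimage[OF A_sub N_null N_E])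
  \<comment> \<open>The image under \<open>X r t\<close> corresponds to the preimage under
    \<open>X t r\<close>, so the formulas for images are those for preimages with \<open>s\<close>
    and \<open>t\<close> exchanged.\<close>
  note g1 = reynolds_preimage[OF g_C1 A_borel A_sub, of t s, unfolded Hs_eq]
  note g2 = reynolds_preimage[OF g_C1 A_borel A_sub, of s t, unfolded Hs_eq]
  note m1 = reynolds_preimage[OF Ck_1_one A_borel A_sub, of t s, unfolded Hs_one]
  note m2 = reynolds_preimage[OF Ck_1_one A_borel A_sub, of s t, unfolded Hs_one]
  show ?thesis
    unfolding Let_def measure_eq_set_integral_one image
    using g1 g2 m1 m2 by blast
qed

end
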